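(* Let $\mathcal{H}$ be a separable complex Hilbert space and let $\Omega\subset\mathcal{H}$ be a domain. Suppose there exist a boundary point $p\in\partial\Omega$ at which $\Omega$ is ($C^2$) strongly pseudoconvex, a point $q\in\Omega$, and a sequence $\{\varphi_j\}\subset\operatorname{Aut}(\Omega)$ such that $\lim_{j\to\infty}\|\varphi_j(q)-p\|=0$. Then $\Omega$ is biholomorphic to the open unit ball $\{z\in\mathcal{H} : \|z\|<1\}$ of $\mathcal{H}$.
   Context: A domain is an open connected subset (not assumed bounded) of a Banach space. A map $u$ from an open subset of a complex Banach space to a Banach space has directional derivatives $du(p;v_1)=\lim_{\mathbb{R}\ni r\to0}\frac1r(u(p+rv_1)-u(p))$ and inductively $d^ku(p;v_1,\dots,v_k)=\lim_{\mathbb{R}\ni r\to0}\frac1r\left(d^{k-1}u(p+rv_k;v_1,\dots,v_{k-1})-d^{k-1}u(p;v_1,\dots,v_{k-1})\right)$; $u$ is $C^k$ if the derivatives up to order $k$ exist and are continuous multilinear tensors (depending continuously on the base point). Set $\partial u(p;v)=\frac12(du(p;v)-i\,du(p;iv))$ and $\bar\partial u(p;v)=\frac12(du(p;v)+i\,du(p;iv))$. A holomorphic mapping is a $C^1$ map $u$ with $\bar\partial u=0$. For a real-valued $C^2$ function $\rho$, $\partial\bar\partial\rho(p;v,v)$ denotes the Levi form (complex Hessian), i.e. $\partial\bar\partial\rho(p;v,v)=\frac14\left(d^2\rho(p;v,v)+d^2\rho(p;iv,iv)\right)$ (the positive normalizing factor is immaterial). $\operatorname{Aut}(\Omega)$ is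 the group of automorphisms of $\Omega$, i.e. bijective holomorphic maps $\Omega\to\Omega$ with holomorphic inverse. Two domains are biholomorphic if there is a bijective holomorphic map between them with holomorphic inverse. A domain $\Omega$ in a Banach space $\mathbb{E}$ is strongly pseudoconvex at $p\in\partial\Omega$ if there are an open neighborhood $U$ of $p$ and a $C^2$ function $\rho:U\to\mathbb{R}$ such that: (i) $\Omega\cap U=\{z\in U:\rho(z)<0\}$; (ii) $\partial\Omega\cap U=\{z\in U:\rho(z)=0\}$; (iii) $d\rho(q;\cdot)$ is a non-zero functional for every $q\in\partial\Omega\cap U$; (iv) there is a constant $C>0$ such that $\partial\bar\partial\rho(p;v,v)\ge C\|v\|^2$ for every $v\in\mathbb{E}$ with $\partial\rho(p;v)=0$. *)

theory Defs
  imports "HOL-Analysis.Analysis"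
begin

section \<open>Complex normed, Banach and Hilbert spaces\<close>

text \<open>Complex spaces are real ones with a compatible complex scalar multiplication, so that
  limits, real differentiation and bounded real-linear maps are those of the library.\<close>

class complex_vector = real_vector +
  fixes scaleC :: "complex \<Rightarrow> 'a \<Rightarrow> 'a" (infixr "*\<^sub>C" 75)
  assumes scaleC_add_right: "a *\<^sub>C (x + y) = a *\<^sub>C x + a *\<^sub>C y"
    and scaleC_add_left: "(a + b) *\<^sub>C x = a *\<^sub>C x + b *\<^sub>C x"
    and scaleC_scaleC: "a *\<^sub>C (b *\<^sub>C x) = (a * b) *\<^sub>C x"
    and scaleC_of_real: "complex_of_real r *\<^sub>C x = r *\<^sub>R x"

class complex_normed_vector = complex_vector + real_normed_vector +
  assumes norm_scaleC: "norm (a *\<^sub>C x) = norm a * norm x"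

class complex_banach = complex_normed_vector + complete_space

text \<open>The inner product is conjugate-linear in its first argument. Positive definiteness
  and nonnegativity follow from \<open>cinner_self\<close> and the properties of the norm.\<close>

class complex_inner = complex_normed_vector +
  fixes cinner :: "'a \<Rightarrow> 'a \<Rightarrow> complex"
  assumes cinner_commute: "cinner x y = cnj (cinner y x)"
    and cinner_add_right: "cinner x (y + z) = cinner x y + cinner x z"
    and cinner_scaleC_right: "cinner x (a *\<^sub>C y) = a * cinner x y"
    and cinner_self: "cinner x x = complex_of_real ((norm x)\<^sup>2)"

class complex_hilbert = complex_inner + complete_space

subclass (in complex_hilbert) complex_banach ..

instantiation complex :: complex_hilbert
begin

definition scaleC_complex :: "complex \<Rightarrow> complex \<Rightarrow> complex"
  where "scaleC_complex a z = a * z"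

definition cinner_complex :: "complex \<Rightarrow> complex \<Rightarrow> complex"
  where "cinner_complex x y = cnj x * y"

instance
proof
  fix a b x y z :: complex and r :: real
  show "a *\<^sub>C (x + y) = a *\<^sub>C x + a *\<^sub>C y" "(a + b) *\<^sub>C x = a *\<^sub>C x + b *\<^sub>C x"
    "a *\<^sub>C b *\<^sub>C x = (a * b) *\<^sub>C x" "complex_of_real r *\<^sub>C x = r *\<^sub>R x"
    by (simp_all add: scaleC_complex_def algebra_simps scaleR_conv_of_real)
  show "norm (a *\<^sub>C x) = norm a * norm x"
    by (simp add: scaleC_complex_def norm_mult)
  show "cinner x y = cnj (cinner y x)" "cinner x (y + z) = cinner x y + cinner x z"
    "cinner x (a *\<^sub>C y) = a * cinner x y"
    by (simp_all add: cinner_complex_def scaleC_complex_def algebra_simps)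
  show "cinner x x = complex_of_real ((norm x)\<^sup>2)"
    by (simp only: cinner_complex_def complex_norm_square mult.commute)
qed

end

section \<open>Directional derivatives and smoothness\<close>

text \<open>Maps on an open set are total functions; their values off the set play no role.\<close>

definition diff_quot :: "('a::real_normed_vector \<Rightarrow> 'b::real_normed_vector) \<Rightarrow> 'a \<Rightarrow> 'a \<Rightarrow> real \<Rightarrow> 'b"
  where "diff_quot u p v r = (1 / r) *\<^sub>R (u (p + r *\<^sub>R v) - u p)"

definition dir_deriv :: "('a::real_normed_vector \<Rightarrow> 'b::real_normed_vector) \<Rightarrow> 'a \<Rightarrow> 'a \<Rightarrow> 'b"
  where "dir_deriv u p v = Lim (at 0) (diff_quot u p v)"

definition dir_deriv2 :: "('a::real_normed_vector \<Rightarrow> 'b::real_normed_vector) \<Rightarrow> 'a \<Rightarrow> 'a \<Rightarrow> 'a \<Rightarrow> 'b"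
  where "dir_deriv2 u p v w = dir_deriv (\<lambda>q. dir_deriv u q v) p w"

text \<open>The derivatives are required to exist as limits, to be bounded (multi)linear in the
  directions, and to depend continuously on the base point in the operator norm.\<close>

definition C1_on :: "('a::real_normed_vector \<Rightarrow> 'b::real_normed_vector) \<Rightarrow> 'a set \<Rightarrow> bool"
  where "C1_on u S \<longleftrightarrow> (\<exists>D :: 'a \<Rightarrow> 'a \<Rightarrow>\<^sub>L 'b. continuous_on S D \<and>
    (\<forall>p\<in>S. \<forall>v. (diff_quot u p v \<longlongrightarrow> blinfun_apply (D p) v) (at 0)))"

definition C2_on :: "('a::real_normed_vector \<Rightarrow> 'b::real_normed_vector) \<Rightarrow> 'a set \<Rightarrow> bool"
  where "C2_on u S \<longleftrightarrow> C1_on u S \<and>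
    (\<exists>D2 :: 'a \<Rightarrow> 'a \<Rightarrow>\<^sub>L 'a \<Rightarrow>\<^sub>L 'b. continuous_on S D2 \<and>
      (\<forall>p\<in>S. \<forall>v w. (diff_quot (\<lambda>q. dir_deriv u q v) p w
          \<longlongrightarrow> blinfun_apply (blinfun_apply (D2 p) v) w) (at 0)))"

section \<open>Holomorphic mappings\<close>

definition del :: "('a::complex_normed_vector \<Rightarrow> 'b::complex_normed_vector) \<Rightarrow> 'a \<Rightarrow> 'a \<Rightarrow> 'b"
  where "del u p v = (1/2) *\<^sub>C (dir_deriv u p v - \<i> *\<^sub>C dir_deriv u p (\<i> *\<^sub>C v))"

definition delbar :: "('a::complex_normed_vector \<Rightarrow> 'b::complex_normed_vector) \<Rightarrow> 'a \<Rightarrow> 'a \<Rightarrow> 'b"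
  where "delbar u p v = (1/2) *\<^sub>C (dir_deriv u p v + \<i> *\<^sub>C dir_deriv u p (\<i> *\<^sub>C v))"

definition holomorphic_map_on ::
    "('a::complex_banach \<Rightarrow> 'b::complex_banach) \<Rightarrow> 'a set \<Rightarrow> bool"
  where "holomorphic_map_on u S \<longleftrightarrow> C1_on u S \<and> (\<forall>p\<in>S. \<forall>v. delbar u p v = 0)"

definition biholomorphism ::
    "('a::complex_banach \<Rightarrow> 'b::complex_banach) \<Rightarrow> 'a set \<Rightarrow> 'b set \<Rightarrow> bool"
  where "biholomorphism f S T \<longleftrightarrow> bij_betw f S T \<and>
    holomorphic_map_on f S \<and> holomorphic_map_on (inv_into S f) T"

definition biholomorphic :: "'a::complex_banach set \<Rightarrow> 'b::complex_banach set \<Rightarrow> bool"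
  where "biholomorphic S T \<longleftrightarrow> (\<exists>f. biholomorphism f S T)"

definition Aut :: "'a::complex_banach set \<Rightarrow> ('a \<Rightarrow> 'a) set"
  where "Aut S = {f. biholomorphism f S S}"

section \<open>Strong pseudoconvexity\<close>

definition complex_domain :: "'a::complex_banach set \<Rightarrow> bool"
  where "complex_domain S \<longleftrightarrow> open S \<and> connected S"

definition levi_form :: "('a::complex_normed_vector \<Rightarrow> real) \<Rightarrow> 'a \<Rightarrow> 'a \<Rightarrow> real"
  where "levi_form \<rho> p v =
    (1/4) * (dir_deriv2 \<rho> p v v + dir_deriv2 \<rho> p (\<i> *\<^sub>C v) (\<i> *\<^sub>C v))"

definition strongly_pseudoconvex_at :: "'a::complex_banach set \<Rightarrow> 'a \<Rightarrow> bool"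
  where "strongly_pseudoconvex_at \<Omega> p \<longleftrightarrow> p \<in> frontier \<Omega> \<and>
    (\<exists>U (\<rho> :: 'a \<Rightarrow> real). open U \<and> p \<in> U \<and> C2_on \<rho> U \<and>
      \<Omega> \<inter> U = {z \<in> U. \<rho> z < 0} \<and>
      frontier \<Omega> \<inter> U = {z \<in> U. \<rho> z = 0} \<and>
      (\<forall>q \<in> frontier \<Omega> \<inter> U. \<exists>v. dir_deriv \<rho> q v \<noteq> 0) \<and>
      (\<exists>C>0. \<forall>v. del (\<lambda>z. complex_of_real (\<rho> z)) p v = 0 \<longrightarrow>
        levi_form \<rho> p v \<ge> C * (norm v)\<^sup>2))"

end

theory Submission
  imports Defs "HOL-Complex_Analysis.Complex_Analysis"
begin

text \<open>Near \<open>p\<close> the domain \<open>\<Omega>\<close> lies between two small perturbations of a paraboloid, in coordinates centred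
  at any point \<open>a \<in> \<Omega>\<close> close to \<open>p\<close>. A polynomial automorphism of the Hilbert space followed by a
  scaled Cayley transform therefore embeds \<open>\<Omega> \<inter> U\<close> into the unit ball, sends \<open>a\<close> to \<open>0\<close>, and has an image
  containing the ball of radius \<open>1 - \<epsilon>\<close>, where \<open>\<epsilon> \<rightarrow> 0\<close> as \<open>a \<rightarrow> p\<close> and \<open>U\<close> shrinks to \<open>p\<close>. Let \<open>f\<^sub>j\<close> be the
  composition of this map for \<open>a = \<phi>\<^sub>j q\<close> with \<open>\<phi>\<^sub>j\<close>.

  A holomorphic peak function at \<open>p\<close> and the maximum principle show that holomorphic discs in \<open>\<Omega>\<close> centred near \<open>p\<close>
  stay near \<open>p\<close> on smaller concentric discs, although \<open>\<Omega>\<close> may be unbounded. Hence the domains of the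
  \<open>f\<^sub>j\<close> exhaust \<open>\<Omega>\<close>, and \<open>f\<^sub>j \<circ> f\<^sub>k\<^sup>-\<^sup>1\<close> maps balls of radius close to \<open>1\<close> into the unit ball.

  By the Schwarz lemma the forms \<open>\<bar>df\<^sub>j (q) v\<bar>\<^sup>2\<close> converge. After composing \<open>f\<^sub>j\<close> with suitable unitary operators the
  derivatives \<open>df\<^sub>j (q)\<close> converge in norm, and a quantitative form of Cartan's uniqueness theorem gives
  \<open>f\<^sub>j \<circ> f\<^sub>k\<^sup>-\<^sup>1 \<rightarrow> id\<close> locally uniformly in norm. So \<open>f\<^sub>j\<close> and \<open>f\<^sub>j\<^sup>-\<^sup>1\<close> converge locally uniformly in norm, without
  any appeal to weak compactness, and the limits are inverse to each other.\<close>

\<comment> \<open>Closed balls are not norm compact in infinite dimension and the domain may be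
  unbounded, so normal families give no limits in norm. Convergence has to come from rigidity: the
  transition maps \<open>f j o F k\<close> fix \<open>0\<close> and send almost the whole unit ball
  into the unit ball, so the Schwarz lemma, used in both directions, pinches
  \<open>norm (A j v) / norm (A k v)\<close> towards 1 uniformly in \<open>v\<close>. This
  determines the derivatives in the limit up to a unitary factor on the left, and polar
  decomposition against the limit form removes that factor. The inverses \<open>F j\<close> take
  values in a possibly unbounded set and are never estimated directly; they are factored as
  \<open>F k o g k j\<close> with \<open>k\<close> fixed. Two uniformities carry the argument. The
  Taylor expansion holds for all centres \<open>a\<close> near \<open>p\<close> at once, with an
  error in the weight \<open>|w| + |z|^2\<close> that respects the scaling \<open>w ~ t\<close>,
  \<open>z ~ sqrt t\<close>. Localization holds for arbitrary holomorphic maps with a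
  \<open>\<delta>\<close> independent of the map, so it can be iterated along chains of
  balls.\<close>
subclass (in complex_banach) banach ..

section \<open>Algebra of complex scalars and inner products\<close>

lemma scaleC_zero_left [simp]: "0 *\<^sub>C x = 0" for x :: "'a::complex_vector"
  using scaleC_of_real[of 0 x] by simp

lemma scaleC_zero_right [simp]: "a *\<^sub>C (0::'a::complex_vector) = 0"
  using scaleC_add_right[of a "0::'a" 0] by simp

lemma scaleC_one [simp]: "1 *\<^sub>C x = x" for x :: "'a::complex_vector"
  using scaleC_of_real[of 1 x] by simp

lemma scaleC_minus_right [simp]: "a *\<^sub>C (- x) = - (a *\<^sub>C x)" for x :: "'a::complex_vector"
  using scaleC_add_right[of a x "-x"] by (simp add: eq_neg_iff_add_eq_0 add.commute)

lemma scaleC_minus_left [simp]: "(- a) *\<^sub>C x = - (a *\<^sub>C x)" for x :: "'a::complex_vector"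
  using scaleC_add_left[of a "-a" x] by (simp add: eq_neg_iff_add_eq_0 add.commute)

lemma scaleC_diff_right: "a *\<^sub>C (x - y) = a *\<^sub>C x - a *\<^sub>C y" for x :: "'a::complex_vector"
  using scaleC_add_right[of a x "-y"] by simp

lemma scaleC_scaleR: "a *\<^sub>C (r *\<^sub>R x) = (a * of_real r) *\<^sub>C x" for x :: "'a::complex_vector"
  by (simp flip: scaleC_of_real add: scaleC_scaleC)

lemma scaleR_scaleC: "r *\<^sub>R (a *\<^sub>C x) = (of_real r * a) *\<^sub>C x" for x :: "'a::complex_vector"
  by (simp flip: scaleC_of_real add: scaleC_scaleC)

lemma scaleC_scaleR_commute: "a *\<^sub>C (r *\<^sub>R x) = r *\<^sub>R (a *\<^sub>C x)" for x :: "'a::complex_vector"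
  by (simp add: scaleC_scaleR scaleR_scaleC mult.commute)

lemma scaleC_ii: "\<i> *\<^sub>C \<i> *\<^sub>C x = - x" for x :: "'a::complex_vector"
  by (simp add: scaleC_scaleC)

lemma scaleC_expand: "a *\<^sub>C x = Re a *\<^sub>R x + Im a *\<^sub>R (\<i> *\<^sub>C x)" for x :: "'a::complex_vector"
proof -
  have "a = of_real (Re a) + of_real (Im a) * \<i>"
    by (simp add: complex_eq_iff)
  then have "a *\<^sub>C x = (of_real (Re a) + of_real (Im a) * \<i>) *\<^sub>C x" by simp
  then show ?thesis
    by (simp add: scaleC_add_left scaleC_of_real flip: scaleC_scaleC)
qed

lemma bounded_bilinear_scaleC:
  "bounded_bilinear (scaleC :: complex \<Rightarrow> 'a \<Rightarrow> 'a::complex_normed_vector)"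
proof
  show "\<exists>K. \<forall>a (b::'a). norm (a *\<^sub>C b) \<le> norm a * norm b * K"
    by (rule exI[of _ 1]) (simp add: norm_scaleC)
qed (simp_all add: scaleC_add_left scaleC_add_right scaleC_scaleR scaleR_scaleC scaleR_conv_of_real mult.commute)

lemmas continuous_on_scaleC [continuous_intros] =
  bounded_bilinear.continuous_on[OF bounded_bilinear_scaleC]
lemmas tendsto_scaleC [tendsto_intros] = bounded_bilinear.tendsto[OF bounded_bilinear_scaleC]

lemma cinner_add_left: "cinner (x + y) z = cinner x z + cinner y z" for x :: "'a::complex_inner"
  using cinner_commute[of "x+y" z] cinner_commute[of x z] cinner_commute[of y z]
  by (simp add: cinner_add_right)

lemma cinner_scaleC_left: "cinner (a *\<^sub>C x) y = cnj a * cinner x y" for x :: "'a::complex_inner"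
  using cinner_commute[of "a *\<^sub>C x" y] cinner_commute[of x y]
  by (simp add: cinner_scaleC_right)

lemma cinner_zero_right [simp]: "cinner x 0 = 0" for x :: "'a::complex_inner"
  using cinner_scaleC_right[of x 0 0] by simp

lemma cinner_zero_left [simp]: "cinner 0 x = 0" for x :: "'a::complex_inner"
  using cinner_scaleC_left[of 0 0 x] by simp

lemma cinner_minus_right [simp]: "cinner x (- y) = - cinner x y" for x :: "'a::complex_inner"
  using cinner_scaleC_right[of x "-1" y] by simp

lemma cinner_minus_left [simp]: "cinner (- x) y = - cinner x y" for x :: "'a::complex_inner"
  using cinner_scaleC_left[of "-1" x y] by simp

lemma cinner_diff_right: "cinner x (y - z) = cinner x y - cinner x z" for x :: "'a::complex_inner"
  using cinner_add_right[of x y "-z"] by simp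

lemma cinner_diff_left: "cinner (x - y) z = cinner x z - cinner y z" for x :: "'a::complex_inner"
  using cinner_add_left[of x "-y" z] by simp

lemma cinner_scaleR_right: "cinner x (r *\<^sub>R y) = of_real r * cinner x y" for x :: "'a::complex_inner"
  using cinner_scaleC_right[of x "of_real r" y] by (simp add: scaleC_of_real)

lemma cinner_scaleR_left: "cinner (r *\<^sub>R x) y = of_real r * cinner x y" for x :: "'a::complex_inner"
  using cinner_scaleC_left[of "of_real r" x y] by (simp add: scaleC_of_real)

lemma norm_add_square: "(norm (x + y))\<^sup>2 = (norm x)\<^sup>2 + 2 * Re (cinner x y) + (norm y)\<^sup>2"
  for x :: "'a::complex_inner"
proof -
  have "complex_of_real ((norm (x+y))\<^sup>2) = of_real ((norm x)\<^sup>2) + of_real ((norm y)\<^sup>2) + (cinner x y + cnj (cinner x y))"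
    by (simp only: cinner_self[symmetric] cinner_add_left cinner_add_right cinner_commute[of y x]) (simp add: algebra_simps)
  also have "\<dots> = complex_of_real ((norm x)\<^sup>2 + 2 * Re (cinner x y) + (norm y)\<^sup>2)"
    by (simp add: complex_eq_iff)
  finally show ?thesis by (simp only: of_real_eq_iff)
qed

lemma norm_diff_square: "(norm (x - y))\<^sup>2 = (norm x)\<^sup>2 - 2 * Re (cinner x y) + (norm y)\<^sup>2"
  for x :: "'a::complex_inner"
  using norm_add_square[of x "-y"] by simp

lemma Cauchy_Schwarz_cinner: "cmod (cinner x y) \<le> norm x * norm y" for x :: "'a::complex_inner"
proof (cases "x = 0")
  case False
  define c where "c = cinner x y / of_real ((norm x)\<^sup>2)"
  have nx: "norm x > 0" using False by simp
  have "0 \<le> (norm (y - c *\<^sub>C x))\<^sup>2" by simp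
  also have "\<dots> = (norm y)\<^sup>2 - 2 * Re (cinner y (c *\<^sub>C x)) + (cmod c * norm x)\<^sup>2"
    by (simp add: norm_diff_square norm_scaleC)
  also have "cinner y (c *\<^sub>C x) = of_real ((cmod (cinner x y))\<^sup>2 / (norm x)\<^sup>2)"
    using complex_norm_square[of "cinner x y"]
    by (simp add: cinner_scaleC_right c_def cinner_commute[of y x])
  also have "(cmod c * norm x)\<^sup>2 = (cmod (cinner x y))\<^sup>2 / (norm x)\<^sup>2"
    using nx by (simp add: c_def norm_divide norm_power power_mult_distrib power_divide)
      (simp add: power2_eq_square power4_eq_xxxx)
  finally have "(cmod (cinner x y))\<^sup>2 / (norm x)\<^sup>2 \<le> (norm y)\<^sup>2" by simp
  then have "(cmod (cinner x y))\<^sup>2 \<le> (norm x * norm y)\<^sup>2"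
    using nx by (simp add: field_simps power_mult_distrib)
  then show ?thesis by (rule power2_le_imp_le) simp
qed simp

lemma bounded_bilinear_cinner:
  "bounded_bilinear (cinner :: 'a \<Rightarrow> 'a \<Rightarrow> complex)" for dummy :: "'a::complex_inner"
proof
  show "\<exists>K. \<forall>(a::'a) (b::'a). norm (cinner a b) \<le> norm a * norm b * K"
    by (rule exI[of _ 1]) (simp add: Cauchy_Schwarz_cinner)
qed (simp_all add: cinner_add_left cinner_add_right cinner_scaleR_left cinner_scaleR_right scaleR_conv_of_real)

lemmas continuous_on_cinner [continuous_intros] =
  bounded_bilinear.continuous_on[OF bounded_bilinear_cinner]

lemma parallelogram_law: "(norm (x + y))\<^sup>2 + (norm (x - y))\<^sup>2 = 2 * (norm x)\<^sup>2 + 2 * (norm y)\<^sup>2"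
  for x :: "'a::complex_inner"
  by (simp add: norm_add_square norm_diff_square)

lemma cinner_polarization:
  "cinner x y = of_real (((norm (x + y))\<^sup>2 - (norm (x - y))\<^sup>2) / 4)
     - \<i> * of_real (((norm (x + \<i> *\<^sub>C y))\<^sup>2 - (norm (x - \<i> *\<^sub>C y))\<^sup>2) / 4)"
  for x :: "'a::complex_inner"
  by (simp add: norm_add_square norm_diff_square complex_eq_iff cinner_scaleC_right)

lemma cinner_eqI: "(\<And>x. cinner x y = cinner x z) \<Longrightarrow> y = z" for y :: "'a::complex_inner"
  using cinner_self[of "y - z"] cinner_diff_right[of "y-z" y z] by simp

section \<open>Complex linear maps\<close>

definition clinear :: "('a::complex_vector \<Rightarrow> 'b::complex_vector) \<Rightarrow> bool"
  where "clinear f \<longleftrightarrow> (\<forall>x y. f (x + y) = f x + f y) \<and> (\<forall>a x. f (a *\<^sub>C x) = a *\<^sub>C f x)"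

lemma clinearI: "(\<And>x y. f (x + y) = f x + f y) \<Longrightarrow> (\<And>a x. f (a *\<^sub>C x) = a *\<^sub>C f x) \<Longrightarrow> clinear f"
  by (simp add: clinear_def)

lemma clinear_add: "clinear f \<Longrightarrow> f (x + y) = f x + f y"
  and clinear_scaleC: "clinear f \<Longrightarrow> f (a *\<^sub>C x) = a *\<^sub>C f x"
  by (simp_all add: clinear_def)

lemma clinear_linear: "clinear f \<Longrightarrow> linear f"
  by (rule linearI) (simp_all add: clinear_add clinear_scaleC flip: scaleC_of_real)

lemma clinear_diff: "clinear f \<Longrightarrow> f (x - y) = f x - f y"
  by (simp add: clinear_linear linear_diff)

lemma clinear_zero: "clinear f \<Longrightarrow> f 0 = 0"
  by (simp add: clinear_linear linear_0)

lemma clinear_compose: "clinear f \<Longrightarrow> clinear g \<Longrightarrow> clinear (\<lambda>x. f (g x))"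
  by (simp add: clinear_def)

lemma clinear_of_ii:
  assumes "linear f" and "\<And>x. f (\<i> *\<^sub>C x) = \<i> *\<^sub>C f x"
  shows "clinear f"
proof (rule clinearI)
  show "f (a *\<^sub>C x) = a *\<^sub>C f x" for a x
    using assms by (simp add: scaleC_expand[of a] linear_add linear_scale)
qed (use assms in \<open>simp add: linear_add\<close>)

lemma bounded_linear_of_clinear:
  assumes "clinear f" "\<And>x. norm (f x) \<le> K * norm x"
  shows "bounded_linear f"
  using assms by (intro bounded_linear_intro[where K=K])
    (simp_all add: clinear_add clinear_linear linear_scale mult.commute)

lemma clinear_inv:
  assumes "clinear S" "bij S"
  shows "clinear (inv S)"
proof (rule clinearI)
  have S: "S (inv S x) = x" "inv S (S y) = y" for x y
    using assms(2) by (simp_all add: bij_is_surj surj_f_inv_f bij_is_inj)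
  show "inv S (x + y) = inv S x + inv S y" for x y
    by (metis S clinear_add[OF assms(1)])
  show "inv S (a *\<^sub>C x) = a *\<^sub>C inv S x" for a x
    by (metis S clinear_scaleC[OF assms(1)])
qed

section \<open>Riesz representation\<close>

text \<open>The representing vector is a multiple of the element of least norm on the affine
  hyperplane \<open>f = 1\<close>: completeness and the parallelogram law give its existence, and
  minimality makes it orthogonal to the kernel of \<open>f\<close>.\<close>

lemma Riesz_representation:
  fixes f :: "'a::complex_hilbert \<Rightarrow> complex"
  assumes lin: "clinear f" and bd: "\<And>x. cmod (f x) \<le> K * norm x"
  shows "\<exists>y. \<forall>x. f x = cinner y x"
proof (cases "\<forall>x. f x = 0")
  case True
  then show ?thesis by (intro exI[of _ 0]) simp
next
  case False
  then obtain x0 where x0: "f x0 \<noteq> 0" by blast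
  have bl: "bounded_linear f" using lin bd by (rule bounded_linear_of_clinear)
  define A where "A = {x. f x = 1}"
  have ne: "A \<noteq> {}"
  proof -
    have "f ((1 / f x0) *\<^sub>C x0) = 1"
      using x0 by (simp add: clinear_scaleC[OF lin] scaleC_complex_def)
    then show ?thesis unfolding A_def by blast
  qed
  have clA: "closed A"
  proof -
    have "A = f -` {1}" by (auto simp: A_def)
    then show ?thesis using bl
      by (simp add: closed_vimage linear_continuous_on)
  qed
  define d where "d = (INF x\<in>A. norm x)"
  have bdd: "bdd_below (norm ` A)" by (rule bdd_belowI[of _ 0]) auto
  have d_le: "d \<le> norm x" if "x \<in> A" for x
    unfolding d_def using bdd that by (rule cINF_lower)
  have d0: "d \<ge> 0" unfolding d_def using ne by (rule cINF_greatest) simp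
  have "\<exists>x\<in>A. norm x < d + 1 / real (Suc n)" for n
    using cINF_less_iff[OF ne bdd, of "d + 1 / real (Suc n)"] unfolding d_def by simp
  then obtain X where XA: "\<And>n. X n \<in> A" and Xn: "\<And>n. norm (X n) < d + 1 / real (Suc n)"
    by metis
  \<comment> \<open>The midpoint of \<open>x\<close> and \<open>y\<close> lies in \<open>A\<close>
    again, so \<open>d\<close> bounds its norm from below; hence minimizing sequences are
    Cauchy.\<close>
  have mid: "(norm (x - y))\<^sup>2 \<le> 2 * (norm x)\<^sup>2 + 2 * (norm y)\<^sup>2 - 4 * d\<^sup>2" if "x \<in> A" "y \<in> A" for x y
  proof -
    have "(1/2) *\<^sub>R (x + y) \<in> A"
      using that by (simp add: A_def clinear_linear[OF lin] linear_scale clinear_add[OF lin] scaleR_conv_of_real)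
    then have "d \<le> norm ((1/2) *\<^sub>R (x + y))" by (rule d_le)
    then have "(2*d)\<^sup>2 \<le> (norm (x + y))\<^sup>2" using d0 by (intro power_mono) auto
    then show ?thesis using parallelogram_law[of x y] by simp
  qed
  have Xlim: "(\<lambda>n. norm (X n)) \<longlonglongrightarrow> d"
  proof (rule tendsto_sandwich)
    show "\<forall>\<^sub>F n in sequentially. d \<le> norm (X n)" using d_le XA by simp
    show "\<forall>\<^sub>F n in sequentially. norm (X n) \<le> d + 1 / real (Suc n)" using Xn by (simp add: less_imp_le)
    show "(\<lambda>n. d + 1 / real (Suc n)) \<longlonglongrightarrow> d"
      using tendsto_add[OF tendsto_const LIMSEQ_Suc[OF lim_1_over_n], of d] by simp
  qed simp
  have "Cauchy X"
  proof (rule metric_CauchyI)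
    fix e :: real assume e: "e > 0"
    have "(\<lambda>n. 2 * (norm (X n))\<^sup>2 - 2 * d\<^sup>2) \<longlonglongrightarrow> 2 * d\<^sup>2 - 2 * d\<^sup>2"
      by (intro tendsto_intros Xlim)
    then have "\<forall>\<^sub>F n in sequentially. 2 * (norm (X n))\<^sup>2 - 2 * d\<^sup>2 < e\<^sup>2 / 2"
      using e by (intro order_tendstoD(2)[of _ 0]) auto
    then obtain M where M: "\<And>n. n \<ge> M \<Longrightarrow> 2 * (norm (X n))\<^sup>2 - 2 * d\<^sup>2 < e\<^sup>2 / 2"
      by (auto simp: eventually_sequentially)
    show "\<exists>M. \<forall>m\<ge>M. \<forall>n\<ge>M. dist (X m) (X n) < e"
    proof (intro exI allI impI)
      fix m n assume "m \<ge> M" "n \<ge> M"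
      then have "(norm (X m - X n))\<^sup>2 < e\<^sup>2"
        using mid[OF XA XA, of m n] M[of m] M[of n] by simp
      then show "dist (X m) (X n) < e" using e by (simp add: dist_norm power_less_imp_less_base)
    qed
  qed
  then obtain y where y: "X \<longlonglongrightarrow> y" using Cauchy_convergent convergent_def by blast
  have yA: "y \<in> A" using closed_sequentially[OF clA _ y] XA by blast
  have ny: "norm y = d" using tendsto_norm[OF y] Xlim LIMSEQ_unique by blast
  have y0: "y \<noteq> 0" using yA clinear_zero[OF lin] by (auto simp: A_def)
  have orth: "cinner y z = 0" if fz: "f z = 0" for z
  proof (cases "z = 0")
    case False
    \<comment> \<open>The coefficient of the projection of \<open>y\<close> to the line of
      \<open>z\<close>. Subtracting this projection stays in \<open>A\<close> and would shorten
      \<open>y\<close> unless \<open>cinner z y = 0\<close>.\<close>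
    define c where "c = cinner z y / of_real ((norm z)\<^sup>2)"
    have "y - c *\<^sub>C z \<in> A" using yA fz
      by (simp add: A_def clinear_diff[OF lin] clinear_scaleC[OF lin] scaleC_complex_def)
    then have "d \<le> norm (y - c *\<^sub>C z)" by (rule d_le)
    then have "d\<^sup>2 \<le> (norm (y - c *\<^sub>C z))\<^sup>2" using d0 by (intro power_mono) auto
    also have "\<dots> = d\<^sup>2 - 2 * Re (cinner y (c *\<^sub>C z)) + (cmod c * norm z)\<^sup>2"
      by (simp add: norm_diff_square norm_scaleC ny)
    also have "cinner y (c *\<^sub>C z) = of_real ((cmod (cinner z y))\<^sup>2 / (norm z)\<^sup>2)"
      using complex_norm_square[of "cinner z y"]
      by (simp add: cinner_scaleC_right c_def cinner_commute[of y z])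
    also have "(cmod c * norm z)\<^sup>2 = (cmod (cinner z y))\<^sup>2 / (norm z)\<^sup>2"
      using False by (simp add: c_def norm_divide norm_power power_mult_distrib power_divide)
        (simp add: power2_eq_square power4_eq_xxxx)
    finally have "(cmod (cinner z y))\<^sup>2 / (norm z)\<^sup>2 \<le> 0" by simp
    then have "cinner z y = 0" using False by (simp add: divide_le_0_iff)
    then show ?thesis using cinner_commute[of y z] by simp
  qed simp
  define w where "w = (1 / (norm y)\<^sup>2) *\<^sub>R y"
  have "f x = cinner w x" for x
  proof -
    have "f (x - f x *\<^sub>C y) = 0"
      using yA by (simp add: A_def clinear_diff[OF lin] clinear_scaleC[OF lin] scaleC_complex_def)
    then have "cinner y (x - f x *\<^sub>C y) = 0" by (rule orth)
    then have "cinner y x = f x * of_real ((norm y)\<^sup>2)"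
      by (simp add: cinner_diff_right cinner_scaleC_right cinner_self)
    then show ?thesis using y0 by (simp add: w_def cinner_scaleR_left)
  qed
  then show ?thesis by blast
qed

section \<open>Square roots of positive definite forms\<close>

text \<open>Polarize the form of the self-adjoint \<open>T\<close> at \<open>x + y\<close> and
  \<open>x - y\<close>, with \<open>y\<close> a positive multiple of \<open>T x\<close> of the same
  length as \<open>x\<close>: this expresses \<open>norm x * norm (T x)\<close> through diagonal
  values.\<close>

lemma norm_le_of_numerical_radius:
  fixes T :: "'a::complex_inner \<Rightarrow> 'a"
  assumes lin: "clinear T" and sa: "\<And>x y. cinner (T x) y = cinner x (T y)"
    and num: "\<And>x. \<bar>Re (cinner (T x) x)\<bar> \<le> \<theta> * (norm x)\<^sup>2"
  shows "norm (T x) \<le> \<theta> * norm x"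
proof (cases "T x = 0")
  case True
  have "0 \<le> \<theta> * (norm x)\<^sup>2" using num[of x] by linarith
  then have "x = 0 \<or> \<theta> \<ge> 0" by (auto simp: zero_le_mult_iff)
  then show ?thesis using True by auto
next
  case False
  then have x: "x \<noteq> 0" using clinear_zero[OF lin] by auto
  define y where "y = (norm x / norm (T x)) *\<^sub>R T x"
  have ny: "norm y = norm x" using False by (simp add: y_def)
  have "cinner (T y) x = cnj (cinner (T x) y)"
    using sa[of y x] cinner_commute[of y "T x"] by simp
  then have *: "Re (cinner (T y) x) = Re (cinner (T x) y)" by simp
  have "4 * Re (cinner (T x) y) = Re (cinner (T (x+y)) (x+y)) - Re (cinner (T (x-y)) (x-y))"
    using * by (simp add: clinear_add[OF lin] clinear_diff[OF lin] cinner_add_left cinner_add_right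
        cinner_diff_left cinner_diff_right)
  also have "\<dots> \<le> \<theta> * ((norm (x+y))\<^sup>2 + (norm (x-y))\<^sup>2)"
    using num[of "x+y"] num[of "x-y"] by (simp add: algebra_simps)
  also have "\<dots> = 4 * (\<theta> * (norm x)\<^sup>2)" by (simp add: parallelogram_law ny)
  finally have "Re (cinner (T x) y) \<le> \<theta> * (norm x)\<^sup>2" by simp
  moreover have "Re (cinner (T x) y) = norm x * norm (T x)"
    using False by (simp add: y_def cinner_scaleR_right cinner_self power2_eq_square)
  ultimately have "norm x * norm (T x) \<le> norm x * (\<theta> * norm x)" by (simp add: power2_eq_square ac_simps)
  then show ?thesis using x by simp
qed

text \<open>Conjugate symmetry makes linearity in the second argument enough; the bound is what the
  Riesz representation of the form by an operator needs.\<close>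

definition hermitian_form :: "('a::complex_normed_vector \<Rightarrow> 'a \<Rightarrow> complex) \<Rightarrow> bool"
  where "hermitian_form L \<longleftrightarrow> (\<forall>v. clinear (L v)) \<and> (\<forall>v w. L v w = cnj (L w v)) \<and>
    (\<exists>K. \<forall>v w. cmod (L v w) \<le> K * norm v * norm w)"

lemma hermitian_form_scale:
  assumes "hermitian_form L"
  shows "hermitian_form (\<lambda>v w. of_real r * L v w)"
proof -
  obtain K where K: "cmod (L v w) \<le> K * norm v * norm w" for v w
    using assms unfolding hermitian_form_def by blast
  have "cmod (of_real r * L v w) \<le> (\<bar>r\<bar> * K) * norm v * norm w" for v w
    using mult_left_mono[OF K[of v w], of "\<bar>r\<bar>"] by (simp add: norm_mult mult.assoc)
  moreover have "clinear (\<lambda>w. of_real r * L v w)" for v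
  proof -
    have "clinear (L v)" using assms unfolding hermitian_form_def by blast
    then show ?thesis by (simp add: clinear_def scaleC_complex_def algebra_simps)
  qed
  moreover have "of_real r * L v w = cnj (of_real r * L w v)" for v w
  proof -
    have "L v w = cnj (L w v)" using assms unfolding hermitian_form_def by blast
    then show ?thesis by (metis complex_cnj_complex_of_real complex_cnj_mult)
  qed
  ultimately show ?thesis unfolding hermitian_form_def by blast
qed

lemma hermitian_form_operator:
  fixes L :: "'a::complex_hilbert \<Rightarrow> 'a \<Rightarrow> complex"
  assumes "hermitian_form L"
  obtains M where "clinear M" "\<And>v w. cinner (M v) w = L v w" "\<And>v w. cinner (M v) w = cinner v (M w)"
proof -
  obtain K where lin: "\<And>v. clinear (L v)" and her: "\<And>v w. L v w = cnj (L w v)"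
    and K: "\<And>v w. cmod (L v w) \<le> K * norm v * norm w"
    using assms unfolding hermitian_form_def by blast
  have "\<forall>v. \<exists>y. \<forall>w. L v w = cinner y w"
    using Riesz_representation[OF lin K] by blast
  then obtain M where M: "\<And>v w. L v w = cinner (M v) w" by metis
  have M': "cinner w (M v) = L w v" for v w
    using her[of w v] cinner_commute[of w "M v"] M[of v w] by simp
  show thesis
  proof
    show "clinear M"
    proof (rule clinearI; rule cinner_eqI)
      show "cinner w (M (x + y)) = cinner w (M x + M y)" for w x y
        by (simp add: cinner_add_right M' clinear_add[OF lin])
      show "cinner w (M (a *\<^sub>C x)) = cinner w (a *\<^sub>C M x)" for w x a
        by (simp add: cinner_scaleC_right M' clinear_scaleC[OF lin] scaleC_complex_def)
    qed
    show "cinner (M v) w = L v w" "cinner (M v) w = cinner v (M w)" for v w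
      by (simp_all add: M' M[symmetric])
  qed
qed

text \<open>The operator \<open>1 - X\<close> is then a square root of \<open>1 - T\<close>.\<close>

lemma selfadjoint_sqrt_fixpoint:
  fixes T :: "'a::complex_hilbert \<Rightarrow> 'a"
  assumes lin: "clinear T" and sa: "\<And>x y. cinner (T x) y = cinner x (T y)"
    and nT: "\<And>x. norm (T x) \<le> \<theta> * norm x" and \<theta>: "0 \<le> \<theta>" "\<theta> < 1"
  obtains X where "clinear X" "\<And>x y. cinner (X x) y = cinner x (X y)"
    "\<And>x. norm (X x) \<le> \<theta> * norm x" "\<And>x. 2 *\<^sub>R X x = T x + X (X x)"
proof -
  \<comment> \<open>\<open>\<Phi>\<close> below is the map \<open>X -> (T + X^2) / 2\<close>, whose
    fixed points satisfy \<open>(1 - X)^2 = 1 - T\<close>. It preserves the closed set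
    \<open>S\<close> of complex linear self-adjoint operators of norm at most
    \<open>\<theta>\<close>, so the fixed point inherits all three properties.\<close>
  define S :: "('a \<Rightarrow>\<^sub>L 'a) set" where "S = {X. norm X \<le> \<theta> \<and>
    (\<forall>x. blinfun_apply X (\<i> *\<^sub>C x) = \<i> *\<^sub>C blinfun_apply X x) \<and>
    (\<forall>x y. cinner (blinfun_apply X x) y = cinner x (blinfun_apply X y))}"
  define Tb where "Tb = Blinfun T"
  have Tb: "blinfun_apply Tb = T" unfolding Tb_def
    by (rule bounded_linear_Blinfun_apply[OF bounded_linear_of_clinear[OF lin nT]])
  define \<Phi> where "\<Phi> = (\<lambda>X. (1/2) *\<^sub>R (Tb + (X o\<^sub>L X)))"
  have nTb: "norm Tb \<le> \<theta>" using \<theta> nT by (intro norm_blinfun_bound) (simp_all add: Tb)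
  have S_eq: "S = cball 0 \<theta> \<inter> (\<Inter>x. {X. blinfun_apply X (\<i> *\<^sub>C x) = \<i> *\<^sub>C blinfun_apply X x}) \<inter>
    (\<Inter>x. \<Inter>y. {X. cinner (blinfun_apply X x) y = cinner x (blinfun_apply X y)})"
    by (auto simp: S_def)
  have "closed S" unfolding S_eq
    by (intro closed_Int closed_cball closed_INT ballI closed_Collect_eq continuous_intros)
  then have cS: "complete S" by (rule complete_eq_closed[THEN iffD2])
  have "0 \<in> S" using \<theta> by (simp add: S_def)
  then have neS: "S \<noteq> {}" by blast
  have maps: "\<Phi> ` S \<subseteq> S"
  proof safe
    fix X assume X: "X \<in> S"
    have "norm (X o\<^sub>L X) \<le> \<theta>"
    proof -
      have "norm (X o\<^sub>L X) \<le> norm X * norm X" by (rule norm_blinfun_compose)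
      also have "\<dots> \<le> 1 * \<theta>" using X \<theta> by (intro mult_mono) (auto simp: S_def)
      finally show ?thesis by simp
    qed
    then have "norm (\<Phi> X) \<le> \<theta>"
      using norm_triangle_ineq[of Tb "X o\<^sub>L X"] nTb by (simp add: \<Phi>_def)
    then show "\<Phi> X \<in> S"
      using X by (simp add: S_def \<Phi>_def blinfun.add_left blinfun.scaleR_left Tb clinear_scaleC[OF lin]
          scaleC_add_right scaleC_scaleR_commute cinner_scaleR_left cinner_scaleR_right
          cinner_add_left cinner_add_right sa)
  qed
  have lip: "dist (\<Phi> X) (\<Phi> Y) \<le> \<theta> * dist X Y" if "X \<in> S" "Y \<in> S" for X Y
  proof -
    \<comment> \<open>Operators need not commute, so \<open>X^2 - Y^2\<close> is split as
      \<open>(X - Y) X + Y (X - Y)\<close>.\<close>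
    have eq: "\<Phi> X - \<Phi> Y = (1/2) *\<^sub>R (((X - Y) o\<^sub>L X) + (Y o\<^sub>L (X - Y)))"
      by (rule blinfun_eqI) (simp add: \<Phi>_def blinfun.bilinear_simps algebra_simps)
    have "norm (((X - Y) o\<^sub>L X) + (Y o\<^sub>L (X - Y))) \<le> norm (X - Y) * norm X + norm Y * norm (X - Y)"
      by (intro norm_triangle_le add_mono norm_blinfun_compose)
    also have "\<dots> \<le> norm (X - Y) * \<theta> + \<theta> * norm (X - Y)"
      using that by (intro add_mono mult_left_mono mult_right_mono) (auto simp: S_def)
    finally show ?thesis unfolding dist_norm eq by simp
  qed
  obtain X where XS: "X \<in> S" and fixp: "\<Phi> X = X"
    using Banach_fix[OF cS neS \<theta> maps] lip by blast
  have fixp': "2 *\<^sub>R blinfun_apply X x = T x + blinfun_apply X (blinfun_apply X x)" for x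
  proof -
    have "2 *\<^sub>R blinfun_apply X x = 2 *\<^sub>R blinfun_apply (\<Phi> X) x" using fixp by simp
    also have "\<dots> = T x + blinfun_apply X (blinfun_apply X x)"
      by (simp add: \<Phi>_def blinfun.bilinear_simps Tb)
    finally show ?thesis .
  qed
  show thesis
  proof
    show "clinear (blinfun_apply X)"
      using XS by (intro clinear_of_ii) (auto simp: S_def blinfun.bounded_linear_right bounded_linear.linear)
    show "norm (blinfun_apply X x) \<le> \<theta> * norm x" for x
      using norm_blinfun[of X x] XS mult_right_mono[of "norm X" \<theta> "norm x"] by (simp add: S_def)
  qed (use XS fixp' in \<open>simp_all add: S_def\<close>)
qed

text \<open>Solving \<open>v - X v = y\<close> is the contractive fixed point problem
  \<open>v = y + X v\<close>.\<close>

lemma bij_id_minus_contraction: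
  fixes X :: "'a::{real_normed_vector,complete_space} \<Rightarrow> 'a"
  assumes lin: "linear X" and nX: "\<And>x. norm (X x) \<le> \<theta> * norm x" and \<theta>: "0 \<le> \<theta>" "\<theta> < 1"
  shows "bij (\<lambda>v. v - X v)"
proof (rule bijI)
  have *: "v = 0" if "v = X v" for v
  proof -
    have "(1 - \<theta>) * norm v \<le> 0" using nX[of v] that by (simp add: algebra_simps)
    then show ?thesis using \<theta> by (simp add: mult_le_0_iff)
  qed
  show "inj (\<lambda>v. v - X v)"
  proof (rule injI)
    fix v w assume "v - X v = w - X w"
    then have "v - w = X (v - w)" by (simp add: linear_diff[OF lin] algebra_simps)
    then show "v = w" using * by fastforce
  qed
  show "surj (\<lambda>v. v - X v)"
  proof -
    have "\<exists>v. y = v - X v" for y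
    proof -
      have "\<exists>!v\<in>UNIV. y + X v = v"
      proof (rule Banach_fix[OF complete_UNIV _ \<theta>])
        show "dist (y + X v) (y + X w) \<le> \<theta> * dist v w" for v w
          using nX[of "v - w"] by (simp add: dist_norm linear_diff[OF lin])
      qed auto
      then obtain v where "y + X v = v" by blast
      then show ?thesis by (intro exI[of _ v]) (simp add: algebra_simps)
    qed
    then show ?thesis unfolding surj_def by blast
  qed
qed

text \<open>The form is \<open>cinner (M v) w\<close> with \<open>M = 1 - T\<close> and
  \<open>T\<close> of norm at most \<open>\<theta>\<close>, and \<open>S = 1 - X\<close> is the
  positive square root of \<open>M\<close>. The estimate of \<open>S - 1\<close> by the same
  \<open>\<theta>\<close> later makes the corrected derivatives converge in norm.\<close>

lemma near_identity_form_sqrt: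
  fixes L :: "'a::complex_hilbert \<Rightarrow> 'a \<Rightarrow> complex"
  assumes L: "hermitian_form L" and \<theta>: "0 \<le> \<theta>" "\<theta> < 1"
    and near_id: "\<And>v. \<bar>Re (L v v) - (norm v)\<^sup>2\<bar> \<le> \<theta> * (norm v)\<^sup>2"
  obtains S where "clinear S" "bij S" "\<And>v. (norm (S v))\<^sup>2 = Re (L v v)"
    "\<And>v. norm (S v - v) \<le> \<theta> * norm v"
proof -
  obtain M where lM: "clinear M" and Mc: "\<And>v w. cinner (M v) w = L v w"
    and Msa: "\<And>v w. cinner (M v) w = cinner v (M w)"
    using hermitian_form_operator[OF L] by blast
  define T where "T = (\<lambda>v. v - M v)"
  have lT: "clinear T" unfolding T_def using lM
    by (intro clinearI) (simp_all add: clinear_add clinear_scaleC scaleC_diff_right)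
  have Tsa: "cinner (T x) y = cinner x (T y)" for x y
    by (simp add: T_def cinner_diff_left cinner_diff_right Msa)
  have "norm (T x) \<le> \<theta> * norm x" for x
  proof (rule norm_le_of_numerical_radius[OF lT Tsa])
    show "\<bar>Re (cinner (T x) x)\<bar> \<le> \<theta> * (norm x)\<^sup>2" for x
      using near_id[of x] by (simp add: T_def cinner_diff_left Mc cinner_self abs_minus_commute)
  qed
  from selfadjoint_sqrt_fixpoint[OF lT Tsa this \<theta>] obtain X where lX: "clinear X"
    and Xsa: "\<And>x y. cinner (X x) y = cinner x (X y)" and nX: "\<And>x. norm (X x) \<le> \<theta> * norm x"
    and XX: "\<And>x. 2 *\<^sub>R X x = T x + X (X x)" by blast
  show thesis
  proof
    show "clinear (\<lambda>v. v - X v)" using lX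
      by (intro clinearI) (simp_all add: clinear_add clinear_scaleC scaleC_diff_right)
    show "bij (\<lambda>v. v - X v)"
      using bij_id_minus_contraction[OF clinear_linear[OF lX] nX \<theta>] .
    show "norm (v - X v - v) \<le> \<theta> * norm v" for v using nX by simp
    show "(norm (v - X v))\<^sup>2 = Re (L v v)" for v
    proof -
      have "2 * Re (cinner v (X v)) = Re (cinner v (2 *\<^sub>R X v))" by (simp add: cinner_scaleR_right)
      also have "\<dots> = Re (cinner v (T v)) + Re (cinner (X v) (X v))"
        by (simp add: XX cinner_add_right Xsa)
      finally have "2 * Re (cinner v (X v)) = Re (cinner v (T v)) + (norm (X v))\<^sup>2"
        by (simp add: cinner_self)
      then show ?thesis
        by (simp add: norm_diff_square T_def cinner_diff_right cinner_self Mc flip: Msa)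
    qed
  qed
qed

text \<open>Rescaling by \<open>s\<close> moves the bounds \<open>c\<close> and \<open>C\<close> to
  \<open>1 - \<theta>\<close> and \<open>1 + \<theta>\<close>, symmetric about 1, so that the
  near-identity case applies; \<open>r\<close> undoes the scaling.\<close>

lemma form_sqrt:
  fixes L :: "'a::complex_hilbert \<Rightarrow> 'a \<Rightarrow> complex"
  assumes L: "hermitian_form L" and c: "c > 0" and lower: "\<And>v. c * (norm v)\<^sup>2 \<le> Re (L v v)"
  obtains S :: "'a \<Rightarrow> 'a" where "clinear S" "bij S" "\<And>v. (norm (S v))\<^sup>2 = Re (L v v)"
proof -
  obtain K where K: "\<And>v w. cmod (L v w) \<le> K * norm v * norm w"
    using L unfolding hermitian_form_def by blast
  define C where "C = max K c"
  have upper: "Re (L v v) \<le> C * (norm v)\<^sup>2" for v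
  proof -
    have "Re (L v v) \<le> K * (norm v)\<^sup>2"
      using K[of v v] complex_Re_le_cmod[of "L v v"] by (simp add: power2_eq_square mult.assoc)
    also have "\<dots> \<le> C * (norm v)\<^sup>2" by (simp add: C_def mult_right_mono)
    finally show ?thesis .
  qed
  have Cc: "C \<ge> c" by (simp add: C_def)
  define s where "s = 2 / (C + c)"
  have s: "s > 0" using c Cc by (simp add: s_def)
  define \<theta> where "\<theta> = (C - c) / (C + c)"
  have \<theta>: "0 \<le> \<theta>" "\<theta> < 1" using c Cc by (simp_all add: \<theta>_def)
  have sc: "s * c = 1 - \<theta>" and sC: "s * C = 1 + \<theta>" using c Cc by (simp_all add: s_def \<theta>_def field_simps)
  have nr: "\<bar>Re (of_real s * L v v) - (norm v)\<^sup>2\<bar> \<le> \<theta> * (norm v)\<^sup>2" for v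
  proof -
    have "s * (c * (norm v)\<^sup>2) = (1 - \<theta>) * (norm v)\<^sup>2" "s * (C * (norm v)\<^sup>2) = (1 + \<theta>) * (norm v)\<^sup>2"
      by (simp_all only: sc sC mult.assoc[symmetric])
    then show ?thesis
      using mult_left_mono[OF lower[of v], of s] mult_left_mono[OF upper[of v], of s] s
      by (simp add: abs_le_iff ring_distribs)
  qed
  define r where "r = 1 / sqrt s"
  have r: "r > 0" "r\<^sup>2 * s = 1" using s by (simp_all add: r_def power_divide)
  have rs: "r\<^sup>2 * (s * x) = x" for x using r(2) by (simp only: mult.assoc[symmetric] mult_1_left)
  show thesis
  proof (rule near_identity_form_sqrt[OF hermitian_form_scale[OF L] \<theta> nr])
    fix S :: "'a \<Rightarrow> 'a" assume S: "clinear S" "bij S" "\<And>v. (norm (S v))\<^sup>2 = Re (of_real s * L v v)"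
    show thesis
    proof (rule that)
      show "clinear (\<lambda>v::'a. r *\<^sub>R S v)"
        using S(1) by (intro clinearI) (simp_all add: clinear_add clinear_scaleC scaleR_add_right
            scaleC_scaleR scaleR_scaleC mult.commute)
      have "bij (\<lambda>v::'a. r *\<^sub>R v)"
        by (rule bij_betw_byWitness[where f' = "\<lambda>v. (1/r) *\<^sub>R v"]) (use r in auto)
      then show "bij (\<lambda>v. r *\<^sub>R S v)"
        using bij_comp[OF S(2), of "\<lambda>v. r *\<^sub>R v"] by (simp add: comp_def)
      show "(norm (r *\<^sub>R S v))\<^sup>2 = Re (L v v)" for v
        by (simp add: power_mult_distrib S(3) rs)
    qed
  qed
qed

section \<open>One complex variable\<close>

text \<open>\<open>g\<close> need not extend to the closed disc, so Cauchy's inequality is used on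
  smaller circles whose radius then tends to \<open>\<rho>\<close>.\<close>

lemma deriv_bound_ball:
  assumes g: "g holomorphic_on ball 0 \<rho>" and \<rho>: "\<rho> > 0"
    and M: "\<And>z. cmod z < \<rho> \<Longrightarrow> cmod (g z) \<le> M"
  shows "cmod (deriv g 0) \<le> M / \<rho>"
proof -
  have *: "cmod (deriv g 0) * r \<le> M" if r: "0 < r" "r < \<rho>" for r
  proof -
    have "g holomorphic_on cball 0 r" using r by (intro holomorphic_on_subset[OF g]) auto
    then have "cmod ((deriv ^^ 1) g 0) \<le> fact 1 * M / r ^ 1"
      using r M by (intro Cauchy_inequality holomorphic_on_imp_continuous_on)
        (auto intro: holomorphic_on_subset)
    then show ?thesis using r by (simp add: field_simps)
  qed
  have "((\<lambda>r. cmod (deriv g 0) * r) \<longlongrightarrow> cmod (deriv g 0) * \<rho>) (at_left \<rho>)"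
    by (intro tendsto_intros)
  moreover have "\<forall>\<^sub>F r in at_left \<rho>. cmod (deriv g 0) * r \<le> M"
    using eventually_at_left_real[OF \<rho>] by eventually_elim (use * in auto)
  ultimately have "cmod (deriv g 0) * \<rho> \<le> M"
    by (intro tendsto_upperbound[of _ _ "at_left \<rho>"]) auto
  then show ?thesis using \<rho> by (simp add: field_simps)
qed

lemma Schwarz_lemma_ball:
  assumes g: "g holomorphic_on ball 0 \<rho>" and \<rho>: "\<rho> > 0"
    and M: "\<And>z. cmod z < \<rho> \<Longrightarrow> cmod (g z) \<le> M" and g0: "g 0 = 0" and z: "cmod z < \<rho>"
  shows "cmod (g z) \<le> M * cmod z / \<rho>"
proof (rule field_le_epsilon)
  fix e :: real assume e: "e > 0"
  \<comment> \<open>The Schwarz lemma wants values in the open disc, so \<open>M\<close> is enlarged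
    by \<open>e'\<close>, which is chosen to cost at most \<open>e\<close> in the
    conclusion.\<close>
  define e' where "e' = e / (cmod z / \<rho> + 1)"
  have e': "e' > 0" "e' * (cmod z / \<rho>) \<le> e"
    using e \<rho> by (auto simp: e'_def field_simps add_pos_nonneg)
  have M0: "M \<ge> 0" using M[of 0] \<rho> g0 by auto
  define f where "f = (\<lambda>w. g (of_real \<rho> * w) / of_real (M + e'))"
  have "f holomorphic_on ball 0 1" unfolding f_def
  proof (intro holomorphic_intros)
    show "(\<lambda>w. g (of_real \<rho> * w)) holomorphic_on ball 0 1"
      by (rule holomorphic_on_compose_gen[OF _ g, unfolded comp_def])
        (use \<rho> in \<open>auto intro!: holomorphic_intros simp: norm_mult\<close>)
  qed (use M0 e' in \<open>auto simp flip: of_real_add\<close>)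
  moreover have "f 0 = 0" using g0 by (simp add: f_def)
  moreover have "cmod (f w) < 1" if "cmod w < 1" for w
  proof -
    have "cmod (g (of_real \<rho> * w)) \<le> M" using M[of "of_real \<rho> * w"] \<rho> that by (simp add: norm_mult)
    also have "\<dots> < M + e'" using e' by simp
    finally show ?thesis using M0 e' by (simp add: f_def norm_divide flip: of_real_add)
  qed
  moreover have zz: "cmod (z / of_real \<rho>) < 1" using z \<rho> by (simp add: norm_divide)
  ultimately have "cmod (f (z / of_real \<rho>)) \<le> cmod (z / of_real \<rho>)"
    by (rule Schwarz_Lemma(1))
  then have "cmod (g z) \<le> (M + e') * (cmod z / \<rho>)"
    using M0 e' \<rho> by (simp add: f_def norm_divide field_simps flip: of_real_add)
  then show "cmod (g z) \<le> M * cmod z / \<rho> + e" using e' by (simp add: distrib_right add_divide_distrib)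
qed

text \<open>The Moebius map \<open>(k - x0) / (k + x0)\<close> takes the right half plane to the
  disc and the central value to \<open>0\<close>; the Schwarz lemma for it yields both estimates at
  once.\<close>

lemma Harnack_inequality:
  assumes g: "g holomorphic_on ball 0 \<rho>" and \<rho>: "\<rho> > 0"
    and pos: "\<And>z. cmod z < \<rho> \<Longrightarrow> Re (g z) \<ge> 0" and z: "cmod z < \<rho>"
  shows "Re (g z) * (\<rho> - cmod z) \<le> Re (g 0) * (\<rho> + cmod z)"
    and "Re (g 0) * (\<rho> - cmod z) \<le> Re (g z) * (\<rho> + cmod z)"
proof -
  \<comment> \<open>Adding \<open>e\<close> makes the real part strictly positive, so that
    \<open>k + x0\<close> has no zeros; \<open>e\<close> is sent to \<open>0\<close> at the
    end.\<close>
  have *: "\<bar>Re (g z) - Re (g 0)\<bar> * \<rho> \<le> cmod z * (Re (g z) + Re (g 0) + 2 * e)" if e: "e > 0" for e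
  proof -
    define x0 where "x0 = Re (g 0) + e"
    define k where "k = (\<lambda>w. g w - \<i> * of_real (Im (g 0)) + of_real e)"
    have k: "k holomorphic_on ball 0 \<rho>" unfolding k_def by (intro holomorphic_intros g)
    have x0: "x0 > 0" using pos[of 0] \<rho> e by (simp add: x0_def)
    have Rek: "Re (k w) = Re (g w) + e" for w by (simp add: k_def)
    have k0: "k 0 = of_real x0" by (simp add: k_def x0_def complex_eq_iff)
    define h where "h = (\<lambda>w. (k w - of_real x0) / (k w + of_real x0))"
    have nz: "k w + of_real x0 \<noteq> 0" if "cmod w < \<rho>" for w
      using Rek[of w] pos[OF that] e x0 by (auto simp: complex_eq_iff)
    have "h holomorphic_on ball 0 \<rho>" unfolding h_def
      by (intro holomorphic_intros k) (use nz in auto)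
    moreover have "cmod (h w) \<le> 1" if "cmod w < \<rho>" for w
    proof -
      have "(cmod (k w - of_real x0))\<^sup>2 \<le> (cmod (k w + of_real x0))\<^sup>2"
        using pos[OF that] e x0
        by (simp add: cmod_power2 Rek) (simp add: power2_eq_square algebra_simps)
      then have "cmod (k w - of_real x0) \<le> cmod (k w + of_real x0)" by (rule power2_le_imp_le) simp
      then show ?thesis using nz[OF that] by (simp add: h_def norm_divide)
    qed
    moreover have "h 0 = 0" by (simp add: h_def k0)
    ultimately have "cmod (h z) \<le> 1 * cmod z / \<rho>" using \<rho> z by (intro Schwarz_lemma_ball) auto
    then have "cmod (k z - of_real x0) \<le> (cmod z / \<rho>) * cmod (k z + of_real x0)"
      using nz[OF z] by (simp add: h_def norm_divide field_simps)
    then have 1: "(cmod (k z - of_real x0))\<^sup>2 \<le> (cmod z / \<rho>)\<^sup>2 * (cmod (k z + of_real x0))\<^sup>2"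
      by (metis norm_ge_zero power_mono power_mult_distrib)
    define s where "s = cmod z / \<rho>"
    have s: "0 \<le> s" "s < 1" using z \<rho> by (auto simp: s_def)
    define v where "v = Im (k z)"
    have "(Re (k z) - x0)\<^sup>2 + v\<^sup>2 \<le> s\<^sup>2 * ((Re (k z) + x0)\<^sup>2 + v\<^sup>2)"
      using 1 by (simp add: cmod_power2 s_def v_def)
    \<comment> \<open>As \<open>s < 1\<close>, the imaginary parts can be discarded from both
      sides.\<close>
    moreover have "s\<^sup>2 * v\<^sup>2 \<le> 1 * v\<^sup>2" using s by (intro mult_right_mono power_le_one) auto
    ultimately have "(Re (k z) - x0)\<^sup>2 \<le> (s * (Re (k z) + x0))\<^sup>2"
      unfolding power_mult_distrib distrib_left[of "s\<^sup>2"] by linarith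
    then have "\<bar>Re (k z) - x0\<bar> \<le> \<bar>s * (Re (k z) + x0)\<bar>" by (simp add: abs_le_square_iff)
    also have "\<dots> = s * (Re (k z) + x0)" using s Rek[of z] pos[OF z] e x0 by simp
    finally have "\<bar>Re (g z) - Re (g 0)\<bar> \<le> s * (Re (g z) + Re (g 0) + 2 * e)"
      by (simp add: Rek x0_def algebra_simps)
    then show ?thesis using \<rho> by (simp add: s_def field_simps)
  qed
  have "\<bar>Re (g z) - Re (g 0)\<bar> * \<rho> \<le> cmod z * (Re (g z) + Re (g 0)) + d" if d: "d > 0" for d
  proof -
    define e where "e = d / (2 * cmod z + 1)"
    have pos: "2 * cmod z + 1 > 0" by (rule add_nonneg_pos) simp_all
    then have e0: "e > 0" and "e * (2 * cmod z + 1) = d" using d by (simp_all add: e_def)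
    then have e: "e > 0" "2 * e * cmod z \<le> d" by (simp_all add: algebra_simps)
    show ?thesis using *[OF e(1)] e(2) by (simp add: algebra_simps)
  qed
  then have "\<bar>Re (g z) - Re (g 0)\<bar> * \<rho> \<le> cmod z * (Re (g z) + Re (g 0))" by (rule field_le_epsilon)
  then have "\<bar>(Re (g z) - Re (g 0)) * \<rho>\<bar> \<le> cmod z * (Re (g z) + Re (g 0))"
    using \<rho> by (simp add: abs_mult)
  then show "Re (g z) * (\<rho> - cmod z) \<le> Re (g 0) * (\<rho> + cmod z)"
    and "Re (g 0) * (\<rho> - cmod z) \<le> Re (g z) * (\<rho> + cmod z)"
    by (simp_all add: abs_le_iff algebra_simps)
qed

section \<open>Complex differentiable maps\<close>

lemma scaleC_complex [simp]: "a *\<^sub>C (z::complex) = a * z"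
  by (simp add: scaleC_complex_def)

text \<open>Frechet differentiability with a complex linear derivative at each point, a form well
  suited to compositions and limits. For Hilbert space targets continuity of the derivative is
  recovered from Cauchy estimates, and on open sets the notion then agrees with
  \<open>holomorphic_map_on\<close>.\<close>

definition cdiff_on :: "('a::complex_normed_vector \<Rightarrow> 'b::complex_normed_vector) \<Rightarrow> 'a set \<Rightarrow> bool"
  where "cdiff_on f S \<longleftrightarrow> (\<forall>x\<in>S. \<exists>D. clinear D \<and> (f has_derivative D) (at x))"

lemma cdiff_onI:
  "(\<And>x. x \<in> S \<Longrightarrow> clinear (D x)) \<Longrightarrow> (\<And>x. x \<in> S \<Longrightarrow> (f has_derivative D x) (at x)) \<Longrightarrow> cdiff_on f S"
  by (auto simp: cdiff_on_def)

abbreviation fderiv :: "('a::real_normed_vector \<Rightarrow> 'b::real_normed_vector) \<Rightarrow> 'a \<Rightarrow> 'a \<Rightarrow> 'b"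
  where "fderiv f x \<equiv> frechet_derivative f (at x)"

lemma fderiv_eq: "(f has_derivative D) (at x) \<Longrightarrow> fderiv f x = D"
  by (simp add: frechet_derivative_at[symmetric])

lemma cdiff_on_fderiv:
  assumes "cdiff_on f S" "x \<in> S"
  shows "(f has_derivative fderiv f x) (at x)" "clinear (fderiv f x)"
  using assms fderiv_eq unfolding cdiff_on_def by metis+

lemma cdiff_on_subset: "cdiff_on f S \<Longrightarrow> T \<subseteq> S \<Longrightarrow> cdiff_on f T"
  by (auto simp: cdiff_on_def)

lemma cdiff_on_cong:
  assumes "open S" "\<And>x. x \<in> S \<Longrightarrow> f x = g x" "cdiff_on f S"
  shows "cdiff_on g S"
  unfolding cdiff_on_def
proof
  fix x assume x: "x \<in> S"
  then obtain D where D: "clinear D" "(f has_derivative D) (at x)" using assms(3) by (auto simp: cdiff_on_def)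
  have "(g has_derivative D) (at x)"
    by (rule has_derivative_transform_within_open[OF D(2) assms(1) x]) (use assms(2) in auto)
  then show "\<exists>D. clinear D \<and> (g has_derivative D) (at x)" using D(1) by blast
qed

lemma cdiff_on_continuous: "cdiff_on f S \<Longrightarrow> continuous_on S f"
  by (meson cdiff_on_def continuous_at_imp_continuous_on has_derivative_continuous)

lemma cdiff_on_compose:
  assumes "cdiff_on g S" "cdiff_on f T" "\<And>x. x \<in> S \<Longrightarrow> g x \<in> T"
  shows "cdiff_on (\<lambda>x. f (g x)) S"
proof (rule cdiff_onI)
  fix x assume x: "x \<in> S"
  show "clinear (\<lambda>v. fderiv f (g x) (fderiv g x v))"
    by (rule clinear_compose[OF cdiff_on_fderiv(2)[OF assms(2) assms(3)[OF x]] cdiff_on_fderiv(2)[OF assms(1) x]])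
  show "((\<lambda>x. f (g x)) has_derivative (\<lambda>v. fderiv f (g x) (fderiv g x v))) (at x)"
    by (rule has_derivative_compose[OF cdiff_on_fderiv(1)[OF assms(1) x] cdiff_on_fderiv(1)[OF assms(2) assms(3)[OF x]]])
qed

lemma cdiff_on_const: "cdiff_on (\<lambda>x. c) S"
  by (rule cdiff_onI[where D="\<lambda>_ _. 0"]) (simp_all add: clinear_def)

lemma cdiff_on_bounded_clinear: "clinear f \<Longrightarrow> bounded_linear f \<Longrightarrow> cdiff_on f S"
  by (rule cdiff_onI[where D="\<lambda>_. f"]) (simp_all add: bounded_linear_imp_has_derivative)

lemma cdiff_on_id: "cdiff_on (\<lambda>x. x) S"
  by (rule cdiff_on_bounded_clinear) (simp_all add: clinear_def bounded_linear_ident)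

lemma cdiff_on_add:
  assumes "cdiff_on f S" "cdiff_on g S"
  shows "cdiff_on (\<lambda>x. f x + g x) S"
  by (rule cdiff_onI[where D="\<lambda>x v. fderiv f x v + fderiv g x v"])
    (auto intro!: clinearI has_derivative_add cdiff_on_fderiv[OF assms(1)] cdiff_on_fderiv[OF assms(2)]
      simp: cdiff_on_fderiv(2)[OF assms(1)] cdiff_on_fderiv(2)[OF assms(2)]
        clinear_add clinear_scaleC scaleC_add_right)

lemma cdiff_on_bounded_cbilinear:
  assumes "bounded_bilinear B" and lin: "\<And>x. clinear (B x)" "\<And>y. clinear (\<lambda>x. B x y)"
    and "cdiff_on f S" "cdiff_on g S"
  shows "cdiff_on (\<lambda>x. B (f x) (g x)) S"
  by (rule cdiff_onI[where D="\<lambda>x v. B (f x) (fderiv g x v) + B (fderiv f x v) (g x)"])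
    (auto intro!: clinearI bounded_bilinear.FDERIV[OF assms(1)] cdiff_on_fderiv[OF assms(4)] cdiff_on_fderiv[OF assms(5)]
      simp: cdiff_on_fderiv(2)[OF assms(4)] cdiff_on_fderiv(2)[OF assms(5)]
        clinear_add clinear_scaleC scaleC_add_right clinear_add[OF lin(1)] clinear_add[OF lin(2)]
        clinear_scaleC[OF lin(1)] clinear_scaleC[OF lin(2)])

lemma cdiff_on_scaleC:
  assumes "cdiff_on a S" "cdiff_on f S"
  shows "cdiff_on (\<lambda>x. a x *\<^sub>C f x) S"
  by (rule cdiff_on_bounded_cbilinear[OF bounded_bilinear_scaleC _ _ assms])
    (simp_all add: clinear_def scaleC_add_left scaleC_add_right scaleC_scaleC mult.commute)

lemma cdiff_on_mult:
  fixes a :: "'a::complex_normed_vector \<Rightarrow> complex"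
  assumes "cdiff_on a S" "cdiff_on f S"
  shows "cdiff_on (\<lambda>x. a x * f x) S"
  using cdiff_on_scaleC[OF assms] by simp

lemma cdiff_on_minus: "cdiff_on f S \<Longrightarrow> cdiff_on (\<lambda>x. - f x) S"
  using cdiff_on_scaleC[OF cdiff_on_const[of "-1"]] by simp

lemma cdiff_on_diff: "cdiff_on f S \<Longrightarrow> cdiff_on g S \<Longrightarrow> cdiff_on (\<lambda>x. f x - g x) S"
  using cdiff_on_add[OF _ cdiff_on_minus, of f S g] by simp

lemma bounded_clinear_cinner: "clinear (cinner b)" "bounded_linear (cinner b)"
  for b :: "'a::complex_inner"
proof -
  show "clinear (cinner b)" by (rule clinearI) (simp_all add: cinner_add_right cinner_scaleC_right)
  show "bounded_linear (cinner b)"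
    using bounded_bilinear.bounded_linear_right[OF bounded_bilinear_cinner, of b] .
qed

lemma cdiff_on_cinner:
  fixes f :: "'a::complex_normed_vector \<Rightarrow> 'b::complex_inner"
  assumes "cdiff_on f S"
  shows "cdiff_on (\<lambda>x. cinner b (f x)) S"
proof (rule cdiff_on_compose[OF assms, where T=UNIV])
  show "cdiff_on (cinner b) UNIV"
    by (rule cdiff_on_bounded_clinear; rule bounded_clinear_cinner)
qed simp

lemma cdiff_on_complex:
  assumes "open S"
  shows "cdiff_on g S \<longleftrightarrow> g holomorphic_on S"
proof
  assume g: "cdiff_on g S"
  show "g holomorphic_on S"
    unfolding holomorphic_on_open[OF assms]
  proof
    fix x assume x: "x \<in> S"
    have "fderiv g x = (\<lambda>h. fderiv g x 1 * h)"
    proof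
      fix h
      show "fderiv g x h = fderiv g x 1 * h"
        using clinear_scaleC[OF cdiff_on_fderiv(2)[OF g x], of h 1] by (simp add: mult.commute)
    qed
    then have "(g has_field_derivative fderiv g x 1) (at x)"
      using cdiff_on_fderiv(1)[OF g x] unfolding has_field_derivative_def by simp
    then show "\<exists>f'. (g has_field_derivative f') (at x)" ..
  qed
next
  assume "g holomorphic_on S"
  then show "cdiff_on g S"
    using holomorphic_derivI[OF _ assms]
    by (intro cdiff_onI[where D="\<lambda>x h. deriv g x * h"])
      (auto simp: has_field_derivative_def clinear_def ring_distribs)
qed

lemma cdiff_on_inverse:
  fixes a :: "'a::complex_normed_vector \<Rightarrow> complex"
  assumes "cdiff_on a S" "\<And>x. x \<in> S \<Longrightarrow> a x \<noteq> 0"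
  shows "cdiff_on (\<lambda>x. inverse (a x)) S"
proof (rule cdiff_on_compose[OF assms(1)])
  show "cdiff_on inverse (- {0::complex})"
    by (subst cdiff_on_complex) (auto intro!: holomorphic_intros)
  show "a x \<in> - {0}" if "x \<in> S" for x using assms(2)[OF that] by simp
qed

lemma cdiff_on_power:
  fixes a :: "'a::complex_normed_vector \<Rightarrow> complex"
  assumes "cdiff_on a S"
  shows "cdiff_on (\<lambda>x. a x ^ n) S"
proof (induction n)
  case 0
  show ?case by (simp add: cdiff_on_const)
next
  case (Suc n)
  show ?case using cdiff_on_mult[OF assms Suc] by simp
qed

lemma cdiff_on_affine_line: "cdiff_on (\<lambda>l. x + l *\<^sub>C v) S" for v :: "'a::complex_normed_vector"
  by (intro cdiff_on_add cdiff_on_const cdiff_on_scaleC cdiff_on_id)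

text \<open>Restricting to a complex line and pairing with \<open>b\<close> is how the one-variable
  estimates reach Hilbert space valued maps.\<close>

lemma holomorphic_on_slice:
  fixes f :: "'a::complex_normed_vector \<Rightarrow> 'b::complex_inner"
  assumes "cdiff_on f S" "open T" "\<And>l. l \<in> T \<Longrightarrow> x + l *\<^sub>C v \<in> S"
  shows "(\<lambda>l. cinner b (f (x + l *\<^sub>C v))) holomorphic_on T"
  using cdiff_on_cinner[OF cdiff_on_compose[OF cdiff_on_affine_line assms(1)], of T x v b] assms
  by (simp add: cdiff_on_complex)

lemma deriv_slice:
  fixes f :: "'a::complex_normed_vector \<Rightarrow> 'b::complex_inner"
  assumes "cdiff_on f S" "x \<in> S"
  shows "deriv (\<lambda>l. cinner b (f (x + l *\<^sub>C v))) 0 = cinner b (fderiv f x v)"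
proof (rule DERIV_imp_deriv)
  have 1: "((\<lambda>l::complex. x + l *\<^sub>C v) has_derivative (\<lambda>h. h *\<^sub>C v)) (at 0)"
    by (auto intro!: derivative_eq_intros bounded_linear_imp_has_derivative
        bounded_bilinear.bounded_linear_left[OF bounded_bilinear_scaleC])
  have "(f has_derivative fderiv f x) (at (x + 0 *\<^sub>C v))"
    using cdiff_on_fderiv(1)[OF assms] by simp
  then have 2: "((\<lambda>l. f (x + l *\<^sub>C v)) has_derivative (\<lambda>h. fderiv f x (h *\<^sub>C v))) (at 0)"
    by (rule has_derivative_compose[OF 1])
  have "((\<lambda>l. cinner b (f (x + l *\<^sub>C v))) has_derivative (\<lambda>h. cinner b (fderiv f x (h *\<^sub>C v)))) (at 0)"
    by (rule bounded_linear.has_derivative[OF bounded_clinear_cinner(2) 2])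
  then show "((\<lambda>l. cinner b (f (x + l *\<^sub>C v))) has_field_derivative cinner b (fderiv f x v)) (at 0)"
    unfolding has_field_derivative_def
    by (rule back_subst[where P="\<lambda>D. (_ has_derivative D) _"])
      (auto simp: fun_eq_iff clinear_scaleC[OF cdiff_on_fderiv(2)[OF assms]] cinner_scaleC_right)
qed

lemma norm_le_of_cinner:
  fixes y :: "'a::complex_inner"
  assumes "\<And>b. norm b \<le> 1 \<Longrightarrow> cmod (cinner b y) \<le> K"
  shows "norm y \<le> K"
proof (cases "y = 0")
  case True
  then show ?thesis using assms[of 0] by simp
next
  case False
  have "cmod (cinner ((1 / norm y) *\<^sub>R y) y) = norm y"
    using False by (simp add: cinner_scaleR_left cinner_self norm_divide power2_eq_square norm_mult)
  then show ?thesis using assms[of "(1 / norm y) *\<^sub>R y"] False by simp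
qed

lemma line_in_ball:
  fixes x :: "'a::complex_normed_vector"
  shows "v \<noteq> 0 \<Longrightarrow> cmod l < s / norm v \<Longrightarrow> x + l *\<^sub>C v \<in> ball x s"
  by (simp add: dist_norm norm_scaleC field_simps)

lemma Cauchy_estimate:
  fixes f :: "'a::complex_normed_vector \<Rightarrow> 'b::complex_inner"
  assumes f: "cdiff_on f (ball x s)" and s: "s > 0" and M: "\<And>y. y \<in> ball x s \<Longrightarrow> norm (f y) \<le> M"
  shows "norm (fderiv f x v) \<le> M * norm v / s"
proof (cases "v = 0")
  case True
  then show ?thesis using clinear_zero[OF cdiff_on_fderiv(2)[OF f]] s by simp
next
  case False
  have M0: "M \<ge> 0" using M[of x] s norm_ge_zero[of "f x"] by (auto intro: order_trans simp del: norm_ge_zero)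
  show ?thesis
  proof (rule norm_le_of_cinner)
    fix b :: 'b assume b: "norm b \<le> 1"
    have "cmod (deriv (\<lambda>l. cinner b (f (x + l *\<^sub>C v))) 0) \<le> M / (s / norm v)"
    proof (rule deriv_bound_ball)
      show "(\<lambda>l. cinner b (f (x + l *\<^sub>C v))) holomorphic_on ball 0 (s / norm v)"
        using False by (intro holomorphic_on_slice[OF f]) (auto simp: line_in_ball simp del: mem_ball)
      show "cmod (cinner b (f (x + l *\<^sub>C v))) \<le> M" if "cmod l < s / norm v" for l
      proof -
        have "cmod (cinner b (f (x + l *\<^sub>C v))) \<le> norm b * norm (f (x + l *\<^sub>C v))"
          by (rule Cauchy_Schwarz_cinner)
        also have "\<dots> \<le> 1 * M" using b M[OF line_in_ball[OF False that]] M0 by (intro mult_mono) auto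
        finally show ?thesis by simp
      qed
    qed (use s False in simp)
    then show "cmod (cinner b (fderiv f x v)) \<le> M * norm v / s"
      using deriv_slice[OF f, of x b v] s by simp
  qed
qed

lemma Schwarz_lemma_vector:
  fixes f :: "'a::complex_normed_vector \<Rightarrow> 'b::complex_inner"
  assumes f: "cdiff_on f (ball x s)" and s: "s > 0" and M: "\<And>y. y \<in> ball x s \<Longrightarrow> norm (f y) \<le> M"
    and f0: "f x = 0" and y: "y \<in> ball x s"
  shows "norm (f y) \<le> M * norm (y - x) / s"
proof (cases "y = x")
  case False
  define v where "v = y - x"
  have v: "v \<noteq> 0" "x + 1 *\<^sub>C v = y" using False by (auto simp: v_def)
  have M0: "M \<ge> 0" using M[of x] s norm_ge_zero[of "f x"] by (auto intro: order_trans simp del: norm_ge_zero)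
  show ?thesis
  proof (rule norm_le_of_cinner)
    fix b :: 'b assume b: "norm b \<le> 1"
    have "cmod (cinner b (f (x + 1 *\<^sub>C v))) \<le> M * cmod 1 / (s / norm v)"
    proof (rule Schwarz_lemma_ball[where g="\<lambda>l. cinner b (f (x + l *\<^sub>C v))"])
      show "(\<lambda>l. cinner b (f (x + l *\<^sub>C v))) holomorphic_on ball 0 (s / norm v)"
        using v by (intro holomorphic_on_slice[OF f]) (auto simp: line_in_ball simp del: mem_ball)
      show "cmod (cinner b (f (x + l *\<^sub>C v))) \<le> M" if "cmod l < s / norm v" for l
      proof -
        have "cmod (cinner b (f (x + l *\<^sub>C v))) \<le> norm b * norm (f (x + l *\<^sub>C v))"
          by (rule Cauchy_Schwarz_cinner)
        also have "\<dots> \<le> 1 * M" using b M[OF line_in_ball[OF v(1) that]] M0 by (intro mult_mono) auto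
        finally show ?thesis by simp
      qed
      show "cmod 1 < s / norm v" using y v by (simp add: v_def dist_norm norm_minus_commute)
    qed (use s v f0 in simp_all)
    then show "cmod (cinner b (f y)) \<le> M * norm (y - x) / s"
      using v by (simp add: v_def)
  qed
qed (use f0 in simp)

text \<open>Cauchy estimates on balls of radius \<open>s - r\<close> bound the derivative on the
  convex set \<open>ball x r\<close>.\<close>

lemma cdiff_on_Lipschitz:
  fixes f :: "'a::complex_normed_vector \<Rightarrow> 'b::complex_inner"
  assumes f: "cdiff_on f (ball x s)" and r: "r < s" and M: "\<And>y. y \<in> ball x s \<Longrightarrow> norm (f y) \<le> M"
    and y: "y \<in> ball x r" and z: "z \<in> ball x r"
  shows "norm (f y - f z) \<le> M / (s - r) * norm (y - z)"
proof (rule differentiable_bound[OF convex_ball _ _ y z])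
  fix w assume w: "w \<in> ball x r"
  have sub: "ball w (s - r) \<subseteq> ball x s"
  proof
    fix u assume "u \<in> ball w (s - r)"
    then show "u \<in> ball x s" using w dist_triangle[of x u w] by simp
  qed
  have wS: "w \<in> ball x s" using w r by simp
  show "(f has_derivative fderiv f w) (at w within ball x r)"
    using cdiff_on_fderiv(1)[OF f wS] by (rule has_derivative_at_withinI)
  show "onorm (fderiv f w) \<le> M / (s - r)"
  proof (rule onorm_bound)
    show "0 \<le> M / (s - r)" using norm_ge_zero[of "f w"] M[OF wS] r by (simp del: norm_ge_zero)
    show "norm (fderiv f w v) \<le> M / (s - r) * norm v" for v
      using Cauchy_estimate[OF cdiff_on_subset[OF f sub] _ M[OF subsetD[OF sub]]] r by simp
  qed
qed

text \<open>A difference of derivatives is the derivative of \<open>f (w + h) - f w\<close>. That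
  function is of size \<open>M / s * norm h\<close> by the Lipschitz bound, and a Cauchy estimate
  costs another \<open>1 / s\<close>. The factor 4 leaves room for the translation by
  \<open>h\<close>.\<close>

lemma fderiv_Lipschitz:
  fixes f :: "'a::complex_normed_vector \<Rightarrow> 'b::complex_inner"
  assumes f: "cdiff_on f (ball x (4 * s))" and s: "s > 0" and M: "\<And>y. y \<in> ball x (4 * s) \<Longrightarrow> norm (f y) \<le> M"
    and y: "y \<in> ball x s" and z: "z \<in> ball x s"
  shows "norm (fderiv f y v - fderiv f z v) \<le> M / s\<^sup>2 * norm (y - z) * norm v"
proof -
  define h where "h = z - y"
  have sub: "w \<in> ball x (3 * s)" "w + h \<in> ball x (3 * s)" if "w \<in> ball y s" for w
  proof -
    have "norm (w - y) < s" "norm (y - x) < s" "norm (z - x) < s"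
      using that y z by (simp_all add: dist_norm norm_minus_commute)
    moreover have "norm (w - x) \<le> norm (w - y) + norm (y - x)"
      using norm_triangle_ineq[of "w-y" "y-x"] by simp
    moreover have "norm (w + h - x) \<le> norm (w - y) + norm (z - x)"
      using norm_triangle_ineq[of "w-y" "z-x"] by (simp add: h_def algebra_simps)
    ultimately show "w \<in> ball x (3 * s)" "w + h \<in> ball x (3 * s)"
      using s by (simp_all add: dist_norm norm_minus_commute[of x])
  qed
  have f3: "cdiff_on f (ball x (3 * s))" using s by (intro cdiff_on_subset[OF f] subset_ball) simp
  have fh: "cdiff_on (\<lambda>w. f (w + h)) (ball y s)"
    by (rule cdiff_on_compose[OF cdiff_on_add[OF cdiff_on_id cdiff_on_const] f3]) (use sub in auto)
  have fy: "cdiff_on f (ball y s)" using sub by (intro cdiff_on_subset[OF f3]) auto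
  have g: "cdiff_on (\<lambda>w. f (w + h) - f w) (ball y s)"
    by (intro cdiff_on_diff fh fy)
  have yy: "y \<in> ball y s" using s by simp
  have "norm (fderiv (\<lambda>w. f (w + h) - f w) y v) \<le> (M / (4 * s-3 * s) * norm h) * norm v / s"
  proof (rule Cauchy_estimate[OF g s])
    fix w assume "w \<in> ball y s"
    then show "norm (f (w + h) - f w) \<le> M / (4 * s-3 * s) * norm h"
      using cdiff_on_Lipschitz[OF f _ M sub(2) sub(1), of w w] s by simp
  qed
  moreover have "fderiv (\<lambda>w. f (w + h) - f w) y v = fderiv f z v - fderiv f y v"
  proof -
    have "(f has_derivative fderiv f z) (at z)"
      using cdiff_on_fderiv(1)[OF f, of z] z s by simp
    then have "(f has_derivative fderiv f z) (at (y + h))" by (simp add: h_def)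
    moreover have "((\<lambda>w. w + h) has_derivative (\<lambda>v. v)) (at y)"
      by (auto intro!: derivative_eq_intros)
    ultimately have "((\<lambda>w. f (w + h)) has_derivative (\<lambda>v. fderiv f z v)) (at y)"
      using has_derivative_compose by blast
    then have "((\<lambda>w. f (w + h) - f w) has_derivative (\<lambda>v. fderiv f z v - fderiv f y v)) (at y)"
      using cdiff_on_fderiv(1)[OF fy yy] by (intro has_derivative_diff)
    then show ?thesis by (simp add: fderiv_eq)
  qed
  ultimately show ?thesis
    using s by (simp add: h_def norm_minus_commute power2_eq_square)
qed

text \<open>Harnack's inequality on the line through \<open>x\<close> and \<open>y\<close>, for
  \<open>1 - cinner b f\<close> with \<open>b\<close> the direction of \<open>f y\<close>. As
  \<open>y\<close> lies within half the radius, the factor \<open>(R - 1) / (R + 1)\<close> is at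
  least 1/3. This keeps images away from the unit sphere when the base point moves.\<close>

lemma Harnack_vector:
  fixes f :: "'a::complex_normed_vector \<Rightarrow> 'b::complex_inner"
  assumes f: "cdiff_on f (ball x s)" and s: "s > 0" and f1: "\<And>y. y \<in> ball x s \<Longrightarrow> norm (f y) \<le> 1"
    and fx: "norm (f x) \<le> r" and y: "y \<in> ball x (s / 2)"
  shows "norm (f y) \<le> 1 - (1 - r) / 3"
proof (cases "y = x \<or> f y = 0")
  case True
  have "r \<ge> 0" using fx norm_ge_zero order_trans by blast
  moreover have "norm (f x) \<le> 1" using f1[of x] s by simp
  ultimately have "norm (f y) \<le> r" "norm (f y) \<le> 1" using fx True by auto
  then show ?thesis by (simp add: field_simps)
next
  case False
  define v where "v = y - x"
  have v: "v \<noteq> 0" "x + 1 *\<^sub>C v = y" using False by (auto simp: v_def)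
  define R where "R = s / norm v"
  have R: "R > 0" "R \<ge> 2" using s v y by (simp_all add: R_def v_def dist_norm norm_minus_commute field_simps)
  define b where "b = (1 / norm (f y)) *\<^sub>R f y"
  have b: "norm b = 1" using False by (simp add: b_def)
  have bfy: "cinner b (f y) = of_real (norm (f y))"
    using False by (simp add: b_def cinner_scaleR_left cinner_self power2_eq_square)
  have inb: "x + l *\<^sub>C v \<in> ball x s" if "cmod l < R" for l using line_in_ball[OF v(1)] that by (simp add: R_def)
  define g where "g = (\<lambda>l. 1 - cinner b (f (x + l *\<^sub>C v)))"
  have "Re (g 0) * (R - cmod 1) \<le> Re (g 1) * (R + cmod 1)"
  proof (rule Harnack_inequality(2))
    show "g holomorphic_on ball 0 R" unfolding g_def
      by (intro holomorphic_intros holomorphic_on_slice[OF f]) (use inb in auto)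
    show "0 \<le> Re (g l)" if "cmod l < R" for l
    proof -
      have "cmod (cinner b (f (x + l *\<^sub>C v))) \<le> 1"
        using Cauchy_Schwarz_cinner[of b "f (x + l *\<^sub>C v)"] f1[OF inb[OF that]] b by simp
      then show ?thesis using complex_Re_le_cmod[of "cinner b (f (x + l *\<^sub>C v))"] by (simp add: g_def)
    qed
  qed (use R in auto)
  moreover have g1: "Re (g 1) = 1 - norm (f y)" using v by (simp add: g_def bfy)
  moreover have "Re (g 0) \<ge> 1 - r"
  proof -
    have "cmod (cinner b (f x)) \<le> r" using Cauchy_Schwarz_cinner[of b "f x"] fx b by simp
    then show ?thesis using complex_Re_le_cmod[of "cinner b (f x)"] by (simp add: g_def)
  qed
  then have "(1 - r) * (R - 1) \<le> Re (g 0) * (R - 1)" using R by (intro mult_right_mono) auto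
  ultimately have *: "(1 - r) * (R - 1) \<le> (1 - norm (f y)) * (R + 1)" by simp
  have "1 - norm (f y) \<ge> 0" using f1[of y] y s by simp
  have "(1 - norm (f y)) * (R + 1) \<le> (1 - norm (f y)) * (3 * (R - 1))"
    using R \<open>1 - norm (f y) \<ge> 0\<close> by (intro mult_left_mono) auto
  with * have "(1 - r) * (R - 1) \<le> (3 * (1 - norm (f y))) * (R - 1)" by (simp add: algebra_simps)
  then have "1 - r \<le> 3 * (1 - norm (f y))" using R by simp
  then show ?thesis by (simp add: field_simps)
qed

lemma cdiff_on_locally_bounded:
  assumes "cdiff_on f S" "open S" "x \<in> S"
  obtains s M where "s > 0" "ball x s \<subseteq> S" "\<And>y. y \<in> ball x s \<Longrightarrow> norm (f y) \<le> M"
proof -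
  have "isCont f x"
    using cdiff_on_continuous[OF assms(1)] assms(2,3) by (simp add: continuous_on_eq_continuous_at)
  then obtain d where d: "d > 0" "\<And>y. dist y x < d \<Longrightarrow> dist (f y) (f x) < 1"
    unfolding continuous_at_eps_delta by (metis zero_less_one)
  obtain e where e: "e > 0" "ball x e \<subseteq> S" using assms(2,3) open_contains_ball by blast
  show thesis
  proof
    show "min d e > 0" using d e by simp
    show "ball x (min d e) \<subseteq> S" using e by auto
    show "norm (f y) \<le> norm (f x) + 1" if "y \<in> ball x (min d e)" for y
      using d(2)[of y] that norm_triangle_ineq2[of "f y" "f x"] by (simp add: dist_norm dist_commute norm_minus_commute)
  qed
qed

section \<open>Agreement with holomorphy defined by directional derivatives\<close>

lemma has_vector_derivative_iff_quotient:
  "(g has_vector_derivative d) (at t) \<longleftrightarrow> ((\<lambda>r. (1 / r) *\<^sub>R (g (t + r) - g t)) \<longlongrightarrow> d) (at 0)"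
proof -
  have "(g has_vector_derivative d) (at t) \<longleftrightarrow> ((\<lambda>r. norm (g (t + r) - g t - r *\<^sub>R d) / norm r) \<longlongrightarrow> 0) (at 0)"
    unfolding has_vector_derivative_def has_derivative_at by (simp add: bounded_linear_scaleR_left)
  also have "\<dots> \<longleftrightarrow> ((\<lambda>r. norm ((1 / r) *\<^sub>R (g (t + r) - g t) - d)) \<longlongrightarrow> 0) (at 0)"
  proof (rule tendsto_cong)
    have "norm (g (t + r) - g t - r *\<^sub>R d) / norm r = norm ((1 / r) *\<^sub>R (g (t + r) - g t) - d)"
      if "r \<noteq> 0" for r
    proof -
      have "(1 / r) *\<^sub>R (g (t + r) - g t) - d = (1 / r) *\<^sub>R (g (t + r) - g t - r *\<^sub>R d)"
        using that by (simp add: scaleR_diff_right)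
      then show ?thesis by simp
    qed
    then show "\<forall>\<^sub>F r in at 0. norm (g (t + r) - g t - r *\<^sub>R d) / norm r = norm ((1 / r) *\<^sub>R (g (t + r) - g t) - d)"
      by (simp add: eventually_at_filter)
  qed
  also have "\<dots> \<longleftrightarrow> ((\<lambda>r. (1 / r) *\<^sub>R (g (t + r) - g t)) \<longlongrightarrow> d) (at 0)"
    by (simp add: tendsto_norm_zero_iff LIM_zero_iff)
  finally show ?thesis .
qed

lemma has_derivative_diff_quot:
  assumes "(f has_derivative D) (at p)"
  shows "(diff_quot f p v \<longlongrightarrow> D v) (at 0)"
proof -
  have "((\<lambda>r::real. p + r *\<^sub>R v) has_derivative (\<lambda>h. h *\<^sub>R v)) (at 0)"
    by (auto intro!: derivative_eq_intros)
  moreover have "(f has_derivative D) (at (p + 0 *\<^sub>R v))" using assms by simp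
  ultimately have "((\<lambda>r::real. f (p + r *\<^sub>R v)) has_derivative (\<lambda>h. D (h *\<^sub>R v))) (at 0)"
    by (rule has_derivative_compose)
  moreover have "(\<lambda>h. D (h *\<^sub>R v)) = (\<lambda>h. h *\<^sub>R D v)"
    using assms by (simp add: has_derivative_linear linear_scale)
  ultimately have "((\<lambda>r::real. f (p + r *\<^sub>R v)) has_vector_derivative D v) (at 0)"
    unfolding has_vector_derivative_def by simp
  then show ?thesis
    unfolding has_vector_derivative_iff_quotient diff_quot_def[abs_def] by simp
qed

lemma dir_deriv_eq: "(diff_quot f p v \<longlongrightarrow> L) (at 0) \<Longrightarrow> dir_deriv f p v = L"
  by (simp add: dir_deriv_def tendsto_Lim)

text \<open>Continuity of the derivative in the operator norm comes from local boundedness and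
  \<open>fderiv_Lipschitz\<close>.\<close>

lemma cdiff_on_imp_holomorphic_map_on:
  fixes f :: "'a::complex_banach \<Rightarrow> 'b::complex_hilbert"
  assumes f: "cdiff_on f S" and S: "open S"
  shows "holomorphic_map_on f S"
  unfolding holomorphic_map_on_def
proof
  define D where "D = (\<lambda>p. Blinfun (fderiv f p))"
  have D: "blinfun_apply (D p) = fderiv f p" if "p \<in> S" for p
    unfolding D_def by (rule bounded_linear_Blinfun_apply[OF has_derivative_bounded_linear[OF cdiff_on_fderiv(1)[OF f that]]])
  have lim: "(diff_quot f p v \<longlongrightarrow> fderiv f p v) (at 0)" if "p \<in> S" for p v
    by (rule has_derivative_diff_quot[OF cdiff_on_fderiv(1)[OF f that]])
  have "continuous_on S D"
    unfolding continuous_on_eq_continuous_at[OF S]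
  proof
    fix x assume x: "x \<in> S"
    obtain s M where s: "s > 0" "ball x s \<subseteq> S" and M: "\<And>y. y \<in> ball x s \<Longrightarrow> norm (f y) \<le> M"
      using cdiff_on_locally_bounded[OF f S x] by blast
    define t where "t = s / 4"
    have t: "t > 0" "4 * t = s" using s by (simp_all add: t_def)
    have M0: "M \<ge> 0" using M[of x] s norm_ge_zero[of "f x"] by (auto intro: order_trans simp del: norm_ge_zero)
    have K0: "M / t\<^sup>2 \<ge> 0" using M0 by simp
    have bound: "norm (D y - D x) \<le> M / t\<^sup>2 * norm (y - x)" if y: "y \<in> ball x t" for y
    proof (rule norm_blinfun_bound)
      show "0 \<le> M / t\<^sup>2 * norm (y - x)" using K0 by (intro mult_nonneg_nonneg) auto
      have yS: "y \<in> S" using y s t by auto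
      fix v
      show "norm (blinfun_apply (D y - D x) v) \<le> M / t\<^sup>2 * norm (y - x) * norm v"
        using fderiv_Lipschitz[of f x t M y x v] f M y t s
        by (simp add: blinfun.diff_left D[OF yS] D[OF x] cdiff_on_subset[OF f s(2)] t(2))
    qed
    have "((\<lambda>y. M / t\<^sup>2 * norm (y - x)) \<longlongrightarrow> M / t\<^sup>2 * norm (x - x)) (at x)"
      by (intro tendsto_intros)
    then have l0: "((\<lambda>y. M / t\<^sup>2 * norm (y - x)) \<longlongrightarrow> 0) (at x)" by simp
    have "\<forall>\<^sub>F y in at x. y \<in> ball x t"
      using t by (intro eventually_at_in_open') auto
    then have "\<forall>\<^sub>F y in at x. norm (D y - D x) \<le> M / t\<^sup>2 * norm (y - x)"
      by eventually_elim (use bound in blast)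
    then have "((\<lambda>y. D y - D x) \<longlongrightarrow> 0) (at x)" by (rule Lim_null_comparison[OF _ l0])
    then show "isCont D x" unfolding isCont_def by (rule LIM_zero_cancel)
  qed
  then show "C1_on f S" unfolding C1_on_def using lim D by (intro exI[of _ D]) simp
  show "\<forall>p\<in>S. \<forall>v. delbar f p v = 0"
    using clinear_scaleC[OF cdiff_on_fderiv(2)[OF f]]
    by (simp add: delbar_def dir_deriv_eq[OF lim] scaleC_ii)
qed

text \<open>\<open>delbar = 0\<close> makes the directional derivative complex linear, and its
  continuity in the operator norm upgrades it to a Frechet derivative by the mean value
  inequality.\<close>

lemma holomorphic_map_on_imp_cdiff_on:
  assumes f: "holomorphic_map_on f S" and S: "open S"
  shows "cdiff_on f S"
proof -
  obtain D where cD: "continuous_on S D"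
    and lim: "\<And>p v. p \<in> S \<Longrightarrow> (diff_quot f p v \<longlongrightarrow> blinfun_apply (D p) v) (at 0)"
    using f unfolding holomorphic_map_on_def C1_on_def by blast
  show ?thesis
  proof (rule cdiff_onI)
    fix p assume p: "p \<in> S"
    show "clinear (blinfun_apply (D p))"
    proof (rule clinear_of_ii)
      show "linear (blinfun_apply (D p))" by (simp add: blinfun.bounded_linear_right bounded_linear.linear)
      fix v
      have "delbar f p v = 0" using f p unfolding holomorphic_map_on_def by blast
      then have "2 *\<^sub>C (1/2) *\<^sub>C (D p v + \<i> *\<^sub>C D p (\<i> *\<^sub>C v)) = 0"
        by (simp add: delbar_def dir_deriv_eq[OF lim[OF p]])
      then have "\<i> *\<^sub>C (D p v + \<i> *\<^sub>C D p (\<i> *\<^sub>C v)) = 0" by (simp add: scaleC_scaleC)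
      then show "D p (\<i> *\<^sub>C v) = \<i> *\<^sub>C D p v"
        by (simp add: scaleC_add_right scaleC_ii)
    qed
    show "(f has_derivative blinfun_apply (D p)) (at p)"
      unfolding has_derivative_at_alt
    proof (intro conjI allI impI)
      show "bounded_linear (blinfun_apply (D p))" by (rule blinfun.bounded_linear_right)
      fix e :: real assume e: "e > 0"
      have "isCont D p" using cD p S by (simp add: continuous_on_eq_continuous_at)
      then obtain d1 where d1: "d1 > 0" "\<And>y. dist y p < d1 \<Longrightarrow> dist (D y) (D p) < e"
        unfolding continuous_at_eps_delta using e by metis
      obtain d2 where d2: "d2 > 0" "ball p d2 \<subseteq> S" using S p open_contains_ball by blast
      have "norm (f y - f p - D p (y - p)) \<le> e * norm (y - p)" if y: "norm (y - p) < min d1 d2" for y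
      proof -
        define h where "h = y - p"
        \<comment> \<open>Subtracting the linear part leaves a path with velocity
          \<open>D (p + t *\<^sub>R h) h - D p h\<close>, which is small by continuity of
          \<open>D\<close>.\<close>
        define g where "g = (\<lambda>t::real. f (p + t *\<^sub>R h) - t *\<^sub>R D p h)"
        have near_p: "dist (p + t *\<^sub>R h) p < min d1 d2" if "t \<in> {0..1}" for t
        proof -
          have "norm (t *\<^sub>R h) \<le> 1 * norm h" using that by (simp add: mult_left_le_one_le)
          then show ?thesis using y by (simp add: h_def dist_norm)
        qed
        have "norm (g 1 - g 0) \<le> (e * norm h) * norm (1 - 0 :: real)"
        proof (rule differentiable_bound[of "{0..1::real}" g "\<lambda>t s. s *\<^sub>R (D (p + t *\<^sub>R h) h - D p h)"])
          fix t :: real assume t: "t \<in> {0..1}"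
          have pt: "p + t *\<^sub>R h \<in> S" using near_p[OF t] d2 by (auto simp: dist_commute)
          have "((\<lambda>r. (1 / r) *\<^sub>R (f (p + (t + r) *\<^sub>R h) - f (p + t *\<^sub>R h))) \<longlongrightarrow> D (p + t *\<^sub>R h) h) (at 0)"
            using lim[OF pt, of h] unfolding diff_quot_def[abs_def] by (simp add: scaleR_add_left add.assoc)
          then have "((\<lambda>t. f (p + t *\<^sub>R h)) has_vector_derivative D (p + t *\<^sub>R h) h) (at t)"
            unfolding has_vector_derivative_iff_quotient .
          then have "(g has_vector_derivative (D (p + t *\<^sub>R h) h - D p h)) (at t)"
            unfolding g_def by (auto intro!: derivative_eq_intros)
          then show "(g has_derivative (\<lambda>s. s *\<^sub>R (D (p + t *\<^sub>R h) h - D p h))) (at t within {0..1})"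
            unfolding has_vector_derivative_def by (rule has_derivative_at_withinI)
          have "norm (D (p + t *\<^sub>R h) h - D p h) \<le> e * norm h"
          proof -
            have "norm (D (p + t *\<^sub>R h) h - D p h) \<le> norm (D (p + t *\<^sub>R h) - D p) * norm h"
              using norm_blinfun[of "D (p + t *\<^sub>R h) - D p" h] by (simp add: blinfun.diff_left)
            also have "\<dots> \<le> e * norm h"
              using d1(2)[of "p + t *\<^sub>R h"] near_p[OF t] by (intro mult_right_mono) (simp_all add: dist_norm)
            finally show ?thesis .
          qed
          from mult_left_mono[OF this]
          show "onorm (\<lambda>s. s *\<^sub>R (D (p + t *\<^sub>R h) h - D p h)) \<le> e * norm h"
            using e by (intro onorm_bound) (simp_all add: mult.commute)
        qed auto
        then show ?thesis by (simp add: g_def h_def algebra_simps)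
      qed
      then show "\<exists>d>0. \<forall>y. norm (y - p) < d \<longrightarrow> norm (f y - f p - D p (y - p)) \<le> e * norm (y - p)"
        using d1 d2 by (intro exI[of _ "min d1 d2"]) simp
    qed
  qed
qed

text \<open>Weierstrass' theorem: Cauchy estimates turn uniform convergence into uniform convergence
  of the derivatives relative to \<open>norm h\<close>. Differentiability is demanded only locally
  and eventually because the domains of the approximating maps vary with \<open>n\<close>.\<close>

lemma cdiff_on_uniform_limit:
  fixes f :: "nat \<Rightarrow> 'a::complex_normed_vector \<Rightarrow> 'b::complex_hilbert"
  assumes f: "\<And>x. x \<in> S \<Longrightarrow> \<exists>s>0. uniform_limit (ball x s) f g sequentially \<and> (\<exists>N. \<forall>n\<ge>N. cdiff_on (f n) (ball x s))"
  shows "cdiff_on g S"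
  unfolding cdiff_on_def
proof
  fix x assume "x \<in> S"
  then obtain s N where s: "s > 0" and ul: "uniform_limit (ball x s) f g sequentially"
    and N: "\<And>n. n \<ge> N \<Longrightarrow> cdiff_on (f n) (ball x s)" using f by blast
  define F where "F = (\<lambda>n. f (n + N))"
  have F: "cdiff_on (F n) (ball x s)" for n by (simp add: F_def N)
  have FU: "\<forall>\<^sub>F n in sequentially. \<forall>y\<in>ball x s. dist (F n y) (g y) < e" if "e > 0" for e
    using eventually_all_ge_at_top[OF uniform_limitD[OF ul that]]
    unfolding F_def by eventually_elim (meson le_add1)
  define t where "t = s / 2"
  have t: "t > 0" using s by (simp add: t_def)
  have sub: "ball y t \<subseteq> ball x s" if "y \<in> ball x t" for y
  proof
    fix u assume "u \<in> ball y t"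
    then show "u \<in> ball x s" using that dist_triangle[of x u y] by (simp add: t_def)
  qed
  have yin: "y \<in> ball x s" if "y \<in> ball x t" for y using that t by (simp add: t_def)
  have dF: "norm (fderiv (F m) y h - fderiv (F n) y h) \<le> e * norm h / t"
    if y: "y \<in> ball x t" and e: "\<And>u. u \<in> ball x s \<Longrightarrow> norm (F m u - F n u) \<le> e" for m n y h e
  proof -
    have "fderiv (\<lambda>u. F m u - F n u) y = (\<lambda>h. fderiv (F m) y h - fderiv (F n) y h)"
      by (intro fderiv_eq has_derivative_diff cdiff_on_fderiv(1)[OF F] yin y)
    moreover have "norm (fderiv (\<lambda>u. F m u - F n u) y h) \<le> e * norm h / t"
    proof (rule Cauchy_estimate[OF _ t])
      show "cdiff_on (\<lambda>u. F m u - F n u) (ball y t)"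
        by (intro cdiff_on_diff cdiff_on_subset[OF F sub[OF y]])
    qed (use e sub[OF y] in blast)
    ultimately show ?thesis by simp
  qed
  have Fc: "\<exists>N0. \<forall>m\<ge>N0. \<forall>n\<ge>N0. \<forall>u\<in>ball x s. norm (F m u - F n u) \<le> e" if e: "e > 0" for e
  proof -
    obtain N0 where N0: "\<And>n u. n \<ge> N0 \<Longrightarrow> u \<in> ball x s \<Longrightarrow> dist (F n u) (g u) < e/2"
      using FU[OF half_gt_zero[OF e]] unfolding eventually_sequentially by blast
    have "norm (F m u - F n u) \<le> e" if "m \<ge> N0" "n \<ge> N0" "u \<in> ball x s" for m n u
      using N0[OF that(1,3)] N0[OF that(2,3)] dist_triangle2[of "F m u" "F n u" "g u"] by (simp add: dist_norm)
    then show ?thesis by blast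
  qed
  have cau: "\<exists>N0. \<forall>m\<ge>N0. \<forall>n\<ge>N0. \<forall>y\<in>ball x t. \<forall>h. norm (fderiv (F m) y h - fderiv (F n) y h) \<le> e * norm h"
    if "e > 0" for e
  proof -
    obtain N0 where "\<forall>m\<ge>N0. \<forall>n\<ge>N0. \<forall>u\<in>ball x s. norm (F m u - F n u) \<le> e * t"
      using Fc[of "e * t"] t \<open>e > 0\<close> by auto
    then have "norm (fderiv (F m) y h - fderiv (F n) y h) \<le> e * norm h"
      if "m \<ge> N0" "n \<ge> N0" "y \<in> ball x t" for m n y h
      using dF[OF that(3), of m n "e * t" h] that t by simp
    then show ?thesis by blast
  qed
  have conv: "convergent (\<lambda>n. fderiv (F n) y h)" if y: "y \<in> ball x t" for y h
  proof (rule Cauchy_convergent, rule metric_CauchyI)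
    fix e :: real assume e: "e > 0"
    define e' where "e' = e / (norm h + 1)"
    have h1: "norm h + 1 > 0" by (rule add_nonneg_pos) auto
    have e': "e' > 0" "e' * norm h < e"
      using e h1 by (simp_all add: e'_def pos_divide_less_eq)
    obtain N0 where N0: "\<forall>m\<ge>N0. \<forall>n\<ge>N0. \<forall>y\<in>ball x t. \<forall>h. norm (fderiv (F m) y h - fderiv (F n) y h) \<le> e' * norm h"
      using cau[OF e'(1)] by blast
    have "dist (fderiv (F m) y h) (fderiv (F n) y h) < e" if "m \<ge> N0" "n \<ge> N0" for m n
      unfolding dist_norm by (rule le_less_trans[OF _ e'(2)]) (use N0 y that in blast)
    then show "\<exists>M. \<forall>m\<ge>M. \<forall>n\<ge>M. dist (fderiv (F m) y h) (fderiv (F n) y h) < e" by blast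
  qed
  define g' where "g' = (\<lambda>y h. lim (\<lambda>n. fderiv (F n) y h))"
  have g': "(\<lambda>n. fderiv (F n) y h) \<longlonglongrightarrow> g' y h" if "y \<in> ball x t" for y h
    using conv[OF that] by (simp add: g'_def convergent_LIMSEQ_iff)
  have xt: "x \<in> ball x t" using t by simp
  have nle: "\<forall>\<^sub>F n in sequentially. \<forall>y\<in>ball x t. \<forall>h. norm (fderiv (F n) y h - g' y h) \<le> e * norm h"
    if e: "e > 0" for e
  proof -
    obtain N0 where N0: "\<And>m n y h. \<lbrakk>m\<ge>N0; n\<ge>N0; y\<in>ball x t\<rbrakk> \<Longrightarrow> norm (fderiv (F m) y h - fderiv (F n) y h) \<le> e * norm h"
      using cau[OF e] by blast
    have "norm (fderiv (F m) y h - g' y h) \<le> e * norm h" if "m \<ge> N0" "y \<in> ball x t" for m y h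
    proof (rule tendsto_upperbound)
      show "(\<lambda>n. norm (fderiv (F m) y h - fderiv (F n) y h)) \<longlonglongrightarrow> norm (fderiv (F m) y h - g' y h)"
        by (intro tendsto_intros g' that)
      show "\<forall>\<^sub>F n in sequentially. norm (fderiv (F m) y h - fderiv (F n) y h) \<le> e * norm h"
        using N0 that by (auto simp: eventually_sequentially intro!: exI[of _ N0])
    qed simp
    then show ?thesis by (auto simp: eventually_sequentially intro!: exI[of _ N0])
  qed
  have Fg: "(\<lambda>n. F n y) \<longlonglongrightarrow> g y" if "y \<in> ball x s" for y
    by (rule tendstoI) (use FU that in \<open>fastforce elim: eventually_mono\<close>)
  have "\<exists>G. \<forall>y\<in>ball x t. (\<lambda>n. F n y) \<longlonglongrightarrow> G y \<and> (G has_derivative g' y) (at y within ball x t)"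
  proof (rule has_derivative_sequence[OF convex_ball _ nle xt Fg])
    show "(F n has_derivative fderiv (F n) y) (at y within ball x t)" if "y \<in> ball x t" for n y
      by (rule has_derivative_at_withinI[OF cdiff_on_fderiv(1)[OF F yin[OF that]]])
  qed (use s in auto)
  then obtain G where G: "\<And>y. y \<in> ball x t \<Longrightarrow> (\<lambda>n. F n y) \<longlonglongrightarrow> G y"
    and G': "(G has_derivative g' x) (at x within ball x t)" using xt by blast
  have "(G has_derivative g' x) (at x)"
    using G' at_within_open[OF xt open_ball] by simp
  then have "(g has_derivative g' x) (at x)"
    by (rule has_derivative_transform_within_open[OF _ open_ball xt])
      (use LIMSEQ_unique[OF G Fg[OF yin]] in blast)
  moreover have "clinear (g' x)"
  proof (rule clinearI)
    show "g' x (v + w) = g' x v + g' x w" for v w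
      using tendsto_add[OF g'[OF xt, of v] g'[OF xt, of w]] g'[OF xt, of "v + w"]
        clinear_add[OF cdiff_on_fderiv(2)[OF F yin[OF xt]]] LIMSEQ_unique by fastforce
    show "g' x (a *\<^sub>C v) = a *\<^sub>C g' x v" for a v
      using tendsto_scaleC[OF tendsto_const[of a] g'[OF xt, of v]] g'[OF xt, of "a *\<^sub>C v"]
        clinear_scaleC[OF cdiff_on_fderiv(2)[OF F yin[OF xt]]] LIMSEQ_unique by fastforce
  qed
  ultimately show "\<exists>D. clinear D \<and> (g has_derivative D) (at x)" by blast
qed

section \<open>Localization near a peak point\<close>

text \<open>A substitute for subharmonicity: \<open>W\<close> is touched from below at
  \<open>z\<close> by the modulus of a holomorphic function. That suffices for the maximum principle
  and survives taking maxima.\<close>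

definition holo_support :: "(complex \<Rightarrow> real) \<Rightarrow> complex \<Rightarrow> bool"
  where "holo_support W z \<longleftrightarrow> (\<exists>d>0. \<exists>g. g holomorphic_on ball z d \<and>
    (\<forall>w\<in>ball z d. cmod (g w) \<le> W w) \<and> cmod (g z) = W z)"

lemma holo_supportI:
  assumes "open T" "z \<in> T" "g holomorphic_on T" "\<And>w. w \<in> T \<Longrightarrow> cmod (g w) \<le> W w" "cmod (g z) = W z"
  shows "holo_support W z"
proof -
  obtain d where d: "d > 0" "ball z d \<subseteq> T" using assms(1,2) open_contains_ball by blast
  then show ?thesis unfolding holo_support_def
    using assms holomorphic_on_subset[OF assms(3) d(2)] by blast
qed

text \<open>Among the points where \<open>W\<close> is maximal, take one of greatest modulus. If it
  were interior, the supporting function would attain its maximum modulus there and be constant, so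
  \<open>W\<close> would be maximal also at points further out.\<close>

lemma max_principle_holo_support:
  assumes \<rho>: "\<rho> > 0" and cont: "continuous_on (cball 0 \<rho>) W"
    and supp: "\<And>z. cmod z < \<rho> \<Longrightarrow> holo_support W z"
    and M: "\<And>z. cmod z = \<rho> \<Longrightarrow> W z \<le> M" and z: "cmod z \<le> \<rho>"
  shows "W z \<le> M"
proof -
  obtain z0 where z0: "z0 \<in> cball 0 \<rho>" "\<And>w. w \<in> cball 0 \<rho> \<Longrightarrow> W w \<le> W z0"
    using continuous_attains_sup[OF compact_cball _ cont] \<rho> by auto
  define Z where "Z = {w \<in> cball 0 \<rho>. W w = W z0}"
  have "closed Z" unfolding Z_def
    using continuous_closed_preimage_constant[OF cont closed_cball, of "W z0"] by simp
  moreover have "bounded Z" by (rule bounded_subset[OF bounded_cball[of 0 \<rho>]]) (auto simp: Z_def)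
  ultimately have "compact Z" by (simp add: compact_eq_bounded_closed)
  moreover have "Z \<noteq> {}" using z0(1) by (auto simp: Z_def)
  ultimately obtain z1 where z1: "z1 \<in> Z" "\<And>w. w \<in> Z \<Longrightarrow> cmod w \<le> cmod z1"
    using continuous_attains_sup[of Z cmod] continuous_on_norm_id by blast
  have W1: "W z1 = W z0" "cmod z1 \<le> \<rho>" using z1(1) by (auto simp: Z_def)
  have "cmod z1 = \<rho>"
  proof (rule ccontr)
    assume "cmod z1 \<noteq> \<rho>"
    then have lt: "cmod z1 < \<rho>" using W1 by simp
    obtain d g where d: "d > 0" and g: "g holomorphic_on ball z1 d"
      "\<And>w. w \<in> ball z1 d \<Longrightarrow> cmod (g w) \<le> W w" "cmod (g z1) = W z1"
      using supp[OF lt] unfolding holo_support_def by blast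
    define e where "e = min d (\<rho> - cmod z1)"
    have e: "e > 0" using d lt by (simp add: e_def)
    have sub: "w \<in> cball 0 \<rho>" "w \<in> ball z1 d" if "w \<in> ball z1 e" for w
      using that norm_triangle_ineq2[of w z1] by (auto simp: e_def dist_norm norm_minus_commute)
    have "g constant_on ball z1 e"
    proof (rule maximum_modulus_principle[where U="ball z1 e" and \<xi>=z1])
      show "g holomorphic_on ball z1 e" by (rule holomorphic_on_subset[OF g(1)]) (simp add: e_def subset_ball)
      show "cmod (g w) \<le> cmod (g z1)" if "w \<in> ball z1 e" for w
        using g(2)[OF sub(2)[OF that]] z0(2)[OF sub(1)[OF that]] g(3) W1 by simp
    qed (use e in auto)
    then have const: "g w = g z1" if "w \<in> ball z1 e" for w
      using that e unfolding constant_on_def by (metis centre_in_ball)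
    define w where "w = z1 + of_real (e/2) * (if z1 = 0 then 1 else sgn z1)"
    have "w \<in> ball z1 e" using e by (simp add: w_def dist_norm norm_mult norm_sgn)
    then have "w \<in> Z" using const g sub z0(2) W1 by (force simp: Z_def)
    moreover have "cmod w > cmod z1"
    proof (cases "z1 = 0")
      case False
      have "w = of_real (1 + e / 2 / cmod z1) * z1"
        using False by (simp add: w_def sgn_eq algebra_simps)
      then have "cmod w = (1 + e / 2 / cmod z1) * cmod z1"
        using e by (simp only: norm_mult norm_of_real) (simp add: add_nonneg_nonneg)
      then show ?thesis using e False by (simp add: algebra_simps)
    qed (use e in \<open>simp add: w_def\<close>)
    ultimately show False using z1(2)[of w] by simp
  qed
  then show ?thesis using M[of z1] z0(2)[of z] z W1 by auto
qed

text \<open>The peak function is \<open>1 / N\<close>; its reciprocal is entire, while the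
  inequality concerns only the part of \<open>\<Omega>\<close> near \<open>p\<close>. The quadratic
  term converts closeness of \<open>cmod (N z)\<close> to 1 into closeness of \<open>z\<close> to
  \<open>p\<close>.\<close>

locale peak_point =
  fixes \<Omega> :: "'h::complex_inner set" and p :: 'h and N :: "'h \<Rightarrow> complex" and c r :: real
  assumes N: "cdiff_on N UNIV" and Np: "N p = 1" and c: "c > 0" and r: "r > 0"
    and peak: "\<And>z. z \<in> \<Omega> \<Longrightarrow> z \<in> ball p r \<Longrightarrow> 1 + c * (norm (z - p))\<^sup>2 \<le> (cmod (N z))\<^sup>2"
begin

lemma N_ge_one: "z \<in> \<Omega> \<Longrightarrow> z \<in> ball p r \<Longrightarrow> 1 \<le> cmod (N z)"
proof -
  assume z: "z \<in> \<Omega>" "z \<in> ball p r"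
  have "1\<^sup>2 \<le> 1 + c * (norm (z - p))\<^sup>2" using c by simp
  also have "\<dots> \<le> (cmod (N z))\<^sup>2" by (rule peak[OF z])
  finally show ?thesis by (rule power2_le_imp_le) simp
qed

lemma isCont_N: "isCont N z"
  using cdiff_on_continuous[OF N] by (simp add: continuous_on_eq_continuous_at)

definition disc :: "(complex \<Rightarrow> 'h) \<Rightarrow> bool"
  where "disc F \<longleftrightarrow> cdiff_on F (ball 0 1) \<and> (\<forall>l\<in>ball 0 1. F l \<in> \<Omega>)"

text \<open>In the next proof \<open>V\<close> equals \<open>\<bar>F - F 0\<bar> / \<bar>N \<circ> F\<bar>\<^sup>A\<close> near \<open>F 0\<close> and a constant \<open>\<kappa>\<close> far away; the
  peak function makes the transition possible. Being locally supported from below by moduli of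
  holomorphic functions, \<open>V\<^sup>2 / \<bar>l\<bar>\<close> obeys the maximum principle, which bounds \<open>V\<^sup>2\<close> by a multiple
  of \<open>\<bar>l\<bar>\<close>. The square makes the quotient vanish continuously at \<open>0\<close>.\<close>

lemma disc_stays_near_aux:
  fixes F :: "complex \<Rightarrow> 'h"
  assumes F: "cdiff_on F (ball 0 1)" and F\<Omega>: "\<And>l. l \<in> ball 0 1 \<Longrightarrow> F l \<in> \<Omega>"
    and R: "0 < R" "R < R2" "R2 < R3" and \<kappa>: "0 < \<kappa>" "\<kappa> \<le> R3"
    and near: "norm (F 0 - p) \<le> r - R3"
    and inner: "\<And>z. z \<in> \<Omega> \<Longrightarrow> norm (z - F 0) = R \<Longrightarrow> \<kappa> < norm (z - F 0) / cmod (N z) ^ A"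
    and outer: "\<And>z. z \<in> \<Omega> \<Longrightarrow> R2 \<le> norm (z - F 0) \<Longrightarrow> norm (z - F 0) < R3 \<Longrightarrow> norm (z - F 0) / cmod (N z) ^ A < \<kappa>"
    and l: "cmod l < 1 / 2" "cmod l < \<kappa>\<^sup>2 / (2 * R3\<^sup>2)"
  shows "norm (F l - F 0) < R"
proof -
  define x where "x = (\<lambda>l. F l - F 0)"
  define v where "v = (\<lambda>l. norm (x l) / cmod (N (F l)) ^ A)"
  define V where "V = (\<lambda>l. if norm (x l) < R then v l else if norm (x l) < R3 then max (v l) \<kappa> else \<kappa>)"
  define B where "B = ball (0::complex) 1"
  have cF: "continuous_on B F" unfolding B_def by (rule cdiff_on_continuous[OF F])
  have cx: "continuous_on B (\<lambda>l. norm (x l))" unfolding x_def by (intro continuous_intros cF)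
  have FB: "F l \<in> ball p r" if "norm (x l) < R3" for l
    using that near norm_triangle_ineq[of "F l - F 0" "F 0 - p"] by (simp add: x_def dist_norm norm_minus_commute)
  have N1: "1 \<le> cmod (N (F l))" if "l \<in> B" "norm (x l) < R3" for l
    using N_ge_one[OF F\<Omega> FB] that by (simp add: B_def)
  have v_le: "v l \<le> norm (x l)" if "l \<in> B" "norm (x l) < R3" for l
    using one_le_power[OF N1[OF that], of A] by (simp add: v_def divide_le_eq mult_left_le_imp_le mult_le_cancel_left1)
  have opens: "open {l \<in> B. norm (x l) < t}" "open {l \<in> B. norm (x l) > t}" for t
    using continuous_open_preimage[OF cx, of "{..<t}"] continuous_open_preimage[OF cx, of "{t<..}"]
    by (auto simp: B_def vimage_def Int_def)
  have cNF: "continuous_on B (\<lambda>l. N (F l))"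
    by (rule continuous_on_compose2[OF cdiff_on_continuous[OF N] cF]) simp
  have cv: "continuous_on {l \<in> B. norm (x l) < R3} v" unfolding v_def
    using N1 by (intro continuous_intros continuous_on_subset[OF cx] continuous_on_subset[OF cNF]) force+
  \<comment> \<open>On these three open sets \<open>V\<close> is \<open>v\<close>,
    \<open>max v \<kappa>\<close> and \<open>\<kappa>\<close>. The hypothesis \<open>inner\<close>
    puts the sphere of radius \<open>R\<close> into \<open>O1\<close>, and \<open>outer\<close>
    makes the maximum equal to \<open>\<kappa>\<close> on the shell between \<open>R2\<close> and
    \<open>R3\<close>, so the pieces overlap consistently.\<close>
  define O1 where "O1 = {l \<in> B. norm (x l) < R} \<union> {l \<in> {l \<in> B. norm (x l) < R3}. v l > \<kappa>}"
  define O2 where "O2 = {l \<in> B. norm (x l) > R} \<inter> {l \<in> B. norm (x l) < R3}"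
  define O3 where "O3 = {l \<in> B. norm (x l) > R2}"
  have oO: "open O1" "open O2" "open O3"
  proof -
    have "open {l \<in> {l \<in> B. norm (x l) < R3}. v l > \<kappa>}"
      using continuous_open_preimage[OF cv opens(1) open_greaterThan, of \<kappa>] by (simp add: vimage_def Int_def)
    then show "open O1" unfolding O1_def by (intro open_Un opens)
    show "open O2" "open O3" unfolding O2_def O3_def by (intro open_Int opens)+
  qed
  have cover: "l \<in> O1 \<or> l \<in> O2 \<or> l \<in> O3" if "l \<in> B" for l
  proof -
    have "l \<in> O1" if "norm (x l) \<le> R"
      using inner[OF F\<Omega>, of l] \<open>l \<in> B\<close> that R by (cases "norm (x l) = R") (auto simp: O1_def v_def x_def B_def)
    moreover have "l \<in> O2" if "norm (x l) > R" "norm (x l) < R3" using \<open>l \<in> B\<close> that by (simp add: O2_def)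
    moreover have "l \<in> O3" if "norm (x l) \<ge> R3" using \<open>l \<in> B\<close> that R by (simp add: O3_def)
    ultimately show ?thesis by linarith
  qed
  have VO: "l \<in> O1 \<Longrightarrow> V l = v l" "l \<in> O2 \<Longrightarrow> V l = max (v l) \<kappa>" "l \<in> O3 \<Longrightarrow> V l = \<kappa>" for l
  proof -
    show "l \<in> O1 \<Longrightarrow> V l = v l" "l \<in> O2 \<Longrightarrow> V l = max (v l) \<kappa>"
      using R by (auto simp: O1_def O2_def V_def)
    show "V l = \<kappa>" if "l \<in> O3"
      using outer[OF F\<Omega>, of l] that R by (auto simp: O3_def V_def v_def x_def B_def max_def)
  qed
  have sub3: "O1 \<subseteq> {l \<in> B. norm (x l) < R3}" "O2 \<subseteq> {l \<in> B. norm (x l) < R3}"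
    using R by (auto simp: O1_def O2_def)
  have cV: "isCont V l" if l: "l \<in> B" for l
  proof -
    have c1: "continuous_on O1 V" using continuous_on_subset[OF cv sub3(1)] VO(1)
      by (simp cong: continuous_on_cong)
    have "continuous_on O2 (\<lambda>l. max (v l) \<kappa>)"
      by (intro continuous_on_max continuous_on_subset[OF cv sub3(2)] continuous_on_const)
    then have c2: "continuous_on O2 V" using VO(2) by (simp cong: continuous_on_cong)
    have c3: "continuous_on O3 V" using VO(3) by (simp cong: continuous_on_cong)
    show ?thesis
      using cover[OF l] c1 c2 c3 oO by (auto simp: continuous_on_eq_continuous_at)
  qed
  have V0: "V l \<ge> 0" for l using \<kappa> by (auto simp: V_def v_def max_def)
  have VR: "V l \<le> R3" if "l \<in> B" for l
    using v_le[OF that] R \<kappa> by (auto simp: V_def)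
  have supp: "\<exists>T g. open T \<and> l \<in> T \<and> g holomorphic_on T \<and> (\<forall>w\<in>T. cmod (g w) \<le> V w) \<and> cmod (g l) = V l"
    if l: "l \<in> B" for l
  proof -
    \<comment> \<open>Pairing with the direction of \<open>x l\<close> makes \<open>cmod g\<close>
      touch \<open>v\<close> at \<open>l\<close> while staying below \<open>v\<close>
      elsewhere.\<close>
    define b where "b = (1 / norm (x l)) *\<^sub>R x l"
    define g where "g = (\<lambda>w. cinner b (x w) * inverse (N (F w)) ^ A)"
    have nb: "norm b \<le> 1" by (simp add: b_def)
    have T3: "open {l \<in> B. norm (x l) < R3}" by (rule opens)
    have "cdiff_on (\<lambda>w. N (F w)) {l \<in> B. norm (x l) < R3}"
      by (rule cdiff_on_compose[OF cdiff_on_subset[OF F] N]) (auto simp: B_def)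
    moreover have "cdiff_on x {l \<in> B. norm (x l) < R3}"
      unfolding x_def by (intro cdiff_on_diff cdiff_on_const cdiff_on_subset[OF F]) (auto simp: B_def)
    ultimately have "cdiff_on g {l \<in> B. norm (x l) < R3}" unfolding g_def
      using N1 by (intro cdiff_on_mult cdiff_on_cinner cdiff_on_power cdiff_on_inverse) force+
    then have hg: "g holomorphic_on {l \<in> B. norm (x l) < R3}" using cdiff_on_complex[OF T3] by blast
    have gv: "cmod (g w) \<le> v w" for w
    proof -
      have "cmod (cinner b (x w)) \<le> 1 * norm (x w)"
        by (rule order_trans[OF Cauchy_Schwarz_cinner]) (intro mult_right_mono nb norm_ge_zero)
      then show ?thesis
        by (simp add: g_def v_def norm_mult norm_power norm_inverse divide_inverse power_inverse mult_right_mono)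
    qed
    have "cinner b (x l) = of_real (norm (x l))"
      by (cases "x l = 0") (simp_all add: b_def cinner_scaleR_left cinner_self power2_eq_square)
    then have gl: "cmod (g l) = v l"
      by (simp add: g_def v_def norm_mult norm_power norm_inverse divide_inverse power_inverse)
    have k: "(\<lambda>_. of_real \<kappa>) holomorphic_on T" "cmod (of_real \<kappa>) = \<kappa>" for T using \<kappa> by auto
    consider "l \<in> O1" | "l \<in> O2" "v l \<ge> \<kappa>" | "l \<in> O2" "v l < \<kappa>" | "l \<in> O3" using cover[OF l] by fastforce
    then show ?thesis
    proof cases
      case 1
      then show ?thesis using oO(1) holomorphic_on_subset[OF hg sub3(1)] gv gl VO(1)
        by (intro exI[of _ O1] exI[of _ g]) auto
    next
      case 2
      then show ?thesis using oO(2) holomorphic_on_subset[OF hg sub3(2)] gv gl VO(2)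
        by (intro exI[of _ O2] exI[of _ g]) (auto simp: max_def intro: order_trans)
    next
      case 3
      then show ?thesis using oO(2) k VO(2)
        by (intro exI[of _ O2] exI[of _ "\<lambda>_. of_real \<kappa>"]) auto
    next
      case 4
      then show ?thesis using oO(3) k VO(3)
        by (intro exI[of _ O3] exI[of _ "\<lambda>_. of_real \<kappa>"]) auto
    qed
  qed
  define W where "W = (\<lambda>l. (V l)\<^sup>2 / cmod l)"
  have "W l \<le> R3\<^sup>2 / (1/2)"
  proof (rule max_principle_holo_support[where \<rho>="1/2"])
    have sB: "cball 0 (1/2) \<subseteq> B" by (auto simp: B_def)
    have "isCont W l" if l: "l \<in> B" for l
    proof (cases "l = 0")
      case False
      then show ?thesis unfolding W_def using cV[OF l] by (intro continuous_intros) auto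
    next
      case True
      \<comment> \<open>Near \<open>0\<close> the Schwarz lemma gives
        \<open>V y <= norm (x y) <= M / s * cmod y\<close>, so \<open>W\<close> tends to
        \<open>0\<close>, which is also its value at \<open>0\<close> because division by zero is
        zero.\<close>
      obtain s M where s: "s > 0" "ball 0 s \<subseteq> B \<inter> {l \<in> B. norm (x l) < R}"
        and M: "\<And>y. y \<in> ball 0 s \<Longrightarrow> norm (F y - F 0) \<le> M"
      proof (rule cdiff_on_locally_bounded[where f="\<lambda>y. F y - F 0" and x="0::complex"])
        show "cdiff_on (\<lambda>y. F y - F 0) (B \<inter> {l \<in> B. norm (x l) < R})"
          by (intro cdiff_on_diff cdiff_on_const cdiff_on_subset[OF F]) (auto simp: B_def)
        show "open (B \<inter> {l \<in> B. norm (x l) < R})" using opens by (auto simp: B_def)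
        show "0 \<in> B \<inter> {l \<in> B. norm (x l) < R}" using R by (auto simp: B_def x_def)
      qed blast
      have W_le: "W y \<le> (M / s)\<^sup>2 * cmod y" if y: "y \<in> ball 0 s" for y
      proof -
        have yR: "y \<in> B" "norm (x y) < R" using s(2) y by auto
        have "norm (x y) \<le> M * norm (y - 0) / s"
          unfolding x_def
          by (rule Schwarz_lemma_vector[OF cdiff_on_diff[OF cdiff_on_subset[OF F] cdiff_on_const] s(1) M])
            (use s y in \<open>auto simp: B_def\<close>)
        moreover have "V y \<le> norm (x y)" using yR v_le[OF yR(1)] R by (simp add: V_def)
        ultimately have "(V y)\<^sup>2 \<le> (M / s * cmod y)\<^sup>2" using V0 by (intro power_mono) auto
        then show ?thesis
          by (cases "y = 0") (simp_all add: W_def divide_le_eq power_mult_distrib power2_eq_square ac_simps)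
      qed
      have "((\<lambda>y. (M / s)\<^sup>2 * cmod y) \<longlongrightarrow> (M / s)\<^sup>2 * cmod 0) (at 0)" by (intro tendsto_intros)
      then have z: "((\<lambda>y. (M / s)\<^sup>2 * cmod y) \<longlongrightarrow> 0) (at 0)" by simp
      have "\<forall>\<^sub>F y in at 0. y \<in> ball (0::complex) s" using s by (intro eventually_at_in_open') auto
      then have "\<forall>\<^sub>F y in at 0. norm (W y) \<le> (M / s)\<^sup>2 * cmod y"
        by eventually_elim (use W_le in \<open>auto simp: W_def\<close>)
      then have "(W \<longlongrightarrow> 0) (at 0)" by (rule Lim_null_comparison[OF _ z])
      then show ?thesis unfolding True isCont_def by (simp add: W_def)
    qed
    then show "continuous_on (cball 0 (1/2)) W" using sB by (intro continuous_at_imp_continuous_on) blast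
    show "holo_support W z" if "cmod z < 1/2" for z
    proof (cases "z = 0")
      case True
      show ?thesis
        by (rule holo_supportI[of UNIV _ "\<lambda>_. 0"]) (auto simp: W_def True)
    next
      case False
      have zB: "z \<in> B" using that by (simp add: B_def)
      obtain T g where T: "open T" "z \<in> T" "g holomorphic_on T" "\<And>w. w \<in> T \<Longrightarrow> cmod (g w) \<le> V w" "cmod (g z) = V z"
        using supp[OF zB] by blast
      show ?thesis
      proof (rule holo_supportI[of "T - {0}" _ "\<lambda>w. (g w)\<^sup>2 / w"])
        show "(\<lambda>w. (g w)\<^sup>2 / w) holomorphic_on T - {0}"
          by (intro holomorphic_intros holomorphic_on_subset[OF T(3)]) auto
        show "cmod ((g w)\<^sup>2 / w) \<le> W w" if "w \<in> T - {0}" for w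
          using T(4)[of w] that by (auto simp: W_def norm_divide norm_power intro!: divide_right_mono power_mono)
        show "cmod ((g z)\<^sup>2 / z) = W z" using T(5) by (simp add: W_def norm_divide norm_power)
      qed (use T False in auto)
    qed
    show "W z \<le> R3\<^sup>2 / (1/2)" if "cmod z = 1/2" for z
      unfolding W_def that using VR[of z] V0[of z] that
      by (intro divide_right_mono power_mono) (auto simp: B_def)
  qed (use l in auto)
  then have W2: "W l \<le> 2 * R3\<^sup>2" by simp
  show ?thesis
  proof (rule ccontr)
    assume "\<not> norm (F l - F 0) < R"
    \<comment> \<open>Outside the inner ball \<open>V\<close> is at least \<open>\<kappa>\<close>,
      whereas \<open>(V l)^2 = W l * cmod l\<close> is below \<open>\<kappa>^2\<close> for such
      small \<open>l\<close>.\<close>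
    then have ge: "V l \<ge> \<kappa>" by (auto simp: V_def x_def)
    have l0: "l \<noteq> 0" using \<open>\<not> norm (F l - F 0) < R\<close> R by auto
    have "\<kappa>\<^sup>2 \<le> (V l)\<^sup>2" using ge \<kappa> by (intro power_mono) auto
    also have "\<dots> = W l * cmod l" using l0 by (simp add: W_def)
    also have "\<dots> \<le> 2 * R3\<^sup>2 * cmod l" using W2 by (intro mult_right_mono) auto
    also have "\<dots> < \<kappa>\<^sup>2"
    proof -
      have "0 < R3\<^sup>2 * 2" using R by simp
      then show ?thesis using l(2) by (simp add: pos_less_divide_eq mult.commute)
    qed
    finally show False by simp
  qed
qed

text \<open>First localization, with a possibly tiny radius \<open>s\<close>. Near \<open>p\<close>
  the modulus of \<open>N\<close> is below \<open>\<theta>\<close>, at distance at least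
  \<open>r / 8\<close> it is at least \<open>m > \<theta>\<close>. A large power \<open>A\<close>
  separates the two so strongly that \<open>norm (z - F 0) / cmod (N z) ^ A\<close> is larger on a
  small sphere than on a shell further out, as the barrier requires.\<close>

lemma disc_stays_near:
  "\<exists>s>0. s < 1 \<and> (\<exists>\<delta>>0. \<forall>F. disc F \<longrightarrow>
     norm (F 0 - p) < \<delta> \<longrightarrow> (\<forall>l\<in>ball 0 s. F l \<in> ball p r))"
proof -
  define m where "m = sqrt (1 + c * (r / 8)\<^sup>2)"
  have m1: "m > 1" using c r by (simp add: m_def)
  define \<theta> where "\<theta> = (1 + m) / 2"
  have \<theta>: "1 < \<theta>" "\<theta> < m" using m1 by (simp_all add: \<theta>_def)
  have "\<theta> - 1 > 0" using \<theta> by simp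
  then obtain d where d: "d > 0" "\<And>z. dist z p < d \<Longrightarrow> dist (N z) (N p) < \<theta> - 1"
    using isCont_N[of p] unfolding continuous_at_eps_delta by metis
  have N\<theta>: "cmod (N z) < \<theta>" if "norm (z - p) < d" for z
    using d(2)[of z] that norm_triangle_ineq2[of "N z" 1] by (simp add: dist_norm Np)
  define R where "R = min (d / 2) (r / 8)"
  have R: "0 < R" "R \<le> d / 2" "R \<le> r / 8" using d r by (simp_all add: R_def)
  define R3 where "R3 = r / 2"
  have "\<exists>A. R3 / R < (m / \<theta>) ^ A" using \<theta> by (intro real_arch_pow) simp
  then obtain A where A: "R3 / R < (m / \<theta>) ^ A" by blast
  define \<kappa> where "\<kappa> = R3 / m ^ A"
  have mA: "m ^ A \<ge> 1" "\<theta> ^ A > 0" using m1 \<theta> by (simp_all add: one_le_power)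
  have R3: "R3 > 0" using r by (simp add: R3_def)
  have \<kappa>: "0 < \<kappa>" "\<kappa> \<le> R3" "\<kappa> < R / \<theta> ^ A"
    using mA R3 A R by (simp_all add: \<kappa>_def field_simps power_divide)
  define s where "s = min (1 / 2) (\<kappa>\<^sup>2 / (2 * R3\<^sup>2))"
  have s: "0 < s" "s \<le> 1 / 2" using \<kappa> R3 by (simp_all add: s_def)
  define \<delta> where "\<delta> = min (d / 2) (r / 8)"
  have \<delta>: "0 < \<delta>" "\<delta> \<le> d / 2" "\<delta> \<le> r / 8" using d r by (simp_all add: \<delta>_def)
  have "F l \<in> ball p r"
    if dF: "disc F"
      and F0: "norm (F 0 - p) < \<delta>" and l: "l \<in> ball 0 s" for F l
  proof -
    have F: "cdiff_on F (ball 0 1)" and F\<Omega>: "\<And>l. l \<in> ball 0 1 \<Longrightarrow> F l \<in> \<Omega>" using dF by (auto simp: disc_def)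
    have tri: "norm (z - p) \<le> norm (z - F 0) + norm (F 0 - p)" "norm (z - F 0) \<le> norm (z - p) + norm (F 0 - p)" for z
      using norm_triangle_ineq[of "z - F 0" "F 0 - p"] norm_triangle_ineq4[of "z - p" "F 0 - p"] by simp_all
    have inner: "\<kappa> < norm (z - F 0) / cmod (N z) ^ A" if z: "z \<in> \<Omega>" and zR: "norm (z - F 0) = R" for z
    proof -
      have "norm (z - p) < d" "norm (z - p) < r" using tri[of z] F0 \<delta> R zR r by linarith+
      then have n: "cmod (N z) < \<theta>" "1 \<le> cmod (N z)"
        using N\<theta> N_ge_one[OF z] by (simp_all add: dist_norm norm_minus_commute)
      have n0: "0 < cmod (N z) ^ A" using n(2) by (intro zero_less_power) linarith
      have "\<kappa> < R / \<theta> ^ A" by (rule \<kappa>)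
      also have "\<dots> \<le> R / cmod (N z) ^ A"
        using n R mA n0 by (intro divide_left_mono power_mono mult_pos_pos) auto
      finally show ?thesis by (simp add: zR)
    qed
    have outer: "norm (z - F 0) / cmod (N z) ^ A < \<kappa>"
      if z: "z \<in> \<Omega>" and zR: "r/4 \<le> norm (z - F 0)" "norm (z - F 0) < R3" for z
    proof -
      have zp: "r/8 \<le> norm (z - p)" "norm (z - p) < r" using tri[of z] F0 \<delta> R zR r unfolding R3_def by linarith+
      have "m\<^sup>2 = 1 + c * (r / 8)\<^sup>2" using c by (simp add: m_def)
      also have "\<dots> \<le> 1 + c * (norm (z - p))\<^sup>2"
        using zp r c by (intro add_left_mono mult_left_mono power_mono) auto
      also have "\<dots> \<le> (cmod (N z))\<^sup>2" using zp by (intro peak z) (simp add: dist_norm norm_minus_commute)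
      finally have mN: "m \<le> cmod (N z)" by (rule power2_le_imp_le) simp
      have "norm (z - F 0) / cmod (N z) ^ A \<le> norm (z - F 0) / m ^ A"
        using mN m1 by (intro divide_left_mono power_mono mult_pos_pos zero_less_power) auto
      also have "\<dots> < \<kappa>" unfolding \<kappa>_def using zR mA by (intro divide_strict_right_mono) auto
      finally show ?thesis .
    qed
    have "norm (F l - F 0) < R"
    proof (rule disc_stays_near_aux[OF F F\<Omega> _ _ _ \<kappa>(1,2) _ inner outer])
      show "norm (F 0 - p) \<le> r - R3" using F0 \<delta> r by (simp add: R3_def)
      show "0 < R" "R < r/4" "r/4 < R3" using R r by (simp_all add: R3_def)
      show "cmod l < 1/2" "cmod l < \<kappa>\<^sup>2 / (2 * R3\<^sup>2)" using l by (simp_all add: s_def)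
    qed
    then show ?thesis
      using norm_triangle_ineq[of "F l - F 0" "F 0 - p"] F0 \<delta> R r by (simp add: dist_norm norm_minus_commute)
  qed
  then show ?thesis using s \<delta>(1) by (intro exI[of _ s]) auto
qed

text \<open>The radius \<open>s\<close> is independent of \<open>\<epsilon>\<close>, which the later
  iteration needs. While the disc stays in \<open>ball p r\<close>, the function
  \<open>1 / N\<close> along it is bounded by 1 and almost 1 at the centre. Harnack's inequality
  keeps its modulus almost 1 on half the disc, and \<open>peak\<close> turns this into closeness to
  \<open>p\<close>.\<close>

lemma disc_localization_small:
  "\<exists>s>0. s < 1 \<and> (\<forall>\<epsilon>>0. \<exists>\<delta>>0. \<forall>F. disc F \<longrightarrow>
     norm (F 0 - p) < \<delta> \<longrightarrow> (\<forall>l\<in>ball 0 s. norm (F l - p) < \<epsilon>))"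
proof -
  obtain s \<delta>0 where s: "s > 0" "s < 1" and \<delta>0: "\<delta>0 > 0"
    and stay: "\<And>F l. disc F \<Longrightarrow> norm (F 0 - p) < \<delta>0 \<Longrightarrow>
      l \<in> ball 0 s \<Longrightarrow> F l \<in> ball p r"
    using disc_stays_near by blast
  have "\<exists>\<delta>>0. \<forall>F. disc F \<longrightarrow>
     norm (F 0 - p) < \<delta> \<longrightarrow> (\<forall>l\<in>ball 0 (s/2). norm (F l - p) < \<epsilon>)" if \<epsilon>: "\<epsilon> > 0" for \<epsilon>
  proof -
    define \<mu> where "\<mu> = 1 / sqrt (1 + c * \<epsilon>\<^sup>2)"
    have "c * \<epsilon>\<^sup>2 > 0" using c \<epsilon> by simp
    then have sq: "sqrt (1 + c * \<epsilon>\<^sup>2) > 1" by simp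
    then have \<mu>: "0 < \<mu>" "\<mu> < 1" unfolding \<mu>_def by (simp_all only: zero_less_divide_iff divide_less_eq) auto
    have "isCont (\<lambda>z. 1 / N z) p" by (intro continuous_intros isCont_N) (simp add: Np)
    moreover have "(1 - \<mu>) / 3 > 0" using \<mu> by simp
    ultimately obtain d where d: "d > 0" "\<And>z. dist z p < d \<Longrightarrow> dist (1 / N z) (1 / N p) < (1 - \<mu>) / 3"
      unfolding continuous_at_eps_delta by metis
    have "norm (F l - p) < \<epsilon>"
      if dF: "disc F"
        and F0: "norm (F 0 - p) < min \<delta>0 d" and l: "l \<in> ball 0 (s/2)" for F l
    proof -
      have F: "cdiff_on F (ball 0 1)" and F\<Omega>: "\<And>l. l \<in> ball 0 1 \<Longrightarrow> F l \<in> \<Omega>" using dF by (auto simp: disc_def)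
      define f where "f = (\<lambda>l. inverse (N (F l)))"
      have Fr: "F l \<in> \<Omega>" "F l \<in> ball p r" if "cmod l < s" for l
        using F\<Omega>[of l] stay[OF dF, of l] F0 that s by simp_all
      have N1: "1 \<le> cmod (N (F l))" if "cmod l < s" for l using N_ge_one[OF Fr[OF that]] .
      have f1: "cmod (f l) \<le> 1" if "cmod l < s" for l
        using N1[OF that] by (simp add: f_def norm_inverse inverse_le_1_iff)
      have "cdiff_on f (ball 0 s)" unfolding f_def
      proof (rule cdiff_on_inverse)
        show "cdiff_on (\<lambda>l. N (F l)) (ball 0 s)"
          using s by (intro cdiff_on_compose[OF cdiff_on_subset[OF F] N]) auto
      qed (use N1 in force)
      then have hf: "f holomorphic_on ball 0 s" by (simp add: cdiff_on_complex)
      \<comment> \<open>A rotation making the value at \<open>0\<close> positive, so that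
        \<open>1 - \<beta> * f\<close> has nonnegative real part, small at \<open>0\<close>.\<close>
      define \<beta> where "\<beta> = cnj (sgn (f 0))"
      have f0: "cmod (f 0) > 1 - (1 - \<mu>) / 3"
      proof -
        have "cmod (1 / N (F 0) - 1) < (1 - \<mu>) / 3" using d(2)[of "F 0"] F0 by (simp add: dist_norm Np)
        then have "cmod (f 0 - 1) < (1 - \<mu>) / 3" by (simp add: f_def inverse_eq_divide)
        moreover have "1 - cmod (f 0) \<le> cmod (f 0 - 1)"
          using norm_triangle_ineq2[of 1 "f 0"] by (simp add: norm_minus_commute)
        ultimately show ?thesis by linarith
      qed
      have f0': "f 0 \<noteq> 0"
      proof
        assume "f 0 = 0"
        then have "1 - (1 - \<mu>) / 3 < 0" using f0 by simp
        then show False using \<mu> by (simp add: field_simps)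
      qed
      have \<beta>: "cmod \<beta> = 1" "\<beta> * f 0 = of_real (cmod (f 0))"
      proof -
        show "cmod \<beta> = 1" using f0' by (simp add: \<beta>_def norm_sgn)
        have "cnj (f 0) * f 0 = of_real (cmod (f 0)) * of_real (cmod (f 0))"
          using complex_norm_square[of "f 0"] by (simp add: mult.commute power2_eq_square)
        then show "\<beta> * f 0 = of_real (cmod (f 0))"
          using f0' by (simp add: \<beta>_def sgn_eq)
      qed
      have ls: "cmod l < s" "cmod l < s / 2" using l s by auto
      have "Re (1 - \<beta> * f l) * (s - cmod l) \<le> Re (1 - \<beta> * f 0) * (s + cmod l)"
      proof (rule Harnack_inequality(1)[where g="\<lambda>l. 1 - \<beta> * f l"])
        show "(\<lambda>l. 1 - \<beta> * f l) holomorphic_on ball 0 s" by (intro holomorphic_intros hf)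
        show "0 \<le> Re (1 - \<beta> * f z)" if "cmod z < s" for z
          using complex_Re_le_cmod[of "\<beta> * f z"] f1[OF that] \<beta> by (simp add: norm_mult)
      qed (use s ls in auto)
      \<comment> \<open>On the half disc the Harnack factor is at most
        \<open>(3 / 2 * s) / (s / 2) = 3\<close>; this is the 3 in the choice of
        \<open>d\<close>.\<close>
      also have "\<dots> \<le> (1 - cmod (f 0)) * (3 / 2 * s)"
        unfolding \<beta> using ls f1[of 0] s by (intro mult_mono) auto
      finally have *: "Re (1 - \<beta> * f l) * (s - cmod l) \<le> (1 - cmod (f 0)) * (3 / 2 * s)" .
      have R0: "Re (1 - \<beta> * f l) \<ge> 0"
        using complex_Re_le_cmod[of "\<beta> * f l"] f1[OF ls(1)] \<beta> by (simp add: norm_mult)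
      have "Re (1 - \<beta> * f l) * (s / 2) \<le> Re (1 - \<beta> * f l) * (s - cmod l)"
        using R0 ls by (intro mult_left_mono) auto
      with * have "Re (1 - \<beta> * f l) * (s / 2) \<le> (3 * (1 - cmod (f 0))) * (s / 2)" by (simp add: algebra_simps)
      then have "Re (1 - \<beta> * f l) \<le> 3 * (1 - cmod (f 0))" using s by simp
      also have "\<dots> < 1 - \<mu>" using f0 by (simp add: field_simps)
      finally have "Re (\<beta> * f l) > \<mu>" by simp
      then have "cmod (f l) > \<mu>"
        using complex_Re_le_cmod[of "\<beta> * f l"] \<beta> by (simp add: norm_mult)
      then have "cmod (N (F l)) < sqrt (1 + c * \<epsilon>\<^sup>2)"
      proof -
        assume "cmod (f l) > \<mu>"
        then have "1 / sqrt (1 + c * \<epsilon>\<^sup>2) < 1 / cmod (N (F l))"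
          by (simp add: f_def \<mu>_def norm_divide inverse_eq_divide)
        moreover have "cmod (N (F l)) > 0" "sqrt (1 + c * \<epsilon>\<^sup>2) > 0" using N1[OF ls(1)] sq by linarith+
        ultimately show ?thesis by (simp add: divide_less_eq field_simps)
      qed
      then have "(cmod (N (F l)))\<^sup>2 < 1 + c * \<epsilon>\<^sup>2"
        using real_less_rsqrt real_sqrt_less_iff[of "(cmod (N (F l)))\<^sup>2" "1 + c * \<epsilon>\<^sup>2"] by simp
      with peak[OF Fr[OF ls(1)]] have "c * (norm (F l - p))\<^sup>2 < c * \<epsilon>\<^sup>2" by linarith
      then have "(norm (F l - p))\<^sup>2 < \<epsilon>\<^sup>2" using c by simp
      then show ?thesis using \<epsilon> by (simp add: power_less_imp_less_base)
    qed
    then show ?thesis using d(1) \<delta>0 by (intro exI[of _ "min \<delta>0 d"]) simp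
  qed
  then show ?thesis using s by (intro exI[of _ "s/2"]) auto
qed

text \<open>Iteration from radius \<open>1 - b ^ k\<close> to \<open>1 - b ^ Suc k\<close> with
  \<open>b = 1 - s\<close>: a point \<open>l0\<close> of the smaller disc is the centre of a disc of
  radius at least \<open>b ^ k\<close>, of which the fraction \<open>s\<close> is controlled, and
  \<open>1 - b ^ k + s * b ^ k = 1 - b ^ Suc k\<close>.\<close>

lemma disc_localization:
  assumes r0: "r0 < 1" and \<epsilon>: "\<epsilon> > 0"
  shows "\<exists>\<delta>>0. \<forall>F. disc F \<longrightarrow>
     norm (F 0 - p) < \<delta> \<longrightarrow> (\<forall>l\<in>ball 0 r0. norm (F l - p) < \<epsilon>)"
proof -
  obtain s where s: "s > 0" "s < 1" and loc: "\<And>\<epsilon>. \<epsilon> > 0 \<Longrightarrow> \<exists>\<delta>>0. \<forall>F. disc F \<longrightarrow> norm (F 0 - p) < \<delta> \<longrightarrow> (\<forall>l\<in>ball 0 s. norm (F l - p) < \<epsilon>)"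
    using disc_localization_small by blast
  define b where "b = 1 - s"
  have b: "0 < b" "b < 1" using s by (simp_all add: b_def)
  have chain: "\<exists>\<delta>>0. \<forall>F. disc F \<longrightarrow>
     norm (F 0 - p) < \<delta> \<longrightarrow> (\<forall>l\<in>ball 0 (1 - b ^ k). norm (F l - p) < \<epsilon>)" if "\<epsilon> > 0" for \<epsilon> k
    using that
  proof (induction k arbitrary: \<epsilon>)
    case 0
    then show ?case by (intro exI[of _ 1]) auto
  next
    case (Suc k)
    obtain \<delta>1 where \<delta>1: "\<delta>1 > 0" and loc1: "\<And>F l. disc F \<Longrightarrow>
       norm (F 0 - p) < \<delta>1 \<Longrightarrow> l\<in>ball 0 s \<Longrightarrow> norm (F l - p) < \<epsilon>"
      using loc[OF Suc.prems] by blast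
    obtain \<delta>2 where \<delta>2: "\<delta>2 > 0" and loc2: "\<And>F l. disc F \<Longrightarrow>
       norm (F 0 - p) < \<delta>2 \<Longrightarrow> l\<in>ball 0 (1 - b ^ k) \<Longrightarrow> norm (F l - p) < min \<epsilon> \<delta>1"
      using Suc.IH[of "min \<epsilon> \<delta>1"] Suc.prems \<delta>1 by (metis min_less_iff_conj)
    have "norm (F l - p) < \<epsilon>"
      if dF: "disc F"
        and F0: "norm (F 0 - p) < min \<delta>1 \<delta>2" and l: "l \<in> ball 0 (1 - b ^ Suc k)" for F l
    proof -
      have F: "cdiff_on F (ball 0 1)" and F\<Omega>: "\<And>l. l \<in> ball 0 1 \<Longrightarrow> F l \<in> \<Omega>" using dF by (auto simp: disc_def)
      define t where "t = 1 - b ^ Suc k"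
      have t: "0 < t" "t < 1" using b by (simp_all add: t_def power_Suc_less_one del: power_Suc)
      \<comment> \<open>\<open>\<tau>\<close> pulls \<open>l\<close> radially back towards the disc
        already controlled, over a distance below \<open>b ^ k * s\<close>.\<close>
      define \<tau> where "\<tau> = (1 - b ^ k) / t"
      have bk: "0 < b ^ k" "b ^ k \<le> 1" using b by (simp_all add: power_le_one)
      have \<tau>: "0 \<le> \<tau>" "\<tau> \<le> 1" and \<tau>': "(1 - \<tau>) * t = b ^ k * s"
        using t bk b by (simp_all add: \<tau>_def t_def b_def field_simps)
      define l0 where "l0 = of_real \<tau> * l"
      have lt: "cmod l < t" using l by (simp add: t_def)
      have l0: "cmod l0 \<le> \<tau> * cmod l" using \<tau> by (simp add: l0_def norm_mult)
      have l0': "cmod l0 \<le> 1 - b ^ k"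
      proof -
        have "\<tau> * cmod l \<le> \<tau> * t" using \<tau> lt by (intro mult_left_mono) auto
        then show ?thesis using l0 t by (simp add: \<tau>_def)
      qed
      define d where "d = 1 - cmod l0"
      have d: "d \<ge> b ^ k" "d > 0" using l0' bk by (simp_all add: d_def)
      have diff: "cmod (l - l0) < d * s"
      proof -
        have "l - l0 = of_real (1 - \<tau>) * l" by (simp add: l0_def algebra_simps)
        then have "cmod (l - l0) = (1 - \<tau>) * cmod l" using \<tau> by (simp only: norm_mult norm_of_real abs_of_nonneg diff_ge_0_iff_ge)
        also have "\<dots> < d * s"
        proof (cases "\<tau> = 1")
          case True
          then show ?thesis using d s by simp
        next
          case False
          then have "(1 - \<tau>) * cmod l < (1 - \<tau>) * t" using \<tau> lt by (intro mult_strict_left_mono) auto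
          also have "\<dots> \<le> d * s" unfolding \<tau>' using d s by (intro mult_right_mono) auto
          finally show ?thesis .
        qed
        finally show ?thesis .
      qed
      \<comment> \<open>For \<open>k = 0\<close> the controlled disc is empty and only the centre is
        available; this is why \<open>\<delta>1\<close> also enters the final minimum.\<close>
      have F0': "norm (F l0 - p) < \<delta>1"
      proof (cases "l0 = 0")
        case True
        then show ?thesis using F0 by simp
      next
        case False
        have "cmod l0 < 1 - b ^ k"
        proof -
          have "\<tau> > 0" using False \<tau> by (auto simp: l0_def order.order_iff_strict)
          then have "\<tau> * cmod l < \<tau> * t" using lt by simp
          then show ?thesis using l0 t by (simp add: \<tau>_def)
        qed
        then show ?thesis using loc2[OF dF, of l0] F0 by simp
      qed
      define G where "G = (\<lambda>m. F (l0 + m *\<^sub>C of_real d))"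
      have in1: "l0 + m *\<^sub>C of_real d \<in> ball 0 1" if "m \<in> ball 0 1" for m
      proof -
        have "cmod (l0 + m * of_real d) \<le> cmod l0 + cmod m * d"
          using norm_triangle_ineq[of l0 "m * of_real d"] d by (simp add: norm_mult)
        also have "\<dots> < cmod l0 + 1 * d" using that d by (intro add_strict_left_mono mult_strict_right_mono) auto
        finally show ?thesis by (simp add: d_def)
      qed
      have "norm (G ((l - l0) / of_real d) - p) < \<epsilon>"
      proof (rule loc1)
        show "disc G" unfolding G_def disc_def
          using cdiff_on_compose[OF cdiff_on_affine_line F in1] F\<Omega>[OF in1] by blast
        show "norm (G 0 - p) < \<delta>1" using F0' by (simp add: G_def)
        show "(l - l0) / of_real d \<in> ball 0 s" using diff d by (simp add: norm_divide pos_divide_less_eq mult.commute)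
      qed
      then show ?thesis using d by (simp add: G_def)
    qed
    then show ?case using \<delta>1 \<delta>2 by (intro exI[of _ "min \<delta>1 \<delta>2"]) simp
  qed
  obtain k where "b ^ k < 1 - r0" using real_arch_pow_inv[of "1 - r0" b] r0 b by auto
  then have "ball 0 r0 \<subseteq> ball (0::complex) (1 - b ^ k)" by (intro subset_ball) simp
  then show ?thesis using chain[OF \<epsilon>, of k] by (meson subsetD)
qed

text \<open>\<open>\<delta>\<close> depends on neither \<open>G\<close> nor the ball, so one choice
  serves all rescaled maps. Each point of the smaller ball lies on a complex disc through the
  centre.\<close>

lemma ball_localization:
  assumes r0: "r0 < 1" and \<epsilon>: "\<epsilon> > 0"
  shows "\<exists>\<delta>>0. \<forall>(G :: 'g::complex_normed_vector \<Rightarrow> 'h) x \<rho>. \<rho> > 0 \<longrightarrow> cdiff_on G (ball x \<rho>) \<longrightarrow>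
    (\<forall>y\<in>ball x \<rho>. G y \<in> \<Omega>) \<longrightarrow> norm (G x - p) < \<delta> \<longrightarrow> (\<forall>y\<in>ball x (r0 * \<rho>). norm (G y - p) < \<epsilon>)"
proof -
  obtain \<delta> where \<delta>: "\<delta> > 0" and loc: "\<And>F l. disc F \<Longrightarrow>
       norm (F 0 - p) < \<delta> \<Longrightarrow> l\<in>ball 0 r0 \<Longrightarrow> norm (F l - p) < \<epsilon>"
    using disc_localization[OF assms] by blast
  have "norm (G y - p) < \<epsilon>" if \<rho>: "\<rho> > 0" and G: "cdiff_on G (ball x \<rho>)"
    and G\<Omega>: "\<And>y. y \<in> ball x \<rho> \<Longrightarrow> G y \<in> \<Omega>" and Gx: "norm (G x - p) < min \<delta> \<epsilon>" and y: "y \<in> ball x (r0 * \<rho>)"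
    for G :: "'g \<Rightarrow> 'h" and x \<rho> y
  proof (cases "y = x")
    case True
    then show ?thesis using Gx by simp
  next
    case False
    define w where "w = (\<rho> / norm (y - x)) *\<^sub>R (y - x)"
    have w: "norm w = \<rho>" using False \<rho> by (simp add: w_def)
    have in1: "x + m *\<^sub>C w \<in> ball x \<rho>" if "m \<in> ball 0 1" for m
      using that w \<rho> by (simp add: dist_norm norm_scaleC)
    define l where "l = complex_of_real (norm (y - x) / \<rho>)"
    have lw: "x + l *\<^sub>C w = y" using False \<rho> by (simp add: l_def w_def scaleC_of_real del: of_real_divide)
    have "norm (G (x + l *\<^sub>C w) - p) < \<epsilon>"
    proof (rule loc[where F="\<lambda>m. G (x + m *\<^sub>C w)"])
      show "disc (\<lambda>m. G (x + m *\<^sub>C w))" unfolding disc_def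
        using cdiff_on_compose[OF cdiff_on_affine_line G in1] G\<Omega>[OF in1] by blast
      show "l \<in> ball 0 r0"
        using y \<rho> by (simp add: l_def norm_divide dist_norm norm_minus_commute pos_divide_less_eq)
    qed (use Gx in simp)
    then show ?thesis by (simp add: lw)
  qed
  then show ?thesis using \<delta> \<epsilon> by (intro exI[of _ "min \<delta> \<epsilon>"]) simp
qed

end

section \<open>Limits of almost surjective maps into the ball\<close>

text \<open>A quantitative form of Cartan's uniqueness theorem: the function \<open>1 / r - \<langle>u, g (\<lambda> u)\<rangle> / \<lambda>\<close> has
  nonnegative real part on the disc of radius \<open>r\<close> and is small at \<open>0\<close>, so Harnack's inequality applies.\<close>

lemma near_identity_bound:
  fixes g :: "'a::complex_inner \<Rightarrow> 'a"
  assumes r: "0 \<le> r'" "r' < r" "r \<le> 1"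
    and g: "cdiff_on g (ball 0 r)" and g1: "\<And>y. y \<in> ball 0 r \<Longrightarrow> norm (g y) \<le> 1" and g0: "g 0 = 0"
    and dd: "\<delta> \<ge> 0" and \<delta>: "\<And>v. norm (fderiv g 0 v - v) \<le> \<delta> * norm v" and z: "norm z \<le> r'"
  shows "(norm (g z - z))\<^sup>2 \<le> (1/r - 1)\<^sup>2 + 2 * ((1/r - 1 + \<delta>) * ((r + r') / (r - r')))"
proof -
  have r0: "r > 0" using r by linarith
  have rr: "1 / r - 1 \<ge> 0" using r r0 by (simp add: field_simps)
  have frac: "(r + r') / (r - r') > 0" using r by (intro divide_pos_pos) linarith+
  show ?thesis
  proof (cases "z = 0")
    case True
    have "0 \<le> (1/r - 1)\<^sup>2 + 2 * ((1/r - 1 + \<delta>) * ((r + r') / (r - r')))"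
      using rr dd frac by (intro add_nonneg_nonneg mult_nonneg_nonneg) (auto intro: less_imp_le)
    then show ?thesis using g0 True by simp
  next
    case False
    define t where "t = norm z"
    have t: "0 < t" "t \<le> r'" using False z by (simp_all add: t_def)
    define u where "u = (1 / t) *\<^sub>R z"
    have u: "norm u = 1" "t *\<^sub>R u = z" using False by (simp_all add: u_def t_def)
    define q where "q = (\<lambda>l. cinner u (g (0 + l *\<^sub>C u)))"
    have inb: "0 + l *\<^sub>C u \<in> ball 0 r" if "cmod l < r" for l using that u by (simp add: norm_scaleC)
    have hq: "q holomorphic_on ball 0 r" unfolding q_def
      by (rule holomorphic_on_slice[OF g]) (use inb in auto)
    have q0: "q 0 = 0" by (simp add: q_def g0)
    have qM: "cmod (q l) \<le> 1" if "cmod l < r" for l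
    proof -
      have "cmod (q l) \<le> norm u * norm (g (0 + l *\<^sub>C u))" unfolding q_def by (rule Cauchy_Schwarz_cinner)
      also have "\<dots> \<le> 1 * 1" using u g1[OF inb[OF that]] by (intro mult_mono) auto
      finally show ?thesis by simp
    qed
    have dq: "deriv q 0 = cinner u (fderiv g 0 u)" unfolding q_def
      by (rule deriv_slice[OF g]) (use r0 in simp)
    \<comment> \<open>\<open>h\<close> is the quotient \<open>q l / l\<close>. The Schwarz lemma
      bounds it by \<open>1 / r\<close>, and its value at \<open>0\<close> is the derivative of
      \<open>q\<close>, whose real part is at least \<open>1 - \<delta>\<close>.\<close>
    obtain h where h: "h holomorphic_on ball 0 r" "\<And>l. cmod l < r \<Longrightarrow> q l = l * h l" "deriv q 0 = h 0"
      using Schwarz3[OF hq q0] by blast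
    have h1: "cmod (h l) \<le> 1 / r" if l: "cmod l < r" for l
    proof (cases "l = 0")
      case True
      show ?thesis using deriv_bound_ball[OF hq r0 qM] h(3) True by simp
    next
      case False
      have "cmod (q l) \<le> 1 * cmod l / r" by (rule Schwarz_lemma_ball[OF hq r0 qM q0 l])
      then show ?thesis using False h(2)[OF l] r0 by (simp add: norm_mult field_simps)
    qed
    have tr: "cmod (of_real t) < r" using t r by simp
    have "Re (of_real (1/r) - h (of_real t)) * (r - cmod (of_real t)) \<le> Re (of_real (1/r) - h 0) * (r + cmod (of_real t))"
    proof (rule Harnack_inequality(1)[where g="\<lambda>l. of_real (1/r) - h l"])
      show "(\<lambda>l. of_real (1/r) - h l) holomorphic_on ball 0 r" by (intro holomorphic_intros h)
      show "0 \<le> Re (of_real (1/r) - h l)" if "cmod l < r" for l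
        using complex_Re_le_cmod[of "h l"] h1[OF that] by simp
    qed (use r0 tr in auto)
    then have 1: "(1/r - Re (h (of_real t))) * (r - t) \<le> (1/r - Re (h 0)) * (r + t)" using t by simp
    have "Re (cinner u (fderiv g 0 u)) \<ge> 1 - \<delta>"
    proof -
      have "cinner u (fderiv g 0 u) = cinner u (fderiv g 0 u - u) + 1"
        using u by (simp add: cinner_diff_right cinner_self)
      moreover have "cmod (cinner u (fderiv g 0 u - u)) \<le> \<delta>"
        using Cauchy_Schwarz_cinner[of u "fderiv g 0 u - u"] \<delta>[of u] u by simp
      ultimately show ?thesis using abs_Re_le_cmod[of "cinner u (fderiv g 0 u - u)"] by simp
    qed
    then have h0: "1/r - Re (h 0) \<le> 1/r - 1 + \<delta>" using dq h(3) by simp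
    define k where "k = 1/r - Re (h (of_real t))"
    have k0: "k \<ge> 0" using complex_Re_le_cmod[of "h (of_real t)"] h1[OF tr] by (simp add: k_def)
    have "k * (r - r') \<le> k * (r - t)" using k0 t by (intro mult_left_mono) auto
    also have "\<dots> \<le> (1/r - Re (h 0)) * (r + t)" using 1 by (simp add: k_def)
    also have "\<dots> \<le> (1/r - 1 + \<delta>) * (r + r')"
      using h0 rr dd t r0 r by (intro mult_mono) auto
    finally have k: "k \<le> (1/r - 1 + \<delta>) * ((r + r') / (r - r'))" using r by (simp add: field_simps)
    have gz: "norm (g z) \<le> t / r"
      using Schwarz_lemma_vector[OF g r0 g1 g0, of z] z r by (simp add: t_def)
    \<comment> \<open>The real part of this inner product is almost \<open>t^2\<close> while
      \<open>norm (g z)\<close> is at most \<open>t / r\<close>, so expanding the square shows that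
      \<open>g z\<close> is close to \<open>z\<close>.\<close>
    have "Re (cinner z (g z)) = t * (t * Re (h (of_real t)))"
    proof -
      have "q (of_real t) = cinner u (g z)" using u by (simp add: q_def scaleC_of_real)
      then have "cinner u (g z) = of_real t * h (of_real t)" using h(2)[OF tr] by simp
      moreover have "cinner z (g z) = of_real t * cinner u (g z)"
        using cinner_scaleR_left[of t u "g z"] u(2) by simp
      ultimately show ?thesis by simp
    qed
    then have "(norm (g z - z))\<^sup>2 = (norm (g z))\<^sup>2 - 2 * (t * (t * (1/r - k))) + t\<^sup>2"
      using norm_diff_square[of z "g z"] by (simp add: norm_minus_commute t_def k_def)
    also have "\<dots> \<le> (t / r)\<^sup>2 - 2 * (t * (t * (1/r - k))) + t\<^sup>2"
      using gz by (intro add_right_mono diff_right_mono power_mono) auto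
    also have "\<dots> = t\<^sup>2 * ((1/r - 1)\<^sup>2 + 2 * k)" by (simp add: power2_eq_square algebra_simps)
    also have "\<dots> \<le> 1 * ((1/r - 1)\<^sup>2 + 2 * k)"
      using t r k0 by (intro mult_right_mono power_le_one add_nonneg_nonneg) auto
    finally show ?thesis using k by simp
  qed
qed

text \<open>One \<open>\<eta>\<close> serves both as the loss of radius and as the tolerance for the
  derivative, matching the two kinds of smallness available for transition maps.\<close>

lemma near_identity:
  assumes r': "0 \<le> r'" "r' < 1" and \<epsilon>: "\<epsilon> > 0"
  shows "\<exists>\<eta>>0. r' < 1 - \<eta> \<and> (\<forall>g :: 'a::complex_inner \<Rightarrow> 'a. cdiff_on g (ball 0 (1 - \<eta>)) \<longrightarrow>
    (\<forall>y\<in>ball 0 (1 - \<eta>). norm (g y) \<le> 1) \<longrightarrow> g 0 = 0 \<longrightarrow> (\<forall>v. norm (fderiv g 0 v - v) \<le> \<eta> * norm v) \<longrightarrow>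
    (\<forall>z. norm z \<le> r' \<longrightarrow> norm (g z - z) \<le> \<epsilon>))"
proof -
  \<comment> \<open>The bound of \<open>near_identity_bound\<close> will be at most
    \<open>4 * \<eta> + 2 * (3 * \<eta> * 4 / (1 - r'))\<close>, which is
    \<open>\<eta> * C\<close>.\<close>
  define C where "C = 4 + 24 / (1 - r')"
  have C: "C > 0" using r' by (simp add: C_def add_pos_nonneg)
  define \<eta> where "\<eta> = min (1/2) (min ((1 - r') / 2) (\<epsilon>\<^sup>2 / C))"
  have "\<eta> > 0" using r' C \<epsilon> by (simp add: \<eta>_def)
  moreover have "\<eta> \<le> 1/2" unfolding \<eta>_def by (rule min.cobounded1)
  moreover have "\<eta> \<le> (1 - r') / 2" unfolding \<eta>_def by (rule min.coboundedI2, rule min.cobounded1)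
  moreover have "\<eta> \<le> \<epsilon>\<^sup>2 / C" unfolding \<eta>_def by (rule min.coboundedI2, rule min.cobounded2)
  ultimately have \<eta>: "\<eta> > 0" "\<eta> \<le> 1/2" "\<eta> \<le> (1 - r') / 2" "\<eta> * C \<le> \<epsilon>\<^sup>2" using C by (simp_all add: pos_le_divide_eq)
  define r where "r = 1 - \<eta>"
  have r: "r' < r" "r \<le> 1" "r > 0" "1 / r - 1 \<le> 2 * \<eta>" "1/r - 1 \<ge> 0" "r - r' \<ge> (1 - r') / 2" "r + r' \<le> 2"
    using \<eta> r' by (simp_all add: r_def field_simps)
  have "norm (g z - z) \<le> \<epsilon>" if "cdiff_on g (ball 0 r)" "\<And>y. y\<in>ball 0 r \<Longrightarrow> norm (g y) \<le> 1" "g 0 = 0"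
    "\<And>v. norm (fderiv g 0 v - v) \<le> \<eta> * norm v" "norm z \<le> r'" for g :: "'a \<Rightarrow> 'a" and z
  proof -
    have "(norm (g z - z))\<^sup>2 \<le> (1/r - 1)\<^sup>2 + 2 * ((1/r - 1 + \<eta>) * ((r + r') / (r - r')))"
      using \<eta>(1) by (intro near_identity_bound[OF r'(1) r(1,2) that(1-3) _ that(4,5)]) auto
    also have "(1/r - 1)\<^sup>2 \<le> (2 * \<eta>)\<^sup>2" using r by (intro power_mono) auto
    also have "(2 * \<eta>)\<^sup>2 \<le> 4 * \<eta>" using \<eta> by (simp add: power2_eq_square)
    also have "(1/r - 1 + \<eta>) * ((r + r') / (r - r')) \<le> (3 * \<eta>) * (2 / ((1 - r') / 2))"
      using r r' \<eta> by (intro mult_mono frac_le) auto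
    finally have "(norm (g z - z))\<^sup>2 \<le> \<eta> * C" by (simp add: C_def algebra_simps)
    also have "\<dots> \<le> \<epsilon>\<^sup>2" by (rule \<eta>)
    finally show ?thesis by (rule power2_le_imp_le) (use \<epsilon> in simp)
  qed
  then show ?thesis using \<eta>(1) r(1) unfolding r_def by (intro exI[of _ \<eta>]) blast
qed

lemma uniform_limit_eval:
  fixes g :: "'a::metric_space \<Rightarrow> 'b::metric_space"
  assumes ul: "uniform_limit S f g sequentially" and S: "open S" "x \<in> S" and cont: "isCont g x" and X: "X \<longlonglongrightarrow> x"
  shows "(\<lambda>n. f n (X n)) \<longlonglongrightarrow> g x"
proof (rule tendstoI)
  fix e :: real assume e: "e > 0"
  have gX: "(\<lambda>n. g (X n)) \<longlonglongrightarrow> g x" by (rule isCont_tendsto_compose[OF cont X])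
  have "\<forall>\<^sub>F n in sequentially. X n \<in> S" by (rule topological_tendstoD[OF X S])
  moreover have "\<forall>\<^sub>F n in sequentially. dist (g (X n)) (g x) < e/2" using e by (intro tendstoD[OF gX]) simp
  moreover have "\<forall>\<^sub>F n in sequentially. \<forall>y\<in>S. dist (f n y) (g y) < e/2" using e by (intro uniform_limitD[OF ul]) simp
  ultimately show "\<forall>\<^sub>F n in sequentially. dist (f n (X n)) (g x) < e"
    by eventually_elim (metis dist_triangle_half_l dist_commute)
qed

text \<open>\<open>f k\<close> embeds the part \<open>V k\<close> of \<open>\<Omega>\<close> in the
  unit ball, and \<open>F k\<close> inverts it over a ball of radius \<open>\<rho> k\<close>. By
  \<open>overlap\<close> these radii eventually exceed every \<open>r < 1\<close> and transition
  maps live on balls of radius near 1; \<open>exhaust\<close> keeps \<open>f k\<close> away from the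
  sphere locally uniformly and replaces compactness.\<close>

locale squeezing =
  fixes \<Omega> :: "'h::complex_hilbert set" and q :: 'h
    and V :: "nat \<Rightarrow> 'h set" and f F :: "nat \<Rightarrow> 'h \<Rightarrow> 'h" and \<rho> :: "nat \<Rightarrow> real"
  assumes open_\<Omega>: "open \<Omega>" and q_in: "q \<in> \<Omega>"
    and open_V: "open (V k)" and V_sub: "V k \<subseteq> \<Omega>" and q_V: "q \<in> V k"
    and f: "cdiff_on (f k) (V k)" and f_ball: "x \<in> V k \<Longrightarrow> norm (f k x) < 1" and f_q: "f k q = 0"
    and \<rho>: "0 < \<rho> k"
    and F: "cdiff_on (F k) (ball 0 (\<rho> k))" and F_V: "norm y < \<rho> k \<Longrightarrow> F k y \<in> V k"
    and f_F: "norm y < \<rho> k \<Longrightarrow> f k (F k y) = y"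
    and F_f: "x \<in> V k \<Longrightarrow> norm (f k x) < \<rho> k \<Longrightarrow> F k (f k x) = x"
    and overlap: "r < 1 \<Longrightarrow> \<exists>N. \<forall>j\<ge>N. \<forall>k\<ge>N. r < \<rho> k \<and> (\<forall>y. norm y < r \<longrightarrow> F k y \<in> V j)"
    and exhaust: "x \<in> \<Omega> \<Longrightarrow> \<exists>s>0. \<exists>r<1. \<exists>N. ball x s \<subseteq> \<Omega> \<and> (\<forall>k\<ge>N. \<forall>y\<in>ball x s. y \<in> V k \<and> norm (f k y) < r)"
begin

lemma F_0: "F k 0 = q"
  using F_f[OF q_V] f_q \<rho> by (metis norm_zero)

abbreviation "A k \<equiv> fderiv (f k) q"
abbreviation "B k \<equiv> fderiv (F k) 0"

lemma A: "(f k has_derivative A k) (at q)" "clinear (A k)"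
  and B: "(F k has_derivative B k) (at 0)" "clinear (B k)"
  using cdiff_on_fderiv[OF f q_V] cdiff_on_fderiv[OF F, of 0] \<rho> by simp_all

lemma A_B: "A k (B k v) = v"
proof -
  have "(f k has_derivative A k) (at (F k 0))" using A by (simp add: F_0)
  then have "((\<lambda>y. f k (F k y)) has_derivative (\<lambda>v. A k (B k v))) (at 0)"
    by (rule has_derivative_compose[OF B(1)])
  moreover have "((\<lambda>y. f k (F k y)) has_derivative (\<lambda>v. v)) (at 0)"
    by (rule has_derivative_transform_within_open[OF has_derivative_ident, of "ball 0 (\<rho> k)"])
      (use \<rho> f_F in auto)
  ultimately show ?thesis using has_derivative_unique by metis
qed

lemma B_A: "B k (A k v) = v"
proof -
  have "isCont (f k) q" using A(1) by (rule has_derivative_continuous)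
  then have "\<forall>\<^sub>F x in at q. f k x \<in> ball 0 (\<rho> k)"
    using \<rho>[of k] f_q unfolding isCont_def by (intro topological_tendstoD[of _ "f k q"]) auto
  moreover have "\<forall>\<^sub>F x in at q. x \<in> V k" by (rule eventually_at_in_open'[OF open_V q_V])
  ultimately have ev: "\<forall>\<^sub>F x in at q. F k (f k x) = x" by eventually_elim (use F_f in auto)
  have "(F k has_derivative B k) (at (f k q))" using B by (simp add: f_q)
  then have "((\<lambda>x. F k (f k x)) has_derivative (\<lambda>v. B k (A k v))) (at q)"
    by (rule has_derivative_compose[OF A(1)])
  moreover have "((\<lambda>x. F k (f k x)) has_derivative (\<lambda>v. v)) (at q)"
    by (rule has_derivative_transform_eventually[OF has_derivative_ident])
      (use ev F_f[OF q_V] f_q \<rho> in \<open>auto elim: eventually_mono\<close>)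
  ultimately show ?thesis using has_derivative_unique by metis
qed

abbreviation "g j k \<equiv> \<lambda>y. f j (F k y)"

lemma g_0: "g j k 0 = 0" by (simp add: F_0 f_q)

lemma cdiff_on_g:
  assumes "r < \<rho> k" "\<And>y. norm y < r \<Longrightarrow> F k y \<in> V j"
  shows "cdiff_on (g j k) (ball 0 r)"
  by (rule cdiff_on_compose[OF cdiff_on_subset[OF F] f]) (use assms in auto)

lemma fderiv_g: "fderiv (g j k) 0 v = A j (B k v)"
proof -
  have "(f j has_derivative A j) (at (F k 0))" using A by (simp add: F_0)
  then have "((\<lambda>y. f j (F k y)) has_derivative (\<lambda>v. A j (B k v))) (at 0)"
    by (rule has_derivative_compose[OF B(1)])
  then show ?thesis by (simp add: fderiv_eq)
qed

text \<open>Cauchy estimate at \<open>0\<close> for the transition map \<open>g j k\<close>, which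
  is bounded by 1 and has derivative \<open>A j o B k\<close>. As \<open>j\<close> and
  \<open>k\<close> may be exchanged, the norms agree asymptotically, uniformly in
  \<open>v\<close>.\<close>

lemma A_comparable:
  assumes "0 < r" "r < 1"
  shows "\<exists>N. \<forall>j\<ge>N. \<forall>k\<ge>N. \<forall>v. norm (A j v) \<le> norm (A k v) / r"
proof -
  obtain N where N: "\<And>j k. j \<ge> N \<Longrightarrow> k \<ge> N \<Longrightarrow> r < \<rho> k \<and> (\<forall>y. norm y < r \<longrightarrow> F k y \<in> V j)"
    using overlap[OF assms(2)] by blast
  have "norm (A j v) \<le> norm (A k v) / r" if "j \<ge> N" "k \<ge> N" for j k v
  proof -
    have "norm (fderiv (g j k) 0 (A k v)) \<le> 1 * norm (A k v) / r"
      using N[OF that] f_ball assms by (intro Cauchy_estimate cdiff_on_g) (auto intro: less_imp_le)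
    then show ?thesis by (simp add: fderiv_g B_A)
  qed
  then show ?thesis by blast
qed

end

text \<open>The Cauchy condition is relative to \<open>A k\<close>; equivalently, the derivative of
  \<open>g j k\<close> at \<open>0\<close> is within \<open>\<delta>\<close> of the identity.
  Unitary factors arrange it in \<open>biholomorphic_unit_ball\<close>.\<close>

locale normalized_squeezing = squeezing +
  assumes normalized: "\<delta> > 0 \<Longrightarrow> \<exists>N. \<forall>j\<ge>N. \<forall>k\<ge>N. \<forall>v. norm (A j v - A k v) \<le> \<delta> * norm (A k v)"
begin

lemma near_id:
  assumes r: "0 \<le> r" "r < 1" and \<epsilon>: "\<epsilon> > 0"
  shows "\<exists>N. \<forall>j\<ge>N. \<forall>k\<ge>N. r < \<rho> k \<and> cdiff_on (g j k) (ball 0 r) \<and>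
    (\<forall>y. norm y \<le> r \<longrightarrow> F k y \<in> V j \<and> norm (g j k y - y) \<le> \<epsilon>)"
proof -
  obtain \<eta> where \<eta>: "\<eta> > 0" "r < 1 - \<eta>" and id: "\<And>g z. cdiff_on g (ball 0 (1 - \<eta>)) \<Longrightarrow>
    (\<And>y. y\<in>ball 0 (1 - \<eta>) \<Longrightarrow> norm (g y) \<le> 1) \<Longrightarrow> g 0 = 0 \<Longrightarrow> (\<And>v. norm (fderiv g 0 v - v) \<le> \<eta> * norm v) \<Longrightarrow>
    norm (z::'a) \<le> r \<Longrightarrow> norm (g z - z) \<le> \<epsilon>"
    using near_identity[where 'a='a, OF r \<epsilon>] by auto
  have "1 - \<eta> < 1" using \<eta> by simp
  then obtain N1 where N1: "\<And>j k. j \<ge> N1 \<Longrightarrow> k \<ge> N1 \<Longrightarrow> 1 - \<eta> < \<rho> k \<and> (\<forall>y. norm y < 1 - \<eta> \<longrightarrow> F k y \<in> V j)"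
    using overlap[of "1 - \<eta>"] by blast
  obtain N2 where N2: "\<And>j k v. j \<ge> N2 \<Longrightarrow> k \<ge> N2 \<Longrightarrow> norm (A j v - A k v) \<le> \<eta> * norm (A k v)"
    using normalized[OF \<eta>(1)] by blast
  have "r < \<rho> k \<and> cdiff_on (g j k) (ball 0 r) \<and> (\<forall>y. norm y \<le> r \<longrightarrow> F k y \<in> V j \<and> norm (g j k y - y) \<le> \<epsilon>)"
    if jk: "j \<ge> max N1 N2" "k \<ge> max N1 N2" for j k
  proof -
    have N: "1 - \<eta> < \<rho> k" "\<And>y. norm y < 1 - \<eta> \<Longrightarrow> F k y \<in> V j" using N1[of j k] jk by auto
    have cd: "cdiff_on (g j k) (ball 0 (1 - \<eta>))" by (rule cdiff_on_g[OF N])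
    have "norm (g j k y - y) \<le> \<epsilon>" if y: "norm y \<le> r" for y
    proof (rule id[OF cd _ g_0 _ y])
      show "norm (g j k y) \<le> 1" if "y \<in> ball 0 (1 - \<eta>)" for y
        using f_ball[OF N(2), of y] that by simp
      show "norm (fderiv (g j k) 0 v - v) \<le> \<eta> * norm v" for v
        using N2[of j k "B k v"] jk by (simp add: fderiv_g A_B)
    qed
    moreover have "cdiff_on (g j k) (ball 0 r)" using \<eta> by (intro cdiff_on_subset[OF cd] subset_ball) simp
    ultimately show ?thesis using N \<eta> by auto
  qed
  then show ?thesis by blast
qed

definition f_lim :: "'a \<Rightarrow> 'a" where "f_lim x = lim (\<lambda>k. f k x)"

definition F_lim :: "'a \<Rightarrow> 'a" where "F_lim y = lim (\<lambda>k. F k y)"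

text \<open>Since \<open>f j y = g j k (f k y)\<close>, the sequence moves only by as much as
  \<open>g j k\<close> differs from the identity; the bound \<open>r < 1\<close> keeps
  \<open>f k y\<close> where that difference is controlled.\<close>

lemma f_lim_uniform:
  assumes x: "x \<in> \<Omega>"
  obtains s r N where "s > 0" "r < 1" "\<And>k y. k \<ge> N \<Longrightarrow> y \<in> ball x s \<Longrightarrow> y \<in> V k"
    "\<And>k y. k \<ge> N \<Longrightarrow> y \<in> ball x s \<Longrightarrow> norm (f k y) < r" "\<And>k y. k \<ge> N \<Longrightarrow> y \<in> ball x s \<Longrightarrow> F k (f k y) = y"
    "uniform_limit (ball x s) f f_lim sequentially"
proof -
  obtain s r N0 where s: "s > 0" and r: "r < 1" and sub: "ball x s \<subseteq> \<Omega>"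
    and N0: "\<And>k y. k \<ge> N0 \<Longrightarrow> y \<in> ball x s \<Longrightarrow> y \<in> V k \<and> norm (f k y) < r"
    using exhaust[OF x] by blast
  have r0: "0 \<le> r" using N0[OF order_refl, of x] s norm_ge_zero[of "f N0 x"] by (auto simp del: norm_ge_zero)
  have near: "\<exists>N\<ge>N0. \<forall>j\<ge>N. \<forall>k\<ge>N. \<forall>y\<in>ball x s. F k (f k y) = y \<and> norm (f j y - f k y) \<le> e" if e: "e > 0" for e
  proof -
    obtain N where N: "\<And>j k. j \<ge> N \<Longrightarrow> k \<ge> N \<Longrightarrow> r < \<rho> k \<and>
      (\<forall>y. norm y \<le> r \<longrightarrow> F k y \<in> V j \<and> norm (g j k y - y) \<le> e)" using near_id[OF r0 r e] by blast
    have "F k (f k y) = y \<and> norm (f j y - f k y) \<le> e" if "j \<ge> max N N0" "k \<ge> max N N0" "y \<in> ball x s" for j k y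
    proof -
      have y: "y \<in> V k" "norm (f k y) < r" using N0[of k y] that by auto
      have "F k (f k y) = y" using N[of j k] that y by (intro F_f) auto
      moreover have "norm (g j k (f k y) - f k y) \<le> e" using N[of j k] that y by auto
      ultimately show ?thesis by simp
    qed
    then show ?thesis by (intro exI[of _ "max N N0"]) auto
  qed
  have "uniformly_Cauchy_on (ball x s) f" unfolding uniformly_Cauchy_on_def
  proof (intro allI impI)
    fix e :: real assume "e > 0"
    then obtain N where "\<forall>j\<ge>N. \<forall>k\<ge>N. \<forall>y\<in>ball x s. F k (f k y) = y \<and> norm (f j y - f k y) \<le> e/2"
      using near[of "e/2"] by auto
    then show "\<exists>M. \<forall>x\<in>ball x s. \<forall>m\<ge>M. \<forall>n\<ge>M. dist (f m x) (f n x) < e"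
      using \<open>e > 0\<close> by (intro exI[of _ N]) (fastforce simp: dist_norm)
  qed
  then have "uniform_limit (ball x s) f f_lim sequentially"
    using Cauchy_uniformly_convergent uniformly_convergent_uniform_limit_iff unfolding f_lim_def[abs_def] by blast
  moreover obtain N where N: "N \<ge> N0" "\<And>k y. k\<ge>N \<Longrightarrow> y\<in>ball x s \<Longrightarrow> F k (f k y) = y" using near[of 1] by auto
  ultimately show thesis
    using s r N0 by (intro that[of s r N]) (auto dest: order_trans[OF N(1)] intro: N(2))
qed

lemma cdiff_on_f_lim: "cdiff_on f_lim \<Omega>"
proof (rule cdiff_on_uniform_limit)
  fix x assume x: "x \<in> \<Omega>"
  obtain s r N where s: "s > 0" "uniform_limit (ball x s) f f_lim sequentially"
    and N: "\<And>k y. k \<ge> N \<Longrightarrow> y \<in> ball x s \<Longrightarrow> y \<in> V k"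
    by (rule f_lim_uniform[OF x]) blast
  have "cdiff_on (f n) (ball x s)" if "n \<ge> N" for n
    using N[OF that] by (intro cdiff_on_subset[OF f]) blast
  then show "\<exists>s>0. uniform_limit (ball x s) f f_lim sequentially \<and> (\<exists>N. \<forall>n\<ge>N. cdiff_on (f n) (ball x s))"
    using s by (intro exI[of _ s]) blast
qed

lemma f_lim_tendsto:
  assumes x: "x \<in> \<Omega>"
  shows "(\<lambda>k. f k x) \<longlonglongrightarrow> f_lim x"
proof -
  obtain s where s: "s > 0" "uniform_limit (ball x s) f f_lim sequentially"
    by (rule f_lim_uniform[OF x]) blast
  show ?thesis by (rule tendsto_uniform_limitI[OF s(2)]) (use s in simp)
qed

lemma f_lim_ball:
  assumes x: "x \<in> \<Omega>"
  shows "norm (f_lim x) < 1"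
proof -
  obtain s r N where s: "s > 0" "r < 1" and N: "\<And>k y. k \<ge> N \<Longrightarrow> y \<in> ball x s \<Longrightarrow> norm (f k y) < r"
    by (rule f_lim_uniform[OF x]) blast
  have "norm (f_lim x) \<le> r"
  proof (rule tendsto_upperbound[OF tendsto_norm[OF f_lim_tendsto[OF x]]])
    show "\<forall>\<^sub>F k in sequentially. norm (f k x) \<le> r"
      using N[of _ x] s by (intro eventually_sequentiallyI[of N]) (auto intro: less_imp_le)
  qed simp
  then show ?thesis using s by simp
qed

text \<open>With \<open>k\<close> fixed, \<open>F j = F k o g k j\<close> reduces the convergence of
  \<open>F j\<close> to that of \<open>g k j\<close>, whose values lie in the unit ball. Moreover
  \<open>g k j = g k i o g i j\<close>, where \<open>g i j\<close> is near the identity and the maps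
  \<open>g k i\<close> are uniformly Lipschitz, so \<open>g k j\<close> is Cauchy in
  \<open>j\<close>.\<close>

lemma F_lim_factor:
  assumes r: "0 \<le> r" "r < 1"
  shows "\<exists>k0. \<forall>k\<ge>k0. \<exists>G. cdiff_on G (ball 0 r) \<and> uniform_limit (ball 0 r) (\<lambda>j. g k j) G sequentially \<and>
    (\<forall>y\<in>ball 0 r. norm (G y) < \<rho> k \<and> F_lim y = F k (G y) \<and> (\<lambda>j. F j y) \<longlonglongrightarrow> F_lim y)"
proof -
  \<comment> \<open>On radius \<open>r2\<close> the transition maps are defined and bounded;
    \<open>r1\<close> leaves room for the displacement by \<open>g i j\<close> and gives
    \<open>g k i\<close> the Lipschitz constant \<open>1 / (r2 - r1)\<close>.\<close>
  define r1 where "r1 = (1 + r) / 2"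
  define r2 where "r2 = (1 + r1) / 2"
  have rr: "r < r1" "r1 < r2" "r2 < 1" "0 \<le> r1" "0 \<le> r2" using r by (simp_all add: r1_def r2_def)
  have near: "\<exists>N. \<forall>j\<ge>N. \<forall>k\<ge>N. r2 < \<rho> k \<and> cdiff_on (g j k) (ball 0 r2) \<and>
    (\<forall>y. norm y \<le> r2 \<longrightarrow> F k y \<in> V j \<and> norm (g j k y - y) \<le> e)" if "e > 0" for e
    by (rule near_id[OF rr(5,3) that])
  have "(r1 - r) / 2 > 0" using rr by simp
  from near[OF this] obtain N where N0': "\<forall>j\<ge>N. \<forall>k\<ge>N. r2 < \<rho> k \<and> cdiff_on (g j k) (ball 0 r2) \<and>
    (\<forall>y. norm y \<le> r2 \<longrightarrow> F k y \<in> V j \<and> norm (g j k y - y) \<le> (r1 - r) / 2)" ..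
  have N0: "r2 < \<rho> k \<and> cdiff_on (g j k) (ball 0 r2) \<and>
    (\<forall>y. norm y \<le> r2 \<longrightarrow> F k y \<in> V j \<and> norm (g j k y - y) \<le> (r1 - r) / 2)" if "j \<ge> N" "k \<ge> N" for j k
    using N0'[THEN spec, THEN mp, OF that(1), THEN spec, THEN mp, OF that(2)] .
  note N = N0[THEN conjunct1] N0[THEN conjunct2, THEN conjunct1]
    N0[THEN conjunct2, THEN conjunct2, THEN spec, THEN mp, THEN conjunct1]
    N0[THEN conjunct2, THEN conjunct2, THEN spec, THEN mp, THEN conjunct2]
  have gr1: "norm (g j k y) \<le> (r1 + r) / 2" "norm (g j k y) < r1" if "j \<ge> N" "k \<ge> N" "y \<in> ball 0 r" for j k y
  proof -
    have "norm (g j k y - y) \<le> (r1 - r) / 2" using N(4)[OF that(1,2), of y] that(3) rr by simp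
    then show "norm (g j k y) \<le> (r1 + r) / 2" using norm_triangle_ineq2[of "g j k y" y] that(3) by (simp add: field_simps)
    then show "norm (g j k y) < r1" using rr by simp
  qed
  have Ffac: "F k (g k j y) = F j y" if "j \<ge> N" "k \<ge> N" "y \<in> ball 0 r" for j k y
    using gr1(2)[OF that(2,1,3)] N(1)[OF that(1,2)] N(3)[OF that(2,1), of y] that(3) rr by (intro F_f) auto
  have "\<exists>G. cdiff_on G (ball 0 r) \<and> uniform_limit (ball 0 r) (\<lambda>j. g k j) G sequentially \<and>
    (\<forall>y\<in>ball 0 r. norm (G y) < \<rho> k \<and> F_lim y = F k (G y) \<and> (\<lambda>j. F j y) \<longlonglongrightarrow> F_lim y)" if k: "k \<ge> N" for k
  proof -
    have "uniformly_Cauchy_on (ball 0 r) (\<lambda>j. g k j)"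
    proof (rule uniformly_Cauchy_onI)
      fix e :: real assume e: "e > 0"
      define e' where "e' = e / 2 * (r2 - r1)"
      have e': "e' > 0" using e rr by (simp add: e'_def)
      obtain N' where N': "\<And>i j y. i \<ge> N' \<Longrightarrow> j \<ge> N' \<Longrightarrow> norm y \<le> r2 \<Longrightarrow> norm (g i j y - y) \<le> e'"
        using near[OF e'] by blast
      have "dist (g k i y) (g k j y) < e" if ij: "i \<ge> max N N'" "j \<ge> max N N'" and y: "y \<in> ball 0 r" for i j y
      proof -
        have ik: "i \<ge> N" "j \<ge> N" using ij by auto
        have "norm (g k i (g i j y) - g k i y) \<le> 1 / (r2 - r1) * norm (g i j y - y)"
        proof (rule cdiff_on_Lipschitz[OF N(2)[OF k ik(1)] rr(2)])
          show "norm (g k i w) \<le> 1" if "w \<in> ball 0 r2" for w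
            using f_ball[OF N(3)[OF k ik(1), of w]] that by simp
          show "g i j y \<in> ball 0 r1" "y \<in> ball 0 r1" using gr1(2)[OF ik y] y rr by auto
        qed
        also have "\<dots> \<le> 1 / (r2 - r1) * e'"
          using N'[of i j y] ij y rr by (intro mult_left_mono) auto
        also have "\<dots> < e" using rr e by (simp add: e'_def)
        finally have "norm (g k i (g i j y) - g k i y) < e" .
        moreover have "F i (g i j y) = F j y" by (rule Ffac[OF ik(2,1) y])
        ultimately show ?thesis by (simp add: dist_norm norm_minus_commute)
      qed
      then show "\<exists>M. \<forall>x\<in>ball 0 r. \<forall>m\<ge>M. \<forall>n\<ge>M. dist (g k m x) (g k n x) < e" by blast
    qed
    then obtain G where G: "uniform_limit (ball 0 r) (\<lambda>j. g k j) G sequentially"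
      using Cauchy_uniformly_convergent unfolding uniformly_convergent_on_def by blast
    have cG: "cdiff_on G (ball 0 r)"
    proof (rule cdiff_on_uniform_limit)
      fix y :: 'a assume "y \<in> ball 0 r"
      then obtain s where s: "s > 0" "ball y s \<subseteq> ball 0 r" using open_contains_ball open_ball by metis
      have "cdiff_on (g k n) (ball y s)" if "n \<ge> N" for n
        using s rr by (intro cdiff_on_subset[OF N(2)[OF k that]]) (auto intro: less_trans)
      then show "\<exists>s>0. uniform_limit (ball y s) (\<lambda>j. g k j) G sequentially \<and> (\<exists>N. \<forall>n\<ge>N. cdiff_on (g k n) (ball y s))"
        using s uniform_limit_on_subset[OF G s(2)] by blast
    qed
    have "norm (G y) < \<rho> k \<and> F_lim y = F k (G y) \<and> (\<lambda>j. F j y) \<longlonglongrightarrow> F_lim y" if y: "y \<in> ball 0 r" for y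
    proof -
      have lim: "(\<lambda>j. g k j y) \<longlonglongrightarrow> G y" by (rule tendsto_uniform_limitI[OF G y])
      have "norm (G y) \<le> (r1 + r) / 2"
      proof (rule tendsto_upperbound[OF tendsto_norm[OF lim]])
        show "\<forall>\<^sub>F j in sequentially. norm (g k j y) \<le> (r1 + r) / 2"
          using gr1(1)[OF k _ y] by (auto simp: eventually_sequentially)
      qed simp
      then have Gy: "norm (G y) < \<rho> k" using N(1)[OF k k] rr by simp
      have "isCont (F k) (G y)"
        using cdiff_on_continuous[OF F, of k] Gy by (simp add: continuous_on_eq_continuous_at)
      then have "(\<lambda>j. F k (g k j y)) \<longlonglongrightarrow> F k (G y)" by (rule isCont_tendsto_compose[OF _ lim])
      moreover have "\<forall>\<^sub>F j in sequentially. F k (g k j y) = F j y"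
        using Ffac[OF _ k y] by (auto simp: eventually_sequentially)
      ultimately have "(\<lambda>j. F j y) \<longlonglongrightarrow> F k (G y)" by (rule Lim_transform_eventually)
      moreover from this have "F_lim y = F k (G y)" by (simp add: F_lim_def limI)
      ultimately show ?thesis using Gy by simp
    qed
    then show ?thesis using G cG by blast
  qed
  then show ?thesis by blast
qed

lemma ball_radius:
  assumes "norm (y::'a) < 1"
  obtains r where "0 \<le> r" "r < 1" "y \<in> ball 0 r"
  using dense[OF assms] norm_ge_zero[of y] by (metis less_imp_le mem_ball_0 order_trans)

lemma cdiff_on_F_lim: "cdiff_on F_lim (ball 0 1)"
  unfolding cdiff_on_def
proof
  fix y :: 'a assume "y \<in> ball 0 1"
  then have "norm y < 1" by simp
  then obtain r where r: "0 \<le> r" "r < 1" "y \<in> ball 0 r" by (rule ball_radius)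
  obtain k G where G: "cdiff_on G (ball 0 r)" "\<And>y. y \<in> ball 0 r \<Longrightarrow> norm (G y) < \<rho> k \<and> F_lim y = F k (G y)"
    using F_lim_factor[OF r(1,2)] by blast
  have "cdiff_on (\<lambda>y. F k (G y)) (ball 0 r)" by (rule cdiff_on_compose[OF G(1) F]) (use G(2) in auto)
  then have "cdiff_on F_lim (ball 0 r)" by (rule cdiff_on_cong[OF open_ball, rotated]) (use G(2) in simp)
  then show "\<exists>D. clinear D \<and> (F_lim has_derivative D) (at y)" using r(3) unfolding cdiff_on_def by blast
qed

lemma F_lim_in: "norm y < 1 \<Longrightarrow> F_lim y \<in> \<Omega>" and F_lim_tendsto: "norm y < 1 \<Longrightarrow> (\<lambda>j. F j y) \<longlonglongrightarrow> F_lim y"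
proof -
  assume "norm y < 1"
  then obtain r where r: "0 \<le> r" "r < 1" "y \<in> ball 0 r" by (rule ball_radius)
  obtain k G where "norm (G y) < \<rho> k \<and> F_lim y = F k (G y) \<and> (\<lambda>j. F j y) \<longlonglongrightarrow> F_lim y"
    using F_lim_factor[OF r(1,2)] r(3) by blast
  then show "F_lim y \<in> \<Omega>" "(\<lambda>j. F j y) \<longlonglongrightarrow> F_lim y" using F_V[of "G y" k] V_sub[of k] by auto
qed

lemma isCont_f_lim: "x \<in> \<Omega> \<Longrightarrow> isCont f_lim x"
  using cdiff_on_continuous[OF cdiff_on_f_lim] open_\<Omega> by (simp add: continuous_on_eq_continuous_at)

lemma f_lim_F_lim:
  assumes y: "norm y < 1"
  shows "f_lim (F_lim y) = y"
proof -
  have x: "F_lim y \<in> \<Omega>" by (rule F_lim_in[OF y])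
  obtain s where s: "s > 0" "uniform_limit (ball (F_lim y) s) f f_lim sequentially"
    by (rule f_lim_uniform[OF x]) blast
  have "(\<lambda>j. f j (F j y)) \<longlonglongrightarrow> f_lim (F_lim y)"
    by (rule uniform_limit_eval[OF s(2) open_ball _ isCont_f_lim[OF x] F_lim_tendsto[OF y]]) (use s in simp)
  moreover obtain N where "\<And>k. k \<ge> N \<Longrightarrow> norm y < \<rho> k" using overlap[OF y] by blast
  then have "\<forall>\<^sub>F j in sequentially. f j (F j y) = y"
    using f_F by (intro eventually_sequentiallyI[of N]) blast
  then have "(\<lambda>j. f j (F j y)) \<longlonglongrightarrow> y" by (rule tendsto_eventually)
  ultimately show ?thesis by (rule LIMSEQ_unique)
qed

text \<open>For fixed large \<open>k\<close> the limit \<open>G\<close> of \<open>g k j\<close>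
  satisfies \<open>G (f_lim x) = f k x\<close>, because \<open>g k j (f j x) = f k x\<close> once
  \<open>F j\<close> inverts \<open>f j\<close> at \<open>x\<close>; applying \<open>F k\<close>
  gives \<open>x\<close>.\<close>

lemma F_lim_f_lim:
  assumes x: "x \<in> \<Omega>"
  shows "F_lim (f_lim x) = x"
proof -
  obtain r where r: "0 \<le> r" "r < 1" "f_lim x \<in> ball 0 r" using ball_radius[OF f_lim_ball[OF x]] by blast
  obtain s N where s: "s > 0" and N': "\<And>k y. k \<ge> N \<Longrightarrow> y \<in> ball x s \<Longrightarrow> F k (f k y) = y"
    by (rule f_lim_uniform[OF x]) blast
  have N: "F k (f k x) = x" if "k \<ge> N" for k using N'[OF that] s by simp
  from F_lim_factor[OF r(1,2)] obtain k0 where k0: "\<forall>k\<ge>k0. \<exists>G. cdiff_on G (ball 0 r) \<and>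
    uniform_limit (ball 0 r) (\<lambda>j. g k j) G sequentially \<and>
    (\<forall>y\<in>ball 0 r. norm (G y) < \<rho> k \<and> F_lim y = F k (G y) \<and> (\<lambda>j. F j y) \<longlonglongrightarrow> F_lim y)" ..
  define k where "k = max N k0"
  have k: "k \<ge> N" "k \<ge> k0" by (simp_all add: k_def)
  from k0[rule_format, OF k(2)] obtain G where G': "cdiff_on G (ball 0 r) \<and>
    uniform_limit (ball 0 r) (\<lambda>j. g k j) G sequentially \<and>
    (\<forall>y\<in>ball 0 r. norm (G y) < \<rho> k \<and> F_lim y = F k (G y) \<and> (\<lambda>j. F j y) \<longlonglongrightarrow> F_lim y)" ..
  then have G: "cdiff_on G (ball 0 r)" "uniform_limit (ball 0 r) (\<lambda>j. g k j) G sequentially"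
    "F_lim (f_lim x) = F k (G (f_lim x))" using r(3) by auto
  have "isCont G (f_lim x)"
    using cdiff_on_continuous[OF G(1)] r(3) by (simp add: continuous_on_eq_continuous_at)
  then have "(\<lambda>j. g k j (f j x)) \<longlonglongrightarrow> G (f_lim x)"
    by (rule uniform_limit_eval[OF G(2) open_ball r(3) _ f_lim_tendsto[OF x]])
  moreover have "\<forall>\<^sub>F j in sequentially. g k j (f j x) = f k x" using N by (intro eventually_sequentiallyI[of N]) simp
  then have "(\<lambda>j. g k j (f j x)) \<longlonglongrightarrow> f k x" by (rule tendsto_eventually)
  ultimately have "G (f_lim x) = f k x" by (rule LIMSEQ_unique)
  then show ?thesis using G(3) N[OF k(1)] by simp
qed

lemma biholomorphic_ball: "biholomorphic \<Omega> {z :: 'a. norm z < 1}"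
proof -
  have bij: "bij_betw f_lim \<Omega> {z. norm z < 1}"
    by (rule bij_betw_byWitness[where f' = F_lim]) (use F_lim_f_lim f_lim_F_lim f_lim_ball F_lim_in in auto)
  have ball: "{z :: 'a. norm z < 1} = ball 0 1" by auto
  have "inv_into \<Omega> f_lim y = F_lim y" if "y \<in> ball 0 1" for y
    using inv_into_f_f[OF bij_betw_imp_inj_on[OF bij] F_lim_in, of y] f_lim_F_lim[of y] that by simp
  then have "cdiff_on (inv_into \<Omega> f_lim) (ball 0 1)"
    by (intro cdiff_on_cong[OF open_ball _ cdiff_on_F_lim]) simp
  then have "holomorphic_map_on (inv_into \<Omega> f_lim) {z. norm z < 1}"
    unfolding ball by (rule cdiff_on_imp_holomorphic_map_on) simp
  then show ?thesis unfolding biholomorphic_def biholomorphism_def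
    using bij cdiff_on_imp_holomorphic_map_on[OF cdiff_on_f_lim open_\<Omega>] by blast
qed

end

section \<open>The limit metric and unitary corrections\<close>

context squeezing
begin

lemma norm_A_convergent: "convergent (\<lambda>j. norm (A j v))"
proof (rule Cauchy_convergent, rule metric_CauchyI)
  fix e :: real assume e: "e > 0"
  obtain N where N: "\<And>j k v. j \<ge> N \<Longrightarrow> k \<ge> N \<Longrightarrow> norm (A j v) \<le> norm (A k v) / (1/2)"
    using A_comparable[of "1/2"] by auto
  \<comment> \<open>\<open>2 * norm (A N v)\<close> dominates all later norms, so a relative error
    \<open>\<delta>\<close> in the comparison is an absolute error below \<open>e\<close>.\<close>
  define \<delta> where "\<delta> = e / (2 * norm (A N v) + 1)"
  have pos: "2 * norm (A N v) + 1 > 0" by (rule add_nonneg_pos) auto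
  have \<delta>: "\<delta> > 0" using e pos by (simp add: \<delta>_def)
  have "\<delta> * (2 * norm (A N v) + 1) = e" using pos by (simp add: \<delta>_def)
  then have \<delta>e: "\<delta> * (2 * norm (A N v)) < e" using \<delta> by (simp add: algebra_simps)
  have "0 < 1 / (1 + \<delta>)" "1 / (1 + \<delta>) < 1" using \<delta> by simp_all
  then obtain N' where N': "\<And>j k v. j \<ge> N' \<Longrightarrow> k \<ge> N' \<Longrightarrow> norm (A j v) \<le> norm (A k v) / (1 / (1 + \<delta>))"
    using A_comparable by blast
  have "norm (A j v) - norm (A k v) < e" if "j \<ge> max N N'" "k \<ge> max N N'" for j k
  proof -
    have "norm (A j v) \<le> norm (A k v) + \<delta> * norm (A k v)"
      using N'[of j k v] that by (simp add: algebra_simps)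
    also have "\<delta> * norm (A k v) \<le> \<delta> * (2 * norm (A N v))"
      using N[of k N v] that \<delta> by (intro mult_left_mono) auto
    finally show ?thesis using \<delta>e by simp
  qed
  then show "\<exists>M. \<forall>m\<ge>M. \<forall>n\<ge>M. dist (norm (A m v)) (norm (A n v)) < e"
    by (intro exI[of _ "max N N'"] allI impI) (simp add: dist_real_def abs_less_iff)
qed

text \<open>The norms converge, hence by polarization so do the forms
  \<open>cinner (A j v) (A j w)\<close>, and \<open>S\<close> is a square root of the limit form.
  That form is positive definite because all late \<open>A j\<close> are comparable with one fixed
  invertible \<open>A N\<close>.\<close>

lemma limit_metric:
  obtains S :: "'h \<Rightarrow> 'h" where "clinear S" "bij S"
    "\<And>r. 0 < r \<Longrightarrow> r < 1 \<Longrightarrow> \<exists>N. \<forall>j\<ge>N. \<forall>v. r * norm (S v) \<le> norm (A j v) \<and> norm (A j v) \<le> norm (S v) / r"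
proof -
  define \<nu> where "\<nu> = (\<lambda>v. lim (\<lambda>j. norm (A j v)))"
  have \<nu>: "(\<lambda>j. norm (A j v)) \<longlonglongrightarrow> \<nu> v" for v
    using norm_A_convergent[of v] by (simp add: \<nu>_def convergent_LIMSEQ_iff)
  have \<nu>0: "\<nu> v \<ge> 0" for v by (rule tendsto_lowerbound[OF \<nu>]) auto
  obtain N where N: "\<And>j k v. j \<ge> N \<Longrightarrow> k \<ge> N \<Longrightarrow> norm (A j v) \<le> norm (A k v) / (1/2)"
    using A_comparable[of "1/2"] by auto
  obtain K where K: "K > 0" "\<And>v. norm (A N v) \<le> norm v * K"
    using bounded_linear.pos_bounded[OF has_derivative_bounded_linear[OF A(1)]] by blast
  obtain K' where K': "K' > 0" "\<And>v. norm (B N v) \<le> norm v * K'"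
    using bounded_linear.pos_bounded[OF has_derivative_bounded_linear[OF B(1)]] by blast
  define L where "L = (\<lambda>v w. lim (\<lambda>j. cinner (A j v) (A j w)))"
  have pol: "cinner (A j v) (A j w) = of_real (1 / 4 * ((norm (A j (v + w)))\<^sup>2 - (norm (A j (v - w)))\<^sup>2))
     - \<i> * of_real (1 / 4 * ((norm (A j (v + \<i> *\<^sub>C w)))\<^sup>2 - (norm (A j (v - \<i> *\<^sub>C w)))\<^sup>2))" for j v w
    unfolding clinear_add[OF A(2)] clinear_diff[OF A(2)] clinear_scaleC[OF A(2)]
    by (subst cinner_polarization) simp
  have lim: "(\<lambda>j. cinner (A j v) (A j w)) \<longlonglongrightarrow> of_real (1 / 4 * ((\<nu> (v + w))\<^sup>2 - (\<nu> (v - w))\<^sup>2))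
     - \<i> * of_real (1 / 4 * ((\<nu> (v + \<i> *\<^sub>C w))\<^sup>2 - (\<nu> (v - \<i> *\<^sub>C w))\<^sup>2))" for v w
    unfolding pol by (intro tendsto_intros \<nu>)
  have L: "(\<lambda>j. cinner (A j v) (A j w)) \<longlonglongrightarrow> L v w" for v w
    using lim[of v w] unfolding L_def limI[OF lim[of v w]] .
  have "hermitian_form L" unfolding hermitian_form_def
  proof (intro conjI allI)
    show "clinear (L v)" for v
    proof (rule clinearI)
      show "L v (x + y) = L v x + L v y" for x y
        using L[of v "x + y"] tendsto_add[OF L[of v x] L[of v y]]
        unfolding clinear_add[OF A(2)] cinner_add_right by (rule LIMSEQ_unique)
      show "L v (a *\<^sub>C x) = a *\<^sub>C L v x" for a x
        using L[of v "a *\<^sub>C x"] tendsto_mult[OF tendsto_const[of a] L[of v x]]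
        unfolding clinear_scaleC[OF A(2)] cinner_scaleC_right scaleC_complex by (rule LIMSEQ_unique)
    qed
    show "L v w = cnj (L w v)" for v w
    proof (rule LIMSEQ_unique[OF L])
      have "(\<lambda>j. cnj (cinner (A j w) (A j v))) \<longlonglongrightarrow> cnj (L w v)" by (intro tendsto_intros L)
      then show "(\<lambda>j. cinner (A j v) (A j w)) \<longlonglongrightarrow> cnj (L w v)" by (simp flip: cinner_commute)
    qed
    have "cmod (L v w) \<le> (2 * K * (2 * K)) * norm v * norm w" for v w
    proof (rule tendsto_upperbound[OF tendsto_norm[OF L]])
      have "cmod (cinner (A j v) (A j w)) \<le> (2 * K * (2 * K)) * norm v * norm w" if j: "j \<ge> N" for j
      proof -
        have b: "norm (A j v) \<le> 2 * K * norm v" for v using N[OF j order_refl, of v] K(2)[of v] by (simp add: algebra_simps)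
        have "cmod (cinner (A j v) (A j w)) \<le> norm (A j v) * norm (A j w)" by (rule Cauchy_Schwarz_cinner)
        also have "\<dots> \<le> (2 * K * norm v) * (2 * K * norm w)" using K by (intro mult_mono b) auto
        finally show ?thesis by (simp add: ac_simps)
      qed
      then show "\<forall>\<^sub>F j in sequentially. cmod (cinner (A j v) (A j w)) \<le> (2 * K * (2 * K)) * norm v * norm w"
        by (rule eventually_sequentiallyI)
    qed simp
    then show "\<exists>K. \<forall>v w. cmod (L v w) \<le> K * norm v * norm w" by blast
  qed
  moreover have Lv: "Re (L v v) = (\<nu> v)\<^sup>2" for v
  proof -
    have "(\<lambda>j. of_real ((norm (A j v))\<^sup>2)) \<longlonglongrightarrow> L v v" using L[of v v] by (simp only: cinner_self)
    moreover have "(\<lambda>j. complex_of_real ((norm (A j v))\<^sup>2)) \<longlonglongrightarrow> of_real ((\<nu> v)\<^sup>2)" by (intro tendsto_intros \<nu>)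
    ultimately have "L v v = of_real ((\<nu> v)\<^sup>2)" by (rule LIMSEQ_unique)
    then show ?thesis by simp
  qed
  moreover have "(1 / (2 * K'))\<^sup>2 * (norm v)\<^sup>2 \<le> Re (L v v)" for v
  proof -
    have nv: "norm v \<le> norm (A N v) * K'" using K'(2)[of "A N v"] by (simp add: B_A)
    have "norm v / (2 * K') \<le> \<nu> v"
    proof (rule tendsto_lowerbound[OF \<nu>])
      have "norm v / (2 * K') \<le> norm (A j v)" if j: "j \<ge> N" for j
      proof -
        have "norm v \<le> (2 * norm (A j v)) * K'"
          using N[OF order_refl j, of v] K' by (intro order_trans[OF nv] mult_right_mono) auto
        then show ?thesis using K' by (simp add: pos_divide_le_eq ac_simps)
      qed
      then show "\<forall>\<^sub>F j in sequentially. norm v / (2 * K') \<le> norm (A j v)" by (rule eventually_sequentiallyI)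
    qed simp
    then have "(norm v / (2 * K'))\<^sup>2 \<le> (\<nu> v)\<^sup>2" using K' by (intro power_mono) auto
    then show ?thesis by (simp add: Lv power_divide)
  qed
  moreover have "(1 / (2 * K'))\<^sup>2 > 0" using K' by simp
  ultimately obtain S :: "'h \<Rightarrow> 'h" where S: "clinear S" "bij S" "\<And>v. (norm (S v))\<^sup>2 = Re (L v v)"
    using form_sqrt by metis
  have S\<nu>: "norm (S v) = \<nu> v" for v
    using S(3)[of v] \<nu>0[of v] by (simp add: Lv)
  show thesis
  proof (rule that[OF S(1,2)])
    fix r :: real assume r: "0 < r" "r < 1"
    obtain M where M: "\<And>j k v. j \<ge> M \<Longrightarrow> k \<ge> M \<Longrightarrow> norm (A j v) \<le> norm (A k v) / r"
      using A_comparable[OF r] by blast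
    have "r * norm (S v) \<le> norm (A j v) \<and> norm (A j v) \<le> norm (S v) / r" if j: "j \<ge> M" for j v
    proof
      have "\<nu> v \<le> norm (A j v) / r"
        by (rule tendsto_upperbound[OF \<nu>]) (auto intro!: eventually_sequentiallyI[of M] M j)
      then show "r * norm (S v) \<le> norm (A j v)" using r by (simp add: S\<nu> field_simps)
      show "norm (A j v) \<le> norm (S v) / r" unfolding S\<nu>
        by (rule tendsto_lowerbound[OF tendsto_divide[OF \<nu> tendsto_const]])
          (use r in \<open>auto intro!: eventually_sequentiallyI[of M] M j\<close>)
    qed
    then show "\<exists>N. \<forall>j\<ge>N. \<forall>v. r * norm (S v) \<le> norm (A j v) \<and> norm (A j v) \<le> norm (S v) / r" by blast
  qed
qed

text \<open>Polar decomposition: \<open>T = A j o inv S\<close> nearly preserves norms,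
  \<open>S'\<close> is its modulus, and \<open>U = S' o S o B j\<close>, the modulus composed with
  the inverse of \<open>T\<close>, is unitary. Then \<open>U o A j = S' o S\<close>, where
  \<open>S'\<close> is within \<open>\<theta>\<close> of the identity.\<close>

lemma unitary_correction:
  fixes S :: "'h \<Rightarrow> 'h"
  assumes S: "clinear S" "bij S" and r: "0 < r" "r < 1" and \<theta>: "0 \<le> \<theta>" "\<theta> < 1" "1 / r\<^sup>2 \<le> 1 + \<theta>" "1 - \<theta> \<le> r\<^sup>2"
    and cmp: "\<And>v. r * norm (S v) \<le> norm (A j v)" "\<And>v. norm (A j v) \<le> norm (S v) / r"
  obtains U :: "'h \<Rightarrow> 'h" where "clinear U" "bij U" "\<And>v. norm (U v) = norm v"
    "\<And>v. norm (U (A j v) - S v) \<le> \<theta> * norm (S v)"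
proof -
  have SS: "S (inv S x) = x" "inv S (S x) = x" for x
    using S(2) by (simp_all add: bij_is_surj surj_f_inv_f bij_is_inj)
  define T where "T = (\<lambda>v. A j (inv S v))"
  have T: "clinear T" unfolding T_def by (rule clinear_compose[OF A(2) clinear_inv[OF S]])
  have T1: "r * norm v \<le> norm (T v)" "norm (T v) \<le> norm v / r" for v
    using cmp[of "inv S v"] by (simp_all add: T_def SS)
  have herm: "hermitian_form (\<lambda>v w. cinner (T v) (T w))" unfolding hermitian_form_def
  proof (intro conjI allI)
    show "clinear (\<lambda>w. cinner (T v) (T w))" for v
      by (rule clinear_compose[OF bounded_clinear_cinner(1) T])
    show "cinner (T v) (T w) = cnj (cinner (T w) (T v))" for v w by (rule cinner_commute)
    have "cmod (cinner (T v) (T w)) \<le> (1 / r / r) * norm v * norm w" for v w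
    proof -
      have "cmod (cinner (T v) (T w)) \<le> norm (T v) * norm (T w)" by (rule Cauchy_Schwarz_cinner)
      also have "\<dots> \<le> (norm v / r) * (norm w / r)" using r by (intro mult_mono T1) auto
      finally show ?thesis by simp
    qed
    then show "\<exists>K. \<forall>v w. cmod (cinner (T v) (T w)) \<le> K * norm v * norm w" by blast
  qed
  have nearT: "\<bar>Re (cinner (T v) (T v)) - (norm v)\<^sup>2\<bar> \<le> \<theta> * (norm v)\<^sup>2" for v
  proof -
    have "(1 - \<theta>) * (norm v)\<^sup>2 \<le> r\<^sup>2 * (norm v)\<^sup>2" using \<theta> by (intro mult_right_mono) auto
    also have "\<dots> \<le> (norm (T v))\<^sup>2" using T1(1)[of v] r by (simp add: power_mono flip: power_mult_distrib)
    finally have 1: "(1 - \<theta>) * (norm v)\<^sup>2 \<le> (norm (T v))\<^sup>2" .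
    have "(norm (T v))\<^sup>2 \<le> (norm v / r)\<^sup>2" using T1(2)[of v] by (intro power_mono) auto
    also have "\<dots> = (1 / r\<^sup>2) * (norm v)\<^sup>2" by (simp add: power_divide)
    also have "\<dots> \<le> (1 + \<theta>) * (norm v)\<^sup>2" using \<theta> by (intro mult_right_mono) auto
    finally have "(norm (T v))\<^sup>2 \<le> (1 + \<theta>) * (norm v)\<^sup>2" .
    with 1 show ?thesis by (simp add: cinner_self abs_le_iff algebra_simps)
  qed
  obtain S' where S': "clinear S'" "bij S'" "\<And>v. (norm (S' v))\<^sup>2 = Re (cinner (T v) (T v))"
    "\<And>v. norm (S' v - v) \<le> \<theta> * norm v"
    by (rule near_identity_form_sqrt[OF herm \<theta>(1,2) nearT]) blast
  have nS': "norm (S' v) = norm (T v)" for v using S'(3)[of v] by (simp add: cinner_self)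
  show thesis
  proof
    show "clinear (\<lambda>w. S' (S (B j w)))" by (intro clinear_compose[OF S'(1)] clinear_compose[OF S(1)] B(2))
    have "bij (B j)" by (rule o_bij[of "A j"]) (auto simp: fun_eq_iff A_B B_A)
    then show "bij (\<lambda>w. S' (S (B j w)))" using bij_comp[OF bij_comp[OF _ S(2)] S'(2)] by (simp add: comp_def)
    show "norm (S' (S (B j v))) = norm v" for v by (simp add: nS' T_def SS A_B)
    show "norm (S' (S (B j (A j v))) - S v) \<le> \<theta> * norm (S v)" for v by (simp add: B_A S'(4))
  qed
qed

theorem biholomorphic_unit_ball: "biholomorphic \<Omega> {z :: 'h. norm z < 1}"
proof -
  obtain S :: "'h \<Rightarrow> 'h" where S: "clinear S" "bij S"
    "\<And>r. 0 < r \<Longrightarrow> r < 1 \<Longrightarrow> \<exists>N. \<forall>j\<ge>N. \<forall>v. r * norm (S v) \<le> norm (A j v) \<and> norm (A j v) \<le> norm (S v) / r"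
    by (rule limit_metric) blast
  define \<theta> where "\<theta> = (\<lambda>n::nat. 1 / (real n + 2))"
  have \<theta>: "0 < \<theta> n" "\<theta> n \<le> 1 / 2" for n by (simp_all add: \<theta>_def field_simps)
  have "\<exists>j U. n \<le> j \<and> clinear U \<and> bij U \<and> (\<forall>v. norm (U v) = norm v) \<and>
      (\<forall>v. norm (U (A j v) - S v) \<le> \<theta> n * norm (S v))" for n
  proof -
    \<comment> \<open>This \<open>r\<close> satisfies \<open>1 / r^2 = 1 + \<theta> n\<close>, which
      turns the ratio bounds of the limit metric into the tolerance
      \<open>\<theta> n\<close>.\<close>
    define r where "r = 1 / sqrt (1 + \<theta> n)"
    have r: "0 < r" "r < 1" using \<theta>[of n] by (simp_all add: r_def)
    have r2: "r\<^sup>2 = 1 / (1 + \<theta> n)" using \<theta>[of n] by (simp add: r_def power_divide)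
    have r3: "1 / r\<^sup>2 \<le> 1 + \<theta> n" "1 - \<theta> n \<le> r\<^sup>2"
    proof -
      show "1 / r\<^sup>2 \<le> 1 + \<theta> n" by (simp add: r2)
      have "(1 - \<theta> n) * (1 + \<theta> n) \<le> 1" by (simp add: algebra_simps)
      then show "1 - \<theta> n \<le> r\<^sup>2" unfolding r2 using \<theta>[of n] by (simp add: pos_le_divide_eq)
    qed
    obtain N where N: "\<And>j v. j \<ge> N \<Longrightarrow> r * norm (S v) \<le> norm (A j v)" "\<And>j v. j \<ge> N \<Longrightarrow> norm (A j v) \<le> norm (S v) / r"
      using S(3)[OF r] by blast
    define j where "j = max n N"
    have t: "0 \<le> \<theta> n" "\<theta> n < 1" using \<theta>[of n] by auto
    obtain U :: "'h \<Rightarrow> 'h" where "clinear U" "bij U" "\<And>v. norm (U v) = norm v"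
      "\<And>v. norm (U (A j v) - S v) \<le> \<theta> n * norm (S v)"
      by (rule unitary_correction[OF S(1,2) r t r3 N, of j]) (auto simp: j_def)
    then show ?thesis by (intro exI[of _ j] exI[of _ U]) (auto simp: j_def)
  qed
  \<comment> \<open>The inequality \<open>n <= \<tau> n\<close> lets statements about all large
    indices pass to the selected maps.\<close>
  then obtain \<tau> U where \<tau>: "\<And>n. n \<le> \<tau> n" and U: "\<And>n. clinear (U n)" "\<And>n. bij (U n)" "\<And>n v. norm (U n v) = norm (v::'h)"
    and UA: "\<And>n v. norm (U n (A (\<tau> n) v) - S v) \<le> \<theta> n * norm (S v)"
    by metis
  have UU: "U n (inv (U n) x) = x" "inv (U n) (U n x) = x" for n x
    using U(2)[of n] by (simp_all add: bij_is_surj surj_f_inv_f bij_is_inj)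
  have nUi: "norm (inv (U n) v) = norm v" for n v using U(3)[of n "inv (U n) v"] by (simp add: UU)
  have blU: "bounded_linear (U n)" "bounded_linear (inv (U n))" for n
    using bounded_linear_of_clinear[OF U(1), of n 1] bounded_linear_of_clinear[OF clinear_inv[OF U(1,2)], of n 1]
    by (simp_all add: U(3) nUi)
  have fd: "fderiv (\<lambda>x. U n (f (\<tau> n) x)) q = (\<lambda>v. U n (A (\<tau> n) v))" for n
    by (intro fderiv_eq bounded_linear.has_derivative[OF blU(1)] A(1))
  interpret nrm: normalized_squeezing \<Omega> q "\<lambda>n. V (\<tau> n)" "\<lambda>n x. U n (f (\<tau> n) x)"
    "\<lambda>n y. F (\<tau> n) (inv (U n) y)" "\<lambda>n. \<rho> (\<tau> n)"
  proof unfold_locales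
    show "open \<Omega>" "q \<in> \<Omega>" by (rule open_\<Omega>, rule q_in)
    fix k
    show "open (V (\<tau> k))" "V (\<tau> k) \<subseteq> \<Omega>" "q \<in> V (\<tau> k)" by (rule open_V, rule V_sub, rule q_V)
    show "cdiff_on (\<lambda>x. U k (f (\<tau> k) x)) (V (\<tau> k))"
      by (rule cdiff_on_compose[OF f cdiff_on_bounded_clinear[OF U(1) blU(1), where S=UNIV]]) simp
    show "norm (U k (f (\<tau> k) x)) < 1" if "x \<in> V (\<tau> k)" for x using f_ball[OF that] by (simp add: U(3))
    show "U k (f (\<tau> k) q) = 0" by (simp add: f_q clinear_zero[OF U(1)])
    show "0 < \<rho> (\<tau> k)" by (rule \<rho>)
    show "cdiff_on (\<lambda>y. F (\<tau> k) (inv (U k) y)) (ball 0 (\<rho> (\<tau> k)))"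
      by (rule cdiff_on_compose[OF cdiff_on_bounded_clinear[OF clinear_inv[OF U(1,2)] blU(2)] F]) (simp add: nUi)
    show "F (\<tau> k) (inv (U k) y) \<in> V (\<tau> k)" "U k (f (\<tau> k) (F (\<tau> k) (inv (U k) y))) = y" if "norm y < \<rho> (\<tau> k)" for y
      using F_V[of "inv (U k) y" "\<tau> k"] f_F[of "inv (U k) y" "\<tau> k"] that by (simp_all add: nUi UU)
    show "F (\<tau> k) (inv (U k) (U k (f (\<tau> k) x))) = x" if "x \<in> V (\<tau> k)" "norm (U k (f (\<tau> k) x)) < \<rho> (\<tau> k)" for x
      using F_f[OF that(1)] that(2) by (simp add: U(3) UU)
  next
    fix r :: real assume "r < 1"
    then obtain N where N: "\<And>j k. j\<ge>N \<Longrightarrow> k\<ge>N \<Longrightarrow> r < \<rho> k \<and> (\<forall>y. norm y < r \<longrightarrow> F k y \<in> V j)"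
      using overlap by blast
    have "r < \<rho> (\<tau> k) \<and> (\<forall>y. norm y < r \<longrightarrow> F (\<tau> k) (inv (U k) y) \<in> V (\<tau> j))" if "j \<ge> N" "k \<ge> N" for j k
      using N[of "\<tau> j" "\<tau> k"] \<tau>[of j] \<tau>[of k] that by (auto simp: nUi)
    then show "\<exists>N. \<forall>j\<ge>N. \<forall>k\<ge>N. r < \<rho> (\<tau> k) \<and> (\<forall>y. norm y < r \<longrightarrow> F (\<tau> k) (inv (U k) y) \<in> V (\<tau> j))" by blast
  next
    fix x assume "x \<in> \<Omega>"
    then obtain s r N where s: "s > 0" "r < 1" "ball x s \<subseteq> \<Omega>" and N: "\<And>k y. k\<ge>N \<Longrightarrow> y\<in>ball x s \<Longrightarrow> y \<in> V k \<and> norm (f k y) < r"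
      using exhaust by blast
    have "y \<in> V (\<tau> k) \<and> norm (U k (f (\<tau> k) y)) < r" if "k \<ge> N" "y \<in> ball x s" for k y
      using N[of "\<tau> k" y] \<tau>[of k] that by (auto simp: U(3))
    then show "\<exists>s>0. \<exists>r<1. \<exists>N. ball x s \<subseteq> \<Omega> \<and> (\<forall>k\<ge>N. \<forall>y\<in>ball x s. y \<in> V (\<tau> k) \<and> norm (U k (f (\<tau> k) y)) < r)"
      using s by blast
  next
    fix \<delta> :: real assume \<delta>: "\<delta> > 0"
    obtain N :: nat where N: "4 / \<delta> < real N" using reals_Archimedean2 by blast
    have \<theta>N: "\<theta> n \<le> \<delta> / 4" if "n \<ge> N" for n
    proof -
      have "4 / \<delta> \<le> real n + 2" using N that by linarith
      then show ?thesis using \<delta> by (simp add: \<theta>_def field_simps)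
    qed
    have "norm (U j (A (\<tau> j) v) - U k (A (\<tau> k) v)) \<le> \<delta> * norm (U k (A (\<tau> k) v))" if "j \<ge> N" "k \<ge> N" for j k v
    proof -
      have "norm (U j (A (\<tau> j) v) - U k (A (\<tau> k) v)) \<le> norm (U j (A (\<tau> j) v) - S v) + norm (U k (A (\<tau> k) v) - S v)"
        using norm_triangle_ineq4[of "U j (A (\<tau> j) v) - S v" "U k (A (\<tau> k) v) - S v"] by simp
      also have "\<dots> \<le> \<theta> j * norm (S v) + \<theta> k * norm (S v)" by (intro add_mono UA)
      also have "\<dots> \<le> \<delta> / 4 * norm (S v) + \<delta> / 4 * norm (S v)"
        using that by (intro add_mono mult_right_mono \<theta>N) auto
      also have "\<dots> = \<delta> * (norm (S v) / 2)" by simp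
      \<comment> \<open>As \<open>\<theta> k <= 1 / 2\<close>, the norm of \<open>S v\<close> is at
        most twice that of the corrected derivative, so the error becomes relative to the derivative
        itself.\<close>
      also have "\<dots> \<le> \<delta> * norm (U k (A (\<tau> k) v))"
      proof -
        have "norm (S v) \<le> norm (U k (A (\<tau> k) v)) + norm (U k (A (\<tau> k) v) - S v)"
          using norm_triangle_sub[of "S v" "U k (A (\<tau> k) v)"] by (simp add: norm_minus_commute)
        also have "\<dots> \<le> norm (U k (A (\<tau> k) v)) + 1 / 2 * norm (S v)"
          using mult_right_mono[OF \<theta>(2)[of k], of "norm (S v)"] UA[of k v] by simp
        finally show ?thesis using \<delta> by (intro mult_left_mono) auto
      qed
      finally show ?thesis .
    qed
    then show "\<exists>N. \<forall>j\<ge>N. \<forall>k\<ge>N. \<forall>v. norm (fderiv (\<lambda>x. U j (f (\<tau> j) x)) q v - fderiv (\<lambda>x. U k (f (\<tau> k) x)) q v)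
        \<le> \<delta> * norm (fderiv (\<lambda>x. U k (f (\<tau> k) x)) q v)"
      unfolding fd by blast
  qed
  show ?thesis by (rule nrm.biholomorphic_ball)
qed

end

section \<open>Local geometry at a strongly pseudoconvex point\<close>

text \<open>\<open>ll a\<close> stands for twice the (1,0) part of the derivative of
  \<open>\<rho>\<close> at \<open>a\<close>; \<open>Q\<close> and \<open>L\<close> stand for the
  bilinear and hermitian parts of half the second derivative, frozen at \<open>p\<close>. The
  expansion \<open>taylor\<close> is uniform in the centre \<open>a\<close>. \<open>e\<close> is the
  unit complex normal at \<open>p\<close> and \<open>\<alpha>\<close> the length of the gradient;
  positivity of \<open>L\<close> is assumed on the complement of \<open>e\<close>.\<close>

locale local_model =
  fixes \<Omega> :: "'h::complex_hilbert set" and p :: 'h and \<rho> :: "'h \<Rightarrow> real"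
    and ll :: "'h \<Rightarrow> 'h \<Rightarrow> complex" and Q L :: "'h \<Rightarrow> 'h \<Rightarrow> complex" and e :: 'h
    and \<alpha> M C d0 :: real
  assumes clinear_ll: "clinear (ll a)" and bounded_ll: "bounded_linear (ll a)"
    and ll_near: "\<eta> > 0 \<Longrightarrow> \<exists>\<delta>>0. \<forall>a. norm (a - p) < \<delta> \<longrightarrow> (\<forall>z. cmod (ll a z - ll p z) \<le> \<eta> * norm z)"
    and ll_p: "ll p z = of_real \<alpha> * cinner e z" and \<alpha>: "\<alpha> > 0" and norm_e: "norm e = 1"
    and Q: "bounded_bilinear Q" "clinear (Q v)" "clinear (\<lambda>v. Q v w)" and Q_le: "cmod (Q v w) \<le> M * norm v * norm w"
    and L: "hermitian_form L" and L_le: "cmod (L v w) \<le> M * norm v * norm w"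
    and M: "M > 0" and C: "C > 0" and L_ge: "cinner e v = 0 \<Longrightarrow> C * (norm v)\<^sup>2 \<le> Re (L v v)"
    and taylor: "\<epsilon> > 0 \<Longrightarrow> \<exists>\<delta>>0. \<forall>a z. norm (a - p) < \<delta> \<longrightarrow> norm z < \<delta> \<longrightarrow>
      \<bar>\<rho> (a + z) - \<rho> a - (Re (ll a z) + Re (Q z z) + Re (L z z))\<bar> \<le> \<epsilon> * (norm z)\<^sup>2"
    and \<rho>_p: "\<rho> p = 0" and cont_\<rho>: "isCont \<rho> p"
    and d0: "d0 > 0" and \<Omega>_iff: "z \<in> ball p d0 \<Longrightarrow> z \<in> \<Omega> \<longleftrightarrow> \<rho> z < 0"
    and open_\<Omega>: "open \<Omega>"
begin

definition \<pi> :: "'h \<Rightarrow> 'h" where "\<pi> z = z - cinner e z *\<^sub>C e"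

lemma e_e: "cinner e e = 1"
  by (simp add: cinner_self norm_e)

lemma \<pi>_orth [simp]: "cinner e (\<pi> z) = 0"
  by (simp add: \<pi>_def cinner_diff_right cinner_scaleC_right e_e)

lemma decomp: "cinner e z *\<^sub>C e + \<pi> z = z"
  by (simp add: \<pi>_def)

lemma \<pi>_id: "cinner e z = 0 \<Longrightarrow> \<pi> z = z"
  by (simp add: \<pi>_def)

lemma clinear_\<pi>: "clinear \<pi>"
  by (rule clinearI) (simp_all add: \<pi>_def cinner_add_right cinner_scaleC_right scaleC_add_left scaleC_diff_right scaleC_scaleC)

lemma norm_decomp: "(norm z)\<^sup>2 = (cmod (cinner e z))\<^sup>2 + (norm (\<pi> z))\<^sup>2"
  using norm_add_square[of "cinner e z *\<^sub>C e" "\<pi> z"] unfolding decomp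
  by (simp add: cinner_scaleC_left norm_scaleC norm_e)

lemma norm_\<pi>: "norm (\<pi> z) \<le> norm z"
  by (rule power2_le_imp_le) (simp_all add: norm_decomp[of z])

lemma norm_comp: "cmod (cinner e z) \<le> norm z"
  by (rule power2_le_imp_le) (simp_all add: norm_decomp[of z])

lemma norm_le_sum: "norm z \<le> cmod (cinner e z) + norm (\<pi> z)"
  using norm_triangle_ineq[of "cinner e z *\<^sub>C e" "\<pi> z"] unfolding decomp by (simp add: norm_scaleC norm_e)

lemma bounded_\<pi>: "bounded_linear \<pi>"
  by (rule bounded_linear_of_clinear[OF clinear_\<pi>, of 1]) (simp add: norm_\<pi>)

lemma L_add_left: "L (x + y) w = L x w + L y w"
proof -
  have lin: "clinear (L w)" and her: "\<And>v w. L v w = cnj (L w v)" using L unfolding hermitian_form_def by blast+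
  have "L (x + y) w = cnj (L w x + L w y)" by (subst her) (simp add: clinear_add[OF lin])
  also have "\<dots> = L x w + L y w" by (simp only: complex_cnj_add her[symmetric])
  finally show ?thesis .
qed

lemma clinear_L: "clinear (L v)"
  using L unfolding hermitian_form_def by blast

lemma diff_proj:
  assumes add: "\<And>x y w. B (x + y) w = B x w + B y w" "\<And>x y w. B w (x + y) = B w x + B w y"
    and le: "\<And>v w. cmod (B v w) \<le> M * norm v * norm w"
  shows "cmod (B z z - B (\<pi> z) (\<pi> z)) \<le> 2 * M * (cmod (cinner e z) * norm z)"
proof -
  define x where "x = cinner e z *\<^sub>C e"
  have nx: "norm x = cmod (cinner e z)" by (simp add: x_def norm_scaleC norm_e)
  have z: "z = x + \<pi> z" by (simp add: x_def decomp)
  have "B z z = B x z + B (\<pi> z) z" using add(1)[of x "\<pi> z" z] z by simp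
  also have "B (\<pi> z) z = B (\<pi> z) x + B (\<pi> z) (\<pi> z)" using add(2)[of "\<pi> z" x "\<pi> z"] z by simp
  finally have "B z z - B (\<pi> z) (\<pi> z) = B x z + B (\<pi> z) x" by simp
  moreover have "cmod (B x z) \<le> M * cmod (cinner e z) * norm z" using le[of x z] nx by simp
  moreover have "cmod (B (\<pi> z) x) \<le> M * norm z * cmod (cinner e z)"
    using le[of "\<pi> z" x] nx M norm_\<pi>[of z]
    by (intro order_trans[OF le]) (simp add: mult_left_mono mult_right_mono)
  ultimately show ?thesis using norm_triangle_ineq[of "B x z" "B (\<pi> z) x"] by (simp add: algebra_simps)
qed

lemma Q_diff: "cmod (Q z z - Q (\<pi> z) (\<pi> z)) \<le> 2 * M * (cmod (cinner e z) * norm z)"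
  by (rule diff_proj) (simp_all add: clinear_add[OF Q(2)] clinear_add[OF Q(3)] Q_le)

lemma L_diff: "cmod (L z z - L (\<pi> z) (\<pi> z)) \<le> 2 * M * (cmod (cinner e z) * norm z)"
  by (rule diff_proj) (simp_all add: clinear_add[OF clinear_L] L_add_left L_le)

lemma cdiff_on_ll: "cdiff_on f S \<Longrightarrow> cdiff_on (\<lambda>z. ll a (f z)) S"
  by (rule cdiff_on_compose[OF _ cdiff_on_bounded_clinear[OF clinear_ll bounded_ll, where S=UNIV]]) auto

lemma cdiff_on_\<pi>: "cdiff_on f S \<Longrightarrow> cdiff_on (\<lambda>z. \<pi> (f z)) S"
  by (rule cdiff_on_compose[OF _ cdiff_on_bounded_clinear[OF clinear_\<pi> bounded_\<pi>, where S=UNIV]]) auto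

lemma cdiff_on_Q: "cdiff_on f S \<Longrightarrow> cdiff_on (\<lambda>z. Q (f z) (f z)) S"
  by (rule cdiff_on_bounded_cbilinear[OF Q])

text \<open>The peak function is \<open>1 / N\<close> with \<open>N = 1 + 2 K h\<close>, where \<open>- h\<close> is the holomorphic part of the
  second order expansion of \<open>\<rho>\<close>: on the domain \<open>Re h + K \<bar>h\<bar>\<^sup>2 \<ge> C / 4 \<bar>z - p\<bar>\<^sup>2\<close> because the Levi form
  may fail to be positive only in the direction of \<open>e\<close>, which \<open>h\<close> controls.\<close>

lemma peak_exists: "\<exists>N c r. peak_point \<Omega> p N c r"
proof -
  \<comment> \<open>\<open>K2\<close> is the multiple of \<open>x^2\<close> lost when the cross term
    \<open>x * norm y\<close> is absorbed; \<open>K\<close> converts this loss, via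
    \<open>\<alpha> * x <= cmod (h y) + M * (norm y)^2\<close>, into a multiple of
    \<open>(cmod (h y))^2\<close>.\<close>
  define K2 where "K2 = C + 4 * M\<^sup>2 / C"
  have K2: "K2 > 0" using C by (simp add: K2_def add_pos_nonneg)
  define K where "K = 2 * K2 / \<alpha>\<^sup>2"
  have K: "K > 0" using K2 \<alpha> by (simp add: K_def)
  have "C / 4 > 0" using C by simp
  then obtain \<delta> where \<delta>: "\<delta> > 0" and tay: "\<And>a z. norm (a - p) < \<delta> \<Longrightarrow> norm z < \<delta> \<Longrightarrow>
      \<bar>\<rho> (a + z) - \<rho> a - (Re (ll a z) + Re (Q z z) + Re (L z z))\<bar> \<le> C / 4 * (norm z)\<^sup>2"
    using taylor by blast
  \<comment> \<open>The radius makes the quartic remainder \<open>K * (M * (norm y)^2)^2\<close> at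
    most \<open>C / 4 * (norm y)^2\<close>.\<close>
  define b where "b = sqrt (C / (4 * K * M\<^sup>2))"
  have b: "b > 0" "b\<^sup>2 = C / (4 * K * M\<^sup>2)" using K C M by (simp_all add: b_def)
  define r where "r = min d0 (min \<delta> b)"
  have r: "r > 0" "r \<le> d0" "r \<le> \<delta>" "r \<le> b" using d0 \<delta> b by (simp_all add: r_def)
  define h where "h = (\<lambda>z. - (ll p z + Q z z))"
  define N where "N = (\<lambda>z. 1 + of_real (2 * K) * h (z - p))"
  have "1 + K * C * (norm (z - p))\<^sup>2 \<le> (cmod (N z))\<^sup>2" if z: "z \<in> \<Omega>" "z \<in> ball p r" for z
  proof -
    define y where "y = z - p"
    have ny: "norm y < r" using z(2) by (simp add: y_def dist_norm norm_minus_commute)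
    have "\<rho> z < 0" using \<Omega>_iff[of z] z r by simp
    moreover have "\<bar>\<rho> (p + y) - \<rho> p - (Re (ll p y) + Re (Q y y) + Re (L y y))\<bar> \<le> C / 4 * (norm y)\<^sup>2"
      using ny r \<delta> by (intro tay) auto
    then have "- (\<rho> (p + y) - \<rho> p - (Re (ll p y) + Re (Q y y) + Re (L y y))) \<le> C / 4 * (norm y)\<^sup>2"
      by (rule abs_le_D2)
    moreover have "p + y = z" "Re (h y) = - (Re (ll p y) + Re (Q y y))" by (simp_all add: y_def h_def)
    ultimately have 1: "Re (L y y) - C / 4 * (norm y)\<^sup>2 \<le> Re (h y)"
      using \<rho>_p by simp
    define x where "x = cmod (cinner e y)"
    have x0: "x \<ge> 0" by (simp add: x_def)
    have s: "(norm (\<pi> y))\<^sup>2 = (norm y)\<^sup>2 - x\<^sup>2" using norm_decomp[of y] by (simp add: x_def)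
    have 2: "Re (L y y) \<ge> C * ((norm y)\<^sup>2 - x\<^sup>2) - 2 * M * (x * norm y)"
    proof -
      have "C * (norm (\<pi> y))\<^sup>2 \<le> Re (L (\<pi> y) (\<pi> y))" by (rule L_ge) simp
      moreover have "\<bar>Re (L y y - L (\<pi> y) (\<pi> y))\<bar> \<le> 2 * M * (x * norm y)"
        using abs_Re_le_cmod[of "L y y - L (\<pi> y) (\<pi> y)"] L_diff[of y] by (simp add: x_def)
      ultimately show ?thesis unfolding s by simp
    qed
    have 3: "2 * M * (x * norm y) \<le> C / 4 * (norm y)\<^sup>2 + 4 * M\<^sup>2 / C * x\<^sup>2"
    proof -
      have "0 \<le> (sqrt C / 2 * norm y - 2 * M / sqrt C * x)\<^sup>2" by simp
      also have "\<dots> = C / 4 * (norm y)\<^sup>2 + 4 * M\<^sup>2 / C * x\<^sup>2 - 2 * M * (x * norm y)"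
        using C by (simp add: power2_diff power_mult_distrib power_divide)
      finally show ?thesis by simp
    qed
    have 4: "C / 2 * (norm y)\<^sup>2 - K2 * x\<^sup>2 \<le> Re (h y)"
      using 1 2 3 by (simp add: K2_def algebra_simps)
    have "\<alpha> * x \<le> cmod (h y) + M * (norm y)\<^sup>2"
    proof -
      have "\<alpha> * x = cmod (ll p y)" using \<alpha> by (simp add: ll_p x_def norm_mult)
      also have "ll p y = - (h y + Q y y)" by (simp add: h_def)
      also have "cmod (- (h y + Q y y)) = cmod (h y + Q y y)" by (rule norm_minus_cancel)
      also have "\<dots> \<le> cmod (h y) + cmod (Q y y)" by (rule norm_triangle_ineq)
      finally show ?thesis using Q_le[of y y] by (simp add: power2_eq_square mult.assoc)
    qed
    then have "(\<alpha> * x)\<^sup>2 \<le> (cmod (h y) + M * (norm y)\<^sup>2)\<^sup>2" using \<alpha> x0 by (intro power_mono) auto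
    also have "\<dots> \<le> 2 * (cmod (h y))\<^sup>2 + 2 * (M * (norm y)\<^sup>2)\<^sup>2"
      using sum_squares_bound[of "cmod (h y)" "M * (norm y)\<^sup>2"] by (simp add: power2_sum)
    finally have "K2 / \<alpha>\<^sup>2 * (\<alpha> * x)\<^sup>2 \<le> K2 / \<alpha>\<^sup>2 * (2 * (cmod (h y))\<^sup>2 + 2 * (M * (norm y)\<^sup>2)\<^sup>2)"
      using \<alpha> K2 by (intro mult_left_mono) auto
    moreover have "K2 / \<alpha>\<^sup>2 * (\<alpha> * x)\<^sup>2 = K2 * x\<^sup>2" using \<alpha> by (simp add: power_mult_distrib)
    ultimately have "K2 * x\<^sup>2 \<le> K * (cmod (h y))\<^sup>2 + K * (M * (norm y)\<^sup>2)\<^sup>2"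
      unfolding K_def distrib_left by (simp only: times_divide_eq_left mult.assoc mult.left_commute[of K2 2])
    also have "K * (M * (norm y)\<^sup>2)\<^sup>2 \<le> C / 4 * (norm y)\<^sup>2"
    proof -
      have "(norm y)\<^sup>2 \<le> b\<^sup>2" using ny r by (intro power_mono) auto
      then have "K * M\<^sup>2 * (norm y)\<^sup>2 \<le> K * M\<^sup>2 * b\<^sup>2" using K by (intro mult_left_mono) auto
      also have "\<dots> = C / 4" using K M by (simp add: b(2))
      finally have "K * M\<^sup>2 * (norm y)\<^sup>2 * (norm y)\<^sup>2 \<le> C / 4 * (norm y)\<^sup>2" by (intro mult_right_mono) auto
      then show ?thesis by (simp add: power_mult_distrib power2_eq_square ac_simps)
    qed
    finally have 5: "C / 4 * (norm y)\<^sup>2 \<le> Re (h y) + K * (cmod (h y))\<^sup>2" using 4 by simp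
    \<comment> \<open>The factor \<open>2 * K\<close> in \<open>N\<close> is chosen for this
      identity, whose bracket has just been bounded below.\<close>
    have "(cmod (N z))\<^sup>2 = 1 + 4 * K * (Re (h y) + K * (cmod (h y))\<^sup>2)"
      unfolding cmod_power2 by (simp add: N_def y_def power2_eq_square algebra_simps)
    moreover have "4 * K * (C / 4 * (norm y)\<^sup>2) \<le> 4 * K * (Re (h y) + K * (cmod (h y))\<^sup>2)"
      using 5 K by (intro mult_left_mono) auto
    ultimately show ?thesis by (simp add: y_def ac_simps)
  qed
  moreover have "cdiff_on N UNIV" unfolding N_def h_def
    by (intro cdiff_on_add cdiff_on_const cdiff_on_mult cdiff_on_minus cdiff_on_ll cdiff_on_Q cdiff_on_diff cdiff_on_id)
  moreover have "N p = 1" by (simp add: N_def h_def clinear_zero[OF clinear_ll] clinear_zero[OF Q(2)])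
  moreover have "K * C > 0" using K C by simp
  ultimately have "peak_point \<Omega> p N (K * C) r" using r(1) by (intro peak_point.intro) auto
  then show ?thesis by blast
qed

text \<open>Only the tangential part of \<open>Q\<close> enters, so that the coordinates \<open>w0 a\<close> and \<open>\<pi>\<close> have a polynomial
  inverse; the neglected part of \<open>Q\<close> is absorbed by the error term \<open>\<eta> \<bar>w0\<bar>\<close> below.\<close>

definition w0 :: "'h \<Rightarrow> 'h \<Rightarrow> complex" where "w0 a z = - (ll a z + Q (\<pi> z) (\<pi> z))"

definition \<Lambda> :: "'h \<Rightarrow> real" where "\<Lambda> z = Re (L (\<pi> z) (\<pi> z))"

lemma \<Lambda>_ge: "C * (norm (\<pi> z))\<^sup>2 \<le> \<Lambda> z"
  unfolding \<Lambda>_def by (rule L_ge) simp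

text \<open>The error carries the weights of the scaling, \<open>w0\<close> of order
  \<open>t\<close> and the tangential part of order \<open>sqrt t\<close>, so it stays a small
  multiple of \<open>t\<close>. The Taylor error \<open>(norm z)^2\<close> can be brought to this
  form because the normal component of \<open>z\<close> is controlled by \<open>w0\<close>, the
  square of the tangential part, and a small multiple of that part.\<close>

lemma sandwich:
  assumes \<eta>: "\<eta> > 0"
  shows "\<exists>\<delta>>0. \<forall>a z. norm (a - p) < \<delta> \<longrightarrow> norm z < \<delta> \<longrightarrow>
    \<bar>\<rho> (a + z) - \<rho> a + Re (w0 a z) - \<Lambda> z\<bar> \<le> \<eta> * (cmod (w0 a z) + (norm (\<pi> z))\<^sup>2)"
proof -
  \<comment> \<open>\<open>\<beta>\<close> recovers the normal component from \<open>w0\<close>,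
    \<open>P\<close> bounds products of components, \<open>T\<close> sums up all error terms, and
    \<open>\<kappa>\<close> is the common smallness with
    \<open>\<kappa> * T <= \<eta>\<close>.\<close>
  define \<beta> where "\<beta> = 2 / \<alpha>"
  have \<beta>: "\<beta> > 0" using \<alpha> by (simp add: \<beta>_def)
  define P where "P = \<beta> * (1 + M) + 1"
  have P: "P > 0" "P \<ge> 1" "P \<ge> \<beta>" "P \<ge> \<beta> * M" using \<beta> M by (simp_all add: P_def algebra_simps add_pos_pos)
  define T where "T = 12 * M * P + 2 * P + 1"
  have T: "T > 0" using M P by (simp add: T_def add_pos_pos)
  define \<kappa> where "\<kappa> = min 1 (\<eta> / T)"
  have "\<kappa> > 0" "\<kappa> \<le> 1" "\<kappa> \<le> \<eta> / T" using \<eta> T by (simp_all add: \<kappa>_def)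
  then have \<kappa>: "\<kappa> > 0" "\<kappa> \<le> 1" "\<kappa> * T \<le> \<eta>" using T by (simp_all add: pos_le_divide_eq)
  have "\<kappa> * \<alpha> / 4 > 0" using \<kappa> \<alpha> by simp
  then obtain \<delta>1 where \<delta>1: "\<delta>1 > 0" "\<And>a z. norm (a - p) < \<delta>1 \<Longrightarrow> cmod (ll a z - ll p z) \<le> \<kappa> * \<alpha> / 4 * norm z"
    using ll_near by blast
  obtain \<delta>2 where \<delta>2: "\<delta>2 > 0" and tay: "\<And>a z. norm (a - p) < \<delta>2 \<Longrightarrow> norm z < \<delta>2 \<Longrightarrow>
      \<bar>\<rho> (a + z) - \<rho> a - (Re (ll a z) + Re (Q z z) + Re (L z z))\<bar> \<le> \<kappa> * (norm z)\<^sup>2"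
    using taylor[OF \<kappa>(1)] by blast
  define \<delta> where "\<delta> = min \<kappa> (min \<delta>1 \<delta>2)"
  have \<delta>: "\<delta> > 0" "\<delta> \<le> \<kappa>" "\<delta> \<le> \<delta>1" "\<delta> \<le> \<delta>2" using \<kappa> \<delta>1 \<delta>2 by (simp_all add: \<delta>_def)
  have "\<bar>\<rho> (a + z) - \<rho> a + Re (w0 a z) - \<Lambda> z\<bar> \<le> \<eta> * (cmod (w0 a z) + (norm (\<pi> z))\<^sup>2)"
    if a: "norm (a - p) < \<delta>" and z: "norm z < \<delta>" for a z
  proof -
    define W where "W = cmod (w0 a z)"
    define x where "x = cmod (cinner e z)"
    define s where "s = norm (\<pi> z)"
    have nn: "W \<ge> 0" "x \<ge> 0" "s \<ge> 0" by (simp_all add: W_def x_def s_def)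
    have zz: "norm z \<le> x + s" "(norm z)\<^sup>2 = x\<^sup>2 + s\<^sup>2"
      using norm_le_sum[of z] norm_decomp[of z] by (simp_all add: x_def s_def)
    have small: "x \<le> \<kappa>" "s \<le> \<kappa>" using norm_comp[of z] norm_\<pi>[of z] z \<delta> by (simp_all add: x_def s_def)
    have "\<alpha> * x \<le> W + M * s\<^sup>2 + \<kappa> * \<alpha> / 4 * (x + s)"
    proof -
      have "\<alpha> * x = cmod (ll p z)" using \<alpha> by (simp add: ll_p x_def norm_mult)
      also have "\<dots> = cmod ((- w0 a z - Q (\<pi> z) (\<pi> z)) - (ll a z - ll p z))" by (simp add: w0_def)
      also have "\<dots> \<le> cmod (- w0 a z - Q (\<pi> z) (\<pi> z)) + cmod (ll a z - ll p z)" by (rule norm_triangle_ineq4)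
      also have "\<dots> \<le> (W + M * s\<^sup>2) + \<kappa> * \<alpha> / 4 * norm z"
      proof (rule add_mono)
        have "cmod (Q (\<pi> z) (\<pi> z)) \<le> M * s\<^sup>2" using Q_le[of "\<pi> z" "\<pi> z"] by (simp add: s_def power2_eq_square mult.assoc)
        then show "cmod (- w0 a z - Q (\<pi> z) (\<pi> z)) \<le> W + M * s\<^sup>2"
          using norm_triangle_ineq4[of "- w0 a z" "Q (\<pi> z) (\<pi> z)"] by (simp add: W_def)
        show "cmod (ll a z - ll p z) \<le> \<kappa> * \<alpha> / 4 * norm z" using a \<delta> by (intro \<delta>1(2)) simp
      qed
      also have "\<kappa> * \<alpha> / 4 * norm z \<le> \<kappa> * \<alpha> / 4 * (x + s)" using zz \<kappa> \<alpha> by (intro mult_left_mono) auto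
      finally show ?thesis by simp
    qed
    moreover have "\<kappa> * \<alpha> / 4 * x \<le> 1 * \<alpha> / 4 * x" using \<kappa> \<alpha> nn by (intro mult_right_mono divide_right_mono) auto
    ultimately have "3 / 4 * (\<alpha> * x) \<le> W + M * s\<^sup>2 + \<kappa> * \<alpha> / 4 * s" unfolding distrib_left by linarith
    moreover have "1 / 2 * (\<alpha> * x) \<le> 3 / 4 * (\<alpha> * x)" using \<alpha> nn by simp
    ultimately have "1 / 2 * (\<alpha> * x) \<le> W + M * s\<^sup>2 + \<kappa> * \<alpha> / 4 * s" by linarith
    then have "\<beta> * (1 / 2 * (\<alpha> * x)) \<le> \<beta> * (W + M * s\<^sup>2 + \<kappa> * \<alpha> / 4 * s)" using \<beta> by (intro mult_left_mono) auto
    have x1: "x \<le> \<beta> * (W + M * s\<^sup>2) + \<kappa> * s"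
    proof -
      have "\<beta> * (1 / 2 * (\<alpha> * x)) = x" "\<beta> * (\<kappa> * \<alpha> / 4 * s) = \<kappa> * s / 2" using \<alpha> by (simp_all add: \<beta>_def)
      moreover have "\<kappa> * s \<ge> 0" using \<kappa> nn by simp
      ultimately show ?thesis
        using \<open>\<beta> * (1 / 2 * (\<alpha> * x)) \<le> _\<close> distrib_left[of \<beta> "W + M * s\<^sup>2" "\<kappa> * \<alpha> / 4 * s"] by linarith
    qed
    have P1: "\<beta> * (W + M * s\<^sup>2) + s\<^sup>2 \<le> P * (W + s\<^sup>2)"
      using P \<beta> M nn mult_right_mono[OF P(3) nn(1)] by (simp add: P_def algebra_simps)
    \<comment> \<open>The linear term \<open>\<kappa> * s\<close> in \<open>x1\<close> is harmless
      here: multiplied by \<open>s\<close> it has the right weight.\<close>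
    have xs: "x * s \<le> \<kappa> * (P * (W + s\<^sup>2))"
    proof -
      have "x * s \<le> (\<beta> * (W + M * s\<^sup>2) + \<kappa> * s) * s" using x1 nn by (intro mult_right_mono) auto
      also have "\<dots> = \<beta> * (W + M * s\<^sup>2) * s + \<kappa> * s\<^sup>2" by (simp add: power2_eq_square algebra_simps)
      also have "\<beta> * (W + M * s\<^sup>2) * s \<le> \<beta> * (W + M * s\<^sup>2) * \<kappa>"
        using \<beta> M nn small by (intro mult_left_mono mult_nonneg_nonneg add_nonneg_nonneg) auto
      finally have "x * s \<le> \<kappa> * (\<beta> * (W + M * s\<^sup>2) + s\<^sup>2)" by (simp add: algebra_simps)
      also have "\<dots> \<le> \<kappa> * (P * (W + s\<^sup>2))" using P1 \<kappa> by (intro mult_left_mono) auto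
      finally show ?thesis .
    qed
    have xx: "x\<^sup>2 \<le> 2 * (\<kappa> * (P * (W + s\<^sup>2)))"
    proof -
      have "x\<^sup>2 \<le> x * (\<beta> * (W + M * s\<^sup>2) + \<kappa> * s)" using x1 nn by (simp add: power2_eq_square mult_left_mono)
      also have "\<dots> = x * (\<beta> * (W + M * s\<^sup>2)) + \<kappa> * (x * s)" by (simp add: algebra_simps)
      also have "x * (\<beta> * (W + M * s\<^sup>2)) \<le> \<kappa> * (\<beta> * (W + M * s\<^sup>2))"
        using \<beta> M nn small by (intro mult_right_mono mult_nonneg_nonneg add_nonneg_nonneg) auto
      also have "\<kappa> * (\<beta> * (W + M * s\<^sup>2)) \<le> \<kappa> * (P * (W + s\<^sup>2))"
        using P1 \<kappa> zero_le_power2[of s] by (intro mult_left_mono) linarith+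
      also have "\<kappa> * (x * s) \<le> 1 * (x * s)" using \<kappa> nn by (intro mult_right_mono) auto
      finally show ?thesis using xs by simp
    qed
    have xz: "x * norm z \<le> 3 * (\<kappa> * (P * (W + s\<^sup>2)))"
    proof -
      have "x * norm z \<le> x * (x + s)" using zz nn by (intro mult_left_mono) auto
      then show ?thesis using xx xs by (simp add: power2_eq_square algebra_simps)
    qed
    have "\<bar>\<rho> (a + z) - \<rho> a + Re (w0 a z) - \<Lambda> z\<bar> \<le>
      \<bar>\<rho> (a + z) - \<rho> a - (Re (ll a z) + Re (Q z z) + Re (L z z))\<bar> + \<bar>Re (Q z z - Q (\<pi> z) (\<pi> z))\<bar> + \<bar>Re (L z z - L (\<pi> z) (\<pi> z))\<bar>"
      by (simp add: w0_def \<Lambda>_def)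
    also have "\<dots> \<le> \<kappa> * (norm z)\<^sup>2 + 2 * (M * (x * norm z)) + 2 * (M * (x * norm z))"
    proof (intro add_mono)
      show "\<bar>\<rho> (a + z) - \<rho> a - (Re (ll a z) + Re (Q z z) + Re (L z z))\<bar> \<le> \<kappa> * (norm z)\<^sup>2"
        using a z \<delta> by (intro tay) auto
      show "\<bar>Re (Q z z - Q (\<pi> z) (\<pi> z))\<bar> \<le> 2 * (M * (x * norm z))"
        unfolding x_def mult.assoc[of 2, symmetric] by (rule order_trans[OF abs_Re_le_cmod Q_diff])
      show "\<bar>Re (L z z - L (\<pi> z) (\<pi> z))\<bar> \<le> 2 * (M * (x * norm z))"
        unfolding x_def mult.assoc[of 2, symmetric] by (rule order_trans[OF abs_Re_le_cmod L_diff])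
    qed
    also have "\<dots> \<le> \<kappa> * (2 * (1 * (P * (W + s\<^sup>2))) + (W + s\<^sup>2)) + 4 * (M * (3 * (\<kappa> * (P * (W + s\<^sup>2)))))"
    proof -
      have "\<kappa> * (P * (W + s\<^sup>2)) \<le> 1 * (P * (W + s\<^sup>2))" using \<kappa> P nn by (intro mult_right_mono mult_nonneg_nonneg) auto
      then have "(norm z)\<^sup>2 \<le> 2 * (1 * (P * (W + s\<^sup>2))) + (W + s\<^sup>2)" unfolding zz(2) using xx nn by linarith
      then have "\<kappa> * (norm z)\<^sup>2 \<le> \<kappa> * (2 * (1 * (P * (W + s\<^sup>2))) + (W + s\<^sup>2))" using \<kappa> by (intro mult_left_mono) auto
      moreover have "M * (x * norm z) \<le> M * (3 * (\<kappa> * (P * (W + s\<^sup>2))))" using xz M by (intro mult_left_mono) auto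
      ultimately show ?thesis by linarith
    qed
    also have "\<dots> = \<kappa> * T * (W + s\<^sup>2)" by (simp add: T_def algebra_simps)
    also have "\<dots> \<le> \<eta> * (W + s\<^sup>2)" using \<kappa> nn by (intro mult_right_mono) auto
    finally show ?thesis by (simp add: W_def s_def)
  qed
  then show ?thesis using \<delta>(1) by blast
qed

end

section \<open>Scaling and Cayley transform of the perturbed paraboloid\<close>

definition squeeze_pair :: "'h::complex_normed_vector set \<Rightarrow> real \<Rightarrow> 'h \<Rightarrow> ('h \<Rightarrow> 'h) \<Rightarrow> ('h \<Rightarrow> 'h) \<Rightarrow> bool"
  where "squeeze_pair W r a \<Psi> \<Theta> \<longleftrightarrow> cdiff_on \<Psi> W \<and> (\<forall>z\<in>W. norm (\<Psi> z) < 1) \<and> \<Psi> a = 0 \<and>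
    cdiff_on \<Theta> (ball 0 r) \<and> (\<forall>y\<in>ball 0 r. \<Theta> y \<in> W \<and> \<Psi> (\<Theta> y) = y) \<and>
    (\<forall>z\<in>W. norm (\<Psi> z) < r \<longrightarrow> \<Theta> (\<Psi> z) = z)"

context local_model
begin

text \<open>The model ball belongs to a norm other than the given one; \<open>S\<close> carries it
  linearly to the round ball. \<open>L\<close> supplies positive definiteness on the tangential part
  only, hence the extra square of the normal component.\<close>

lemma model_isometry:
  obtains S :: "'h \<Rightarrow> 'h" where "clinear S" "bij S" "\<And>u. (norm (S u))\<^sup>2 = (cmod (cinner e u))\<^sup>2 + \<Lambda> u"
proof -
  define L' where "L' = (\<lambda>v w. cinner v e * cinner e w + L (\<pi> v) (\<pi> w))"
  have L'v: "Re (L' u u) = (cmod (cinner e u))\<^sup>2 + \<Lambda> u" for u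
    using cinner_commute[of u e] by (simp add: L'_def \<Lambda>_def cmod_power2) (simp add: power2_eq_square)
  have "hermitian_form L'" unfolding hermitian_form_def
  proof (intro conjI allI)
    show "clinear (L' v)" for v
      by (rule clinearI) (simp_all add: L'_def clinear_add[OF clinear_\<pi>] clinear_scaleC[OF clinear_\<pi>]
          clinear_add[OF clinear_L] clinear_scaleC[OF clinear_L] cinner_add_right cinner_scaleC_right algebra_simps)
    show "L' v w = cnj (L' w v)" for v w
    proof -
      have "L (\<pi> v) (\<pi> w) = cnj (L (\<pi> w) (\<pi> v))" using L unfolding hermitian_form_def by blast
      then show ?thesis
        using cinner_commute[of v e] cinner_commute[of e w] by (simp add: L'_def mult.commute)
    qed
    have "cmod (L' v w) \<le> (1 + M) * norm v * norm w" for v w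
    proof -
      have "cmod (L' v w) \<le> cmod (cinner v e) * cmod (cinner e w) + cmod (L (\<pi> v) (\<pi> w))"
        using norm_triangle_ineq[of "cinner v e * cinner e w"] by (simp add: L'_def norm_mult)
      also have "\<dots> \<le> norm v * norm w + M * norm v * norm w"
      proof (intro add_mono mult_mono norm_comp norm_ge_zero)
        show "cmod (cinner v e) \<le> norm v" using Cauchy_Schwarz_cinner[of v e] norm_e by simp
        show "cmod (L (\<pi> v) (\<pi> w)) \<le> M * norm v * norm w"
          using M by (intro order_trans[OF L_le] mult_mono mult_left_mono norm_\<pi>) auto
      qed
      finally show ?thesis by (simp add: algebra_simps)
    qed
    then show "\<exists>K. \<forall>v w. cmod (L' v w) \<le> K * norm v * norm w" by blast
  qed
  moreover have "min 1 C * (norm u)\<^sup>2 \<le> Re (L' u u)" for u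
  proof -
    have "min 1 C * (cmod (cinner e u))\<^sup>2 \<le> 1 * (cmod (cinner e u))\<^sup>2" by (intro mult_right_mono) auto
    moreover have "min 1 C * (norm (\<pi> u))\<^sup>2 \<le> C * (norm (\<pi> u))\<^sup>2" by (intro mult_right_mono) auto
    ultimately show ?thesis unfolding L'v norm_decomp[of u] distrib_left using \<Lambda>_ge[of u] by linarith
  qed
  moreover have "min 1 C > 0" using C by simp
  ultimately obtain S :: "'h \<Rightarrow> 'h" where "clinear S" "bij S" "\<And>u. (norm (S u))\<^sup>2 = Re (L' u u)"
    using form_sqrt by metis
  then show thesis using that L'v by simp
qed

text \<open>The scaling of the model domain \<open>Re w + t > \<Lambda>\<close> followed by the Cayley transform
  \<open>(w, z) \<mapsto> (w, 2 \<surd>t z) / (2 t + w)\<close> onto the unit ball of the norm \<open>\<bar>\<langle>e, u\<rangle>\<bar>\<^sup>2 + \<Lambda> u\<close>,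
  and its inverse.\<close>

definition cayley :: "'h \<Rightarrow> real \<Rightarrow> 'h \<Rightarrow> 'h"
  where "cayley a t z = inverse (of_real (2 * t) + w0 a (z - a)) *\<^sub>C
    (w0 a (z - a) *\<^sub>C e + of_real (2 * sqrt t) *\<^sub>C \<pi> (z - a))"

definition cayley_tan :: "real \<Rightarrow> 'h \<Rightarrow> 'h"
  where "cayley_tan t u = (of_real (sqrt t) * inverse (1 - cinner e u)) *\<^sub>C \<pi> u"

definition cayley_w :: "real \<Rightarrow> 'h \<Rightarrow> complex"
  where "cayley_w t u = of_real (2 * t) * cinner e u * inverse (1 - cinner e u)"

definition cayley_inv :: "'h \<Rightarrow> real \<Rightarrow> 'h \<Rightarrow> 'h"
  where "cayley_inv a t u = a + ((- inverse (ll a e) * (cayley_w t u + ll a (cayley_tan t u) +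
    Q (cayley_tan t u) (cayley_tan t u))) *\<^sub>C e + cayley_tan t u)"

lemma cayley_comps:
  "cinner e (cayley a t z) = inverse (of_real (2 * t) + w0 a (z - a)) * w0 a (z - a)"
  "\<pi> (cayley a t z) = (inverse (of_real (2 * t) + w0 a (z - a)) * of_real (2 * sqrt t)) *\<^sub>C \<pi> (z - a)"
proof -
  show 1: "cinner e (cayley a t z) = inverse (of_real (2 * t) + w0 a (z - a)) * w0 a (z - a)"
    by (simp add: cayley_def cinner_scaleC_right cinner_add_right e_e)
  show "\<pi> (cayley a t z) = (inverse (of_real (2 * t) + w0 a (z - a)) * of_real (2 * sqrt t)) *\<^sub>C \<pi> (z - a)"
    unfolding \<pi>_def[of "cayley a t z"] 1 by (simp add: cayley_def scaleC_add_right scaleC_scaleC)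
qed

lemma \<pi>_cayley_tan [simp]: "\<pi> (cayley_tan t u) = cayley_tan t u" "cinner e (cayley_tan t u) = 0"
  by (simp_all add: cayley_tan_def clinear_scaleC[OF clinear_\<pi>] \<pi>_id cinner_scaleC_right)

text \<open>\<open>Q\<close> sees only the tangential component. Once that is known, the equation
  for \<open>w0 a\<close> is linear in the normal component and solvable as soon as
  \<open>ll a e\<close> is nonzero.\<close>

lemma cayley_inv_comps:
  assumes "ll a e \<noteq> 0"
  shows "\<pi> (cayley_inv a t u - a) = cayley_tan t u" "w0 a (cayley_inv a t u - a) = cayley_w t u"
    "cinner e (cayley_inv a t u - a) = - inverse (ll a e) * (cayley_w t u + ll a (cayley_tan t u) +
    Q (cayley_tan t u) (cayley_tan t u))"
proof -
  have pe: "\<pi> e = 0" by (simp add: \<pi>_def e_e)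
  define m where "m = - inverse (ll a e) * (cayley_w t u + ll a (cayley_tan t u) + Q (cayley_tan t u) (cayley_tan t u))"
  have ci: "cayley_inv a t u - a = m *\<^sub>C e + cayley_tan t u"
    by (simp only: cayley_inv_def m_def add_diff_cancel_left')
  have mm: "m * ll a e = - (cayley_w t u + ll a (cayley_tan t u) + Q (cayley_tan t u) (cayley_tan t u))"
    using assms by (simp add: m_def field_simps)
  show 1: "\<pi> (cayley_inv a t u - a) = cayley_tan t u"
    by (simp add: ci clinear_add[OF clinear_\<pi>] clinear_scaleC[OF clinear_\<pi>] pe)
  show "w0 a (cayley_inv a t u - a) = cayley_w t u"
    unfolding w0_def 1 by (simp add: ci clinear_add[OF clinear_ll] clinear_scaleC[OF clinear_ll] mm)
  show "cinner e (cayley_inv a t u - a) = - inverse (ll a e) * (cayley_w t u + ll a (cayley_tan t u) +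
    Q (cayley_tan t u) (cayley_tan t u))"
    unfolding m_def[symmetric] by (simp add: ci cinner_add_right cinner_scaleC_right e_e)
qed

lemma cayley_cayley_inv:
  assumes "ll a e \<noteq> 0" "t > 0" "cinner e u \<noteq> 1"
  shows "cayley a t (cayley_inv a t u) = u"
proof -
  define k where "k = 1 - cinner e u"
  have k: "k \<noteq> 0" using assms(3) by (simp add: k_def)
  have tt: "complex_of_real t \<noteq> 0" using assms(2) by simp
  have cu: "cinner e u = 1 - k" by (simp add: k_def)
  have w: "of_real (2 * t) + cayley_w t u = of_real (2 * t) * inverse k"
    using k by (simp add: cayley_w_def cu field_simps)
  have st: "complex_of_real (sqrt t) * of_real (sqrt t) = of_real t"
    using assms(2) by (simp flip: of_real_mult)
  have c1: "cinner e (cayley a t (cayley_inv a t u)) = cinner e u"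
    unfolding cayley_comps cayley_inv_comps[OF assms(1)] w using k tt
    by (simp add: cayley_w_def cu field_simps)
  have "\<pi> (cayley a t (cayley_inv a t u)) = \<pi> u"
  proof -
    have "inverse (of_real (2 * t) * inverse k) * of_real (2 * sqrt t) * (of_real (sqrt t) * inverse (1 - cinner e u)) = 1"
      using k tt st by (simp add: k_def[symmetric] field_simps)
    then show ?thesis
      unfolding cayley_comps cayley_inv_comps[OF assms(1)] w by (simp add: cayley_tan_def scaleC_scaleC)
  qed
  then show ?thesis using c1 decomp by metis
qed

lemma cayley_inv_cayley:
  assumes "ll a e \<noteq> 0" "t > 0" "of_real (2 * t) + w0 a (z - a) \<noteq> 0"
  shows "cayley_inv a t (cayley a t z) = z"
proof -
  define k where "k = of_real (2 * t) + w0 a (z - a)"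
  have k: "k \<noteq> 0" using assms(3) by (simp add: k_def)
  have tt: "complex_of_real t \<noteq> 0" using assms(2) by simp
  have w: "w0 a (z - a) = k - of_real (2 * t)" by (simp add: k_def)
  have st: "complex_of_real (sqrt t) * of_real (sqrt t) = of_real t"
    using assms(2) by (simp flip: of_real_mult)
  have k1: "1 - cinner e (cayley a t z) = of_real (2 * t) * inverse k"
    unfolding cayley_comps w using k by (simp add: field_simps)
  have ct: "cayley_tan t (cayley a t z) = \<pi> (z - a)"
  proof -
    have 1: "(of_real (sqrt t) * inverse (of_real (2 * t) * inverse k)) * (inverse k * of_real (2 * sqrt t)) = 1"
      using k tt st by (simp add: field_simps)
    show ?thesis unfolding cayley_tan_def k1 cayley_comps(2) k_def[symmetric] scaleC_scaleC 1 by simp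
  qed
  have cw: "cayley_w t (cayley a t z) = w0 a (z - a)"
    unfolding cayley_w_def k1 unfolding cayley_comps w using k tt by (simp add: field_simps)
  have c: "cinner e (cayley_inv a t (cayley a t z) - a) = cinner e (z - a)"
  proof -
    have "ll a (z - a) = cinner e (z - a) * ll a e + ll a (\<pi> (z - a))"
      using clinear_add[OF clinear_ll, of a "cinner e (z - a) *\<^sub>C e" "\<pi> (z - a)"]
      by (simp add: decomp clinear_scaleC[OF clinear_ll])
    then have "w0 a (z - a) + ll a (\<pi> (z - a)) + Q (\<pi> (z - a)) (\<pi> (z - a)) = - (ll a e * cinner e (z - a))"
      by (simp add: w0_def)
    then show ?thesis unfolding cayley_inv_comps[OF assms(1)] ct cw using assms(1) by simp
  qed
  have "cayley_inv a t (cayley a t z) - a = z - a"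
    using decomp[of "cayley_inv a t (cayley a t z) - a"] decomp[of "z - a"] c cayley_inv_comps(1)[OF assms(1)] ct by metis
  then show ?thesis by simp
qed

lemma \<Lambda>_scale: "\<Lambda> (c *\<^sub>C u) = (cmod c)\<^sup>2 * \<Lambda> u"
proof -
  have her: "\<And>v w. L v w = cnj (L w v)" using L unfolding hermitian_form_def by blast
  have "L (c *\<^sub>C v) (c *\<^sub>C v) = (cnj c * c) * L v v" for v
    using her[of "c *\<^sub>C v" v] her[of v v] clinear_scaleC[OF clinear_L, of "c *\<^sub>C v" c v] clinear_scaleC[OF clinear_L, of v c v]
    by simp
  then show ?thesis
    by (simp add: \<Lambda>_def clinear_scaleC[OF clinear_\<pi>] cmod_power2) (simp add: power2_eq_square)
qed

lemma \<Lambda>_\<pi>: "\<Lambda> (\<pi> u) = \<Lambda> u"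
  by (simp add: \<Lambda>_def \<pi>_id)

text \<open>With \<open>k = 2 t + w\<close> one has
  \<open>(cmod k)^2 = (cmod w)^2 + 4 t (t + Re w)\<close>. The sign of the right side matches the
  model domain \<open>\<Lambda> < t + Re w\<close> with the unit ball, and its size measures
  perturbations.\<close>

lemma norm_cayley_sq:
  assumes "t > 0" "of_real (2 * t) + w0 a (z - a) \<noteq> 0"
  shows "(cmod (cinner e (cayley a t z)))\<^sup>2 + \<Lambda> (cayley a t z) - 1 =
    4 * t * (\<Lambda> (z - a) - t - Re (w0 a (z - a))) / (cmod (of_real (2 * t) + w0 a (z - a)))\<^sup>2"
proof -
  define k where "k = of_real (2 * t) + w0 a (z - a)"
  have k: "(cmod k)\<^sup>2 > 0" using assms(2) by (simp add: k_def)
  have "\<Lambda> (cayley a t z) = \<Lambda> (\<pi> (cayley a t z))" by (simp add: \<Lambda>_\<pi>)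
  also have "\<dots> = (2 * sqrt t / cmod k)\<^sup>2 * \<Lambda> (z - a)"
    unfolding cayley_comps \<Lambda>_scale \<Lambda>_\<pi> k_def[symmetric] using assms(1) by (simp add: norm_mult norm_inverse norm_divide power_divide power_mult_distrib field_simps)
  also have "(2 * sqrt t / cmod k)\<^sup>2 = 4 * t / (cmod k)\<^sup>2"
    using assms(1) by (simp add: power_divide power_mult_distrib)
  finally have 1: "\<Lambda> (cayley a t z) = 4 * t / (cmod k)\<^sup>2 * \<Lambda> (z - a)" .
  have 2: "(cmod (cinner e (cayley a t z)))\<^sup>2 = (cmod (w0 a (z - a)))\<^sup>2 / (cmod k)\<^sup>2"
    unfolding cayley_comps k_def[symmetric] by (simp add: norm_mult norm_inverse power_mult_distrib divide_inverse power_inverse)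
  have 3: "(cmod k)\<^sup>2 = (cmod (w0 a (z - a)))\<^sup>2 + 4 * t * (t + Re (w0 a (z - a)))"
    unfolding cmod_power2 by (simp add: k_def power2_eq_square algebra_simps)
  have "(cmod (cinner e (cayley a t z)))\<^sup>2 + \<Lambda> (cayley a t z) - 1
    = ((cmod (w0 a (z - a)))\<^sup>2 + 4 * t * \<Lambda> (z - a) - (cmod k)\<^sup>2) / (cmod k)\<^sup>2"
    unfolding 1 2 using k by (simp add: field_simps)
  also have "(cmod (w0 a (z - a)))\<^sup>2 + 4 * t * \<Lambda> (z - a) - (cmod k)\<^sup>2 = 4 * t * (\<Lambda> (z - a) - t - Re (w0 a (z - a)))"
    unfolding 3 by (simp add: algebra_simps)
  finally show ?thesis by (simp add: k_def)
qed

text \<open>The perturbation raises the numerator by at most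
  \<open>4 * t * \<eta> * (W + s)\<close>. Since \<open>s\<close> is of order at most
  \<open>t + W\<close> and the denominator is at least \<open>((t + W) / 10)^2\<close>, the excess
  is a multiple of \<open>\<eta>\<close> independent of \<open>t\<close>; the 400 is
  \<open>4 * 10^2\<close>.\<close>

lemma cayley_outer:
  assumes t: "t > 0" and \<eta>: "0 < \<eta>" "\<eta> \<le> 1 / 8" "\<eta> \<le> C / 2"
    and lt: "\<Lambda> z < t + Re w + \<eta> * (cmod w + (norm (\<pi> z))\<^sup>2)"
  shows "of_real (2 * t) + w \<noteq> 0"
    "4 * t * (\<Lambda> z - t - Re w) / (cmod (of_real (2 * t) + w))\<^sup>2 \<le> 400 * \<eta> * (1 + 4 / C)"
proof -
  define W where "W = cmod w"
  define s where "s = (norm (\<pi> z))\<^sup>2"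
  define k where "k = cmod (of_real (2 * t) + w)"
  have W: "W \<ge> 0" "s \<ge> 0" by (simp_all add: W_def s_def)
  have Cs: "C * s \<le> \<Lambda> z" using \<Lambda>_ge[of z] by (simp add: s_def)
  have "\<eta> * s \<le> C / 2 * s" using \<eta> W by (intro mult_right_mono) auto
  then have es: "\<eta> * s \<le> \<Lambda> z / 2" using Cs by simp
  have lt': "\<Lambda> z < t + Re w + \<eta> * W + \<eta> * s" using lt by (simp add: W_def s_def algebra_simps)
  have eW: "\<eta> * W \<le> 1 / 8 * W" using \<eta> W by (intro mult_right_mono) auto
  have RW: "Re w \<le> W" unfolding W_def by (rule complex_Re_le_cmod)
  have \<Lambda>0: "\<Lambda> z \<ge> 0" using Cs C W by (meson mult_nonneg_nonneg less_imp_le order_trans)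
  have \<Lambda>1: "\<Lambda> z \<le> 2 * (t + 2 * W)" using lt' es eW RW W(1) by argo
  have Rew: "Re w \<ge> - t - 1 / 8 * W" using lt' es eW \<Lambda>0 by linarith
  \<comment> \<open>For \<open>W\<close> large the term \<open>2 * t\<close> cannot cancel
    \<open>w\<close>; otherwise \<open>Re w >= - t - W / 8\<close> keeps the real part of the
    denominator above \<open>t / 2\<close>.\<close>
  have k: "(t + W) / 10 \<le> k"
  proof (cases "W \<ge> 4 * t")
    case True
    have "W \<le> k + 2 * t" using norm_triangle_ineq4[of "of_real (2 * t) + w" "of_real (2 * t)"] t
      by (simp add: k_def W_def norm_mult)
    then show ?thesis using True t by simp
  next
    case False
    have "2 * t + Re w \<le> k" using complex_Re_le_cmod[of "of_real (2 * t) + w"] by (simp add: k_def)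
    then show ?thesis using False Rew t by simp
  qed
  have k0: "k > 0" using k t W by simp
  then show "of_real (2 * t) + w \<noteq> 0" by (auto simp: k_def)
  have "s \<le> \<Lambda> z / C" using Cs C by (simp add: pos_le_divide_eq mult.commute)
  also have "\<dots> \<le> 2 * (t + 2 * W) / C" using \<Lambda>1 C by (intro divide_right_mono) auto
  also have "\<dots> \<le> 4 / C * (t + W)" using C t W by (simp add: field_simps)
  finally have s1: "W + s \<le> (1 + 4 / C) * (t + W)" using t by (simp add: distrib_right)
  have "4 * t * (\<Lambda> z - t - Re w) \<le> 4 * t * (\<eta> * (W + s))"
    using lt' t by (intro mult_left_mono) (auto simp: distrib_left)
  also have "\<dots> \<le> 4 * (t + W) * (\<eta> * ((1 + 4 / C) * (t + W)))"
    using s1 \<eta> t W C by (intro mult_mono mult_left_mono mult_nonneg_nonneg) auto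
  also have "\<dots> = 400 * \<eta> * (1 + 4 / C) * ((t + W) / 10)\<^sup>2" by (simp add: power2_eq_square)
  also have "\<dots> \<le> 400 * \<eta> * (1 + 4 / C) * k\<^sup>2"
    using k t W \<eta> C by (intro mult_left_mono power_mono mult_nonneg_nonneg add_nonneg_nonneg) auto
  finally show "4 * t * (\<Lambda> z - t - Re w) / (cmod (of_real (2 * t) + w))\<^sup>2 \<le> 400 * \<eta> * (1 + 4 / C)"
    using k0 by (simp add: k_def pos_divide_le_eq)
qed

text \<open>On the model ball of radius \<open>1 - \<epsilon>\<close> the defining inequality holds
  with margin at least \<open>t * \<epsilon> / 4\<close>, while the weighted error is
  \<open>\<eta>\<close> times a multiple of \<open>t\<close>. The size bounds show that preimages
  approach the centre as \<open>t\<close> tends to \<open>0\<close>.\<close>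

lemma cayley_inner:
  assumes t: "t > 0" and \<epsilon>: "0 < \<epsilon>" "\<epsilon> < 1" and u: "(cmod (cinner e u))\<^sup>2 + \<Lambda> u < (1 - \<epsilon>)\<^sup>2"
    and \<eta>: "\<eta> > 0" "\<eta> * (2 / \<epsilon> + 1 / (C * \<epsilon>\<^sup>2)) < \<epsilon> / 4"
  shows "cinner e u \<noteq> 1" "cmod (cayley_w t u) \<le> 2 * t / \<epsilon>" "C * (norm (cayley_tan t u))\<^sup>2 \<le> t / \<epsilon>\<^sup>2"
    "- t - Re (cayley_w t u) + \<Lambda> (cayley_tan t u) + \<eta> * (cmod (cayley_w t u) + (norm (cayley_tan t u))\<^sup>2) < 0"
proof -
  define x where "x = cinner e u"
  have \<Lambda>0: "\<Lambda> u \<ge> 0" using \<Lambda>_ge[of u] C by (meson mult_nonneg_nonneg less_imp_le order_trans zero_le_power2)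
  have "(cmod x)\<^sup>2 < (1 - \<epsilon>)\<^sup>2" using u \<Lambda>0 by (simp add: x_def)
  then have x: "cmod x < 1 - \<epsilon>" by (rule power_less_imp_less_base) (use \<epsilon> in simp)
  define k where "k = cmod (1 - x)"
  have "1 - cmod x \<le> k" "k \<le> 1 + cmod x"
    unfolding k_def using norm_triangle_ineq2[of 1 x] norm_triangle_ineq4[of 1 x] by (simp_all only: norm_one)
  then have k: "k \<ge> \<epsilon>" "k \<le> 2" using x \<epsilon> by linarith+
  have k0: "k > 0" using k \<epsilon> by simp
  show "cinner e u \<noteq> 1" using k0 by (auto simp: k_def x_def)
  have ik: "1 / k \<le> 1 / \<epsilon>" using k \<epsilon> by (simp add: frac_le)
  have ik2: "1 / k\<^sup>2 \<le> 1 / \<epsilon>\<^sup>2" using k \<epsilon> by (simp add: frac_le power_mono)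
  have "cmod (cayley_w t u) = 2 * t * cmod x * (1 / k)"
    using t by (simp add: cayley_w_def x_def k_def norm_mult norm_inverse divide_inverse)
  also have "\<dots> \<le> 2 * t * 1 * (1 / \<epsilon>)" using x \<epsilon> t ik k0 by (intro mult_mono) auto
  finally show w: "cmod (cayley_w t u) \<le> 2 * t / \<epsilon>" by simp
  have \<Lambda>t: "\<Lambda> (cayley_tan t u) = t / k\<^sup>2 * \<Lambda> u"
    using t unfolding cayley_tan_def \<Lambda>_scale \<Lambda>_\<pi>
    by (simp add: x_def[symmetric] k_def[symmetric] norm_mult norm_inverse power_mult_distrib divide_inverse power_inverse)
  have u1: "\<Lambda> u \<le> 1"
  proof -
    have "\<Lambda> u < (1 - \<epsilon>)\<^sup>2" using u by (smt (verit) zero_le_power2)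
    also have "\<dots> \<le> 1" using \<epsilon> by (intro power_le_one) auto
    finally show ?thesis by simp
  qed
  have "C * (norm (cayley_tan t u))\<^sup>2 \<le> \<Lambda> (cayley_tan t u)" using \<Lambda>_ge[of "cayley_tan t u"] by simp
  also have "\<dots> = t * (1 / k\<^sup>2) * \<Lambda> u" by (simp add: \<Lambda>t)
  also have "\<dots> \<le> t * (1 / \<epsilon>\<^sup>2) * 1" using t ik2 u1 \<Lambda>0 by (intro mult_mono) auto
  finally show s: "C * (norm (cayley_tan t u))\<^sup>2 \<le> t / \<epsilon>\<^sup>2" by simp
  have ksq: "k\<^sup>2 = 1 - 2 * Re x + (cmod x)\<^sup>2"
    unfolding k_def cmod_power2 by (simp add: power2_eq_square algebra_simps)
  have Rw: "Re (cayley_w t u) = 2 * t * ((Re x - (cmod x)\<^sup>2) / k\<^sup>2)"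
  proof -
    have "x * inverse (1 - x) = x * cnj (1 - x) / of_real (k\<^sup>2)"
      using complex_div_cnj[of x "1 - x"] by (simp add: k_def divide_inverse)
    then have "Re (x * inverse (1 - x)) = Re (x * cnj (1 - x)) / k\<^sup>2" by (simp only: Re_divide_of_real)
    also have "Re (x * cnj (1 - x)) = Re x - (cmod x)\<^sup>2"
      unfolding cmod_power2 by (simp add: power2_eq_square algebra_simps)
    finally show ?thesis by (simp add: cayley_w_def x_def[symmetric] mult.assoc)
  qed
  have gap: "- t - Re (cayley_w t u) + \<Lambda> (cayley_tan t u) = - (t * ((1 - ((cmod x)\<^sup>2 + \<Lambda> u)) / k\<^sup>2))"
  proof -
    have "- t - Re (cayley_w t u) + \<Lambda> (cayley_tan t u) = (- (t * k\<^sup>2) - 2 * t * (Re x - (cmod x)\<^sup>2) + t * \<Lambda> u) / k\<^sup>2"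
      unfolding Rw \<Lambda>t using k0 by (simp add: field_simps)
    also have "- (t * k\<^sup>2) - 2 * t * (Re x - (cmod x)\<^sup>2) + t * \<Lambda> u = - (t * (1 - ((cmod x)\<^sup>2 + \<Lambda> u)))"
      by (simp add: ksq algebra_simps)
    finally show ?thesis by simp
  qed
  have "\<epsilon> / 4 \<le> (1 - ((cmod x)\<^sup>2 + \<Lambda> u)) / k\<^sup>2"
  proof -
    have "(1 - \<epsilon>)\<^sup>2 \<le> 1 - \<epsilon>" using \<epsilon> by (simp add: power2_eq_square mult_left_le)
    then have "\<epsilon> \<le> 1 - ((cmod x)\<^sup>2 + \<Lambda> u)" using u by (simp add: x_def)
    moreover have "k\<^sup>2 \<le> 2\<^sup>2" using k k0 by (intro power_mono) auto
    ultimately show ?thesis using \<epsilon> k0 by (intro frac_le) auto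
  qed
  then have "t * (\<epsilon> / 4) \<le> t * ((1 - ((cmod x)\<^sup>2 + \<Lambda> u)) / k\<^sup>2)" using t by (intro mult_left_mono) auto
  moreover have "\<eta> * (cmod (cayley_w t u) + (norm (cayley_tan t u))\<^sup>2) < t * (\<epsilon> / 4)"
  proof -
    have "(norm (cayley_tan t u))\<^sup>2 \<le> t / (C * \<epsilon>\<^sup>2)" using s C \<epsilon> by (simp add: field_simps)
    then have "cmod (cayley_w t u) + (norm (cayley_tan t u))\<^sup>2 \<le> t * (2 / \<epsilon> + 1 / (C * \<epsilon>\<^sup>2))"
      using w by (simp add: distrib_left mult.commute)
    then have "\<eta> * (cmod (cayley_w t u) + (norm (cayley_tan t u))\<^sup>2) \<le> \<eta> * (t * (2 / \<epsilon> + 1 / (C * \<epsilon>\<^sup>2)))"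
      using \<eta> by (intro mult_left_mono) auto
    also have "\<dots> = t * (\<eta> * (2 / \<epsilon> + 1 / (C * \<epsilon>\<^sup>2)))" by simp
    also have "\<dots> < t * (\<epsilon> / 4)" using \<eta>(2) t by (intro mult_strict_left_mono) auto
    finally show ?thesis .
  qed
  ultimately show "- t - Re (cayley_w t u) + \<Lambda> (cayley_tan t u) + \<eta> * (cmod (cayley_w t u) + (norm (cayley_tan t u))\<^sup>2) < 0"
    unfolding gap by linarith
qed

lemma cdiff_on_cayley:
  assumes "\<And>z. z \<in> X \<Longrightarrow> of_real (2 * t) + w0 a (z - a) \<noteq> 0"
  shows "cdiff_on (cayley a t) X"
  unfolding cayley_def[abs_def] w0_def using assms unfolding w0_def
  by (intro cdiff_on_scaleC cdiff_on_inverse cdiff_on_add cdiff_on_const cdiff_on_minus cdiff_on_ll cdiff_on_Q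
      cdiff_on_\<pi> cdiff_on_diff cdiff_on_id)

lemma cdiff_on_cayley_inv:
  assumes "\<And>u. u \<in> X \<Longrightarrow> cinner e u \<noteq> 1"
  shows "cdiff_on (cayley_inv a t) X"
proof -
  have i: "cdiff_on (\<lambda>u. inverse (1 - cinner e u)) X" using assms
    by (intro cdiff_on_inverse cdiff_on_diff cdiff_on_const cdiff_on_cinner cdiff_on_id) auto
  have ct: "cdiff_on (cayley_tan t) X" unfolding cayley_tan_def[abs_def]
    by (intro cdiff_on_scaleC cdiff_on_mult cdiff_on_const i cdiff_on_\<pi> cdiff_on_id)
  have cw: "cdiff_on (cayley_w t) X" unfolding cayley_w_def[abs_def]
    by (intro cdiff_on_mult cdiff_on_const cdiff_on_cinner cdiff_on_id i)
  show ?thesis unfolding cayley_inv_def[abs_def]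
    by (intro cdiff_on_add cdiff_on_const cdiff_on_scaleC cdiff_on_mult ct cw cdiff_on_ll cdiff_on_Q)
qed

lemma model_isometry_bounded:
  assumes S: "clinear S" "bij S" "\<And>u. (norm (S u))\<^sup>2 = (cmod (cinner e u))\<^sup>2 + \<Lambda> u"
  shows "bounded_linear S" "bounded_linear (inv S)"
proof -
  have "norm (S u) \<le> sqrt (1 + M) * norm u" for u
  proof (rule power2_le_imp_le)
    have "\<Lambda> u \<le> cmod (L (\<pi> u) (\<pi> u))" unfolding \<Lambda>_def by (rule complex_Re_le_cmod)
    also have "\<dots> \<le> M * norm u * norm u" using M by (intro order_trans[OF L_le] mult_mono mult_left_mono norm_\<pi>) auto
    finally have "\<Lambda> u \<le> M * (norm u)\<^sup>2" by (simp add: power2_eq_square mult.assoc)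
    moreover have "(cmod (cinner e u))\<^sup>2 \<le> (norm u)\<^sup>2" by (intro power_mono norm_comp) simp
    moreover have "(sqrt (1 + M) * norm u)\<^sup>2 = (norm u)\<^sup>2 + M * (norm u)\<^sup>2"
      using M by (simp add: power_mult_distrib algebra_simps)
    ultimately show "(norm (S u))\<^sup>2 \<le> (sqrt (1 + M) * norm u)\<^sup>2" unfolding S(3) by linarith
  qed (use M in simp)
  then show "bounded_linear S" by (rule bounded_linear_of_clinear[OF S(1)])
  have m: "min 1 C > 0" using C by simp
  have "norm u \<le> 1 / sqrt (min 1 C) * norm (S u)" for u
  proof (rule power2_le_imp_le)
    have "min 1 C * (cmod (cinner e u))\<^sup>2 \<le> 1 * (cmod (cinner e u))\<^sup>2" by (intro mult_right_mono) auto
    moreover have "min 1 C * (norm (\<pi> u))\<^sup>2 \<le> C * (norm (\<pi> u))\<^sup>2" by (intro mult_right_mono) auto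
    ultimately have "min 1 C * (norm u)\<^sup>2 \<le> (norm (S u))\<^sup>2"
      unfolding S(3) norm_decomp[of u] distrib_left using \<Lambda>_ge[of u] by linarith
    then have "(norm u)\<^sup>2 \<le> (norm (S u))\<^sup>2 / min 1 C" using m by (simp only: pos_le_divide_eq mult.commute)
    also have "\<dots> = (1 / sqrt (min 1 C) * norm (S u))\<^sup>2" using m by (simp add: power_divide power_mult_distrib)
    finally show "(norm u)\<^sup>2 \<le> (1 / sqrt (min 1 C) * norm (S u))\<^sup>2" .
  qed (use m in simp)
  from this[of "inv S _"] have "norm (inv S v) \<le> 1 / sqrt (min 1 C) * norm v" for v
    by (simp add: surj_f_inv_f[OF bij_is_surj[OF S(2)]])
  then show "bounded_linear (inv S)" by (rule bounded_linear_of_clinear[OF clinear_inv[OF S(1,2)]])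
qed

text \<open>The order of choices matters: \<open>\<epsilon>\<close> determines
  \<open>\<eta>\<close>, which determines the neighbourhood \<open>d\<close>; only then is
  \<open>a\<close> taken so close to \<open>p\<close> that \<open>t = - \<rho> a\<close> is small
  and the preimage of the ball lies within \<open>d\<close> of \<open>p\<close>.\<close>

lemma squeeze_maps:
  assumes \<epsilon>: "0 < \<epsilon>" "\<epsilon> < 1"
  shows "\<exists>d>0. \<exists>\<delta>>0. \<delta> \<le> d \<and> (\<forall>a\<in>\<Omega>. norm (a - p) < \<delta> \<longrightarrow> (\<exists>\<Psi> \<Theta>. squeeze_pair (\<Omega> \<inter> ball p d) (1 - \<epsilon>) a \<Psi> \<Theta>))"
proof -
  obtain S :: "'h \<Rightarrow> 'h" where S: "clinear S" "bij S" "\<And>u. (norm (S u))\<^sup>2 = (cmod (cinner e u))\<^sup>2 + \<Lambda> u"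
    by (rule model_isometry) blast
  note blS = model_isometry_bounded[OF S]
  have SS: "S (inv S x) = x" "inv S (S x) = x" for x
    using S(2) by (simp_all add: bij_is_surj surj_f_inv_f bij_is_inj)
  define \<epsilon>1 where "\<epsilon>1 = \<epsilon> / 2"
  \<comment> \<open>Dividing by \<open>\<mu>\<close> absorbs the overshoot of the image, as
    \<open>1 + \<epsilon> < \<mu>^2\<close>; the covered ball shrinks, but
    \<open>\<mu> * (1 - \<epsilon>) <= 1 - \<epsilon>1\<close> is still within reach.\<close>
  define \<mu> where "\<mu> = 1 + \<epsilon> / 2"
  have \<epsilon>1: "0 < \<epsilon>1" "\<epsilon>1 < 1" and \<mu>: "\<mu> > 0" using \<epsilon> by (simp_all add: \<epsilon>1_def \<mu>_def)
  have \<mu>1: "\<mu> * (1 - \<epsilon>) \<le> 1 - \<epsilon>1" "1 + \<epsilon> < \<mu>\<^sup>2"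
    using \<epsilon> by (simp_all add: \<mu>_def \<epsilon>1_def power2_eq_square algebra_simps)
  define X where "X = 2 / \<epsilon>1 + 1 / (C * \<epsilon>1\<^sup>2)"
  define Y where "Y = 400 * (1 + 4 / C)"
  have XY: "X > 0" "Y > 0" using \<epsilon>1 C by (simp_all add: X_def Y_def add_pos_pos)
  define \<eta> where "\<eta> = min (min (1 / 8) (C / 2)) (min (\<epsilon> / Y) (\<epsilon>1 / 8 / X))"
  have "\<eta> > 0" unfolding \<eta>_def using \<epsilon> \<epsilon>1 C XY by simp
  moreover have "\<eta> \<le> 1 / 8" "\<eta> \<le> C / 2" "\<eta> \<le> \<epsilon> / Y" "\<eta> \<le> \<epsilon>1 / 8 / X"
    unfolding \<eta>_def by (meson min.cobounded1 min.cobounded2 order_trans)+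
  ultimately have \<eta>: "\<eta> > 0" "\<eta> \<le> 1 / 8" "\<eta> \<le> C / 2" "\<eta> * Y \<le> \<epsilon>" "\<eta> * X \<le> \<epsilon>1 / 8"
    using XY by (simp_all only: pos_le_divide_eq)
  have \<eta>X: "\<eta> * (2 / \<epsilon>1 + 1 / (C * \<epsilon>1\<^sup>2)) < \<epsilon>1 / 4" using \<eta>(5) \<epsilon>1 unfolding X_def by linarith
  have \<eta>Y: "400 * \<eta> * (1 + 4 / C) \<le> \<epsilon>" using \<eta>(4) unfolding Y_def by (simp only: ac_simps)
  obtain \<delta>s where \<delta>s: "\<delta>s > 0" and sw: "\<And>a z. norm (a - p) < \<delta>s \<Longrightarrow> norm z < \<delta>s \<Longrightarrow>
    \<bar>\<rho> (a + z) - \<rho> a + Re (w0 a z) - \<Lambda> z\<bar> \<le> \<eta> * (cmod (w0 a z) + (norm (\<pi> z))\<^sup>2)"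
    using sandwich[OF \<eta>(1)] by blast
  define d where "d = min d0 (\<delta>s / 2)"
  have d: "d > 0" "d \<le> d0" "d \<le> \<delta>s / 2" using d0 \<delta>s by (simp_all add: d_def)
  have "\<alpha> / 2 > 0" using \<alpha> by simp
  then obtain \<delta>1 where \<delta>1: "\<delta>1 > 0" and l1: "\<And>a z. norm (a - p) < \<delta>1 \<Longrightarrow> cmod (ll a z - ll p z) \<le> \<alpha> / 2 * norm z"
    using ll_near by blast
  define \<kappa> where "\<kappa> = 1 / (sqrt C * \<epsilon>1)"
  have \<kappa>: "\<kappa> > 0" using C \<epsilon>1 by (simp add: \<kappa>_def)
  \<comment> \<open>\<open>\<phi> t\<close> bounds the distance of the preimages from
    \<open>a\<close>; it is continuous and vanishes at \<open>0\<close>.\<close>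
  define \<phi> where "\<phi> = (\<lambda>t. 2 / \<alpha> * (2 * t / \<epsilon>1 + \<alpha> / 2 * (\<kappa> * sqrt t) + M * (\<kappa> * sqrt t)\<^sup>2) + \<kappa> * sqrt t)"
  have "isCont \<phi> 0" unfolding \<phi>_def using \<epsilon>1 \<alpha> by (intro continuous_intros) auto
  moreover have "d / 2 > 0" using d by simp
  ultimately obtain t0 where t0: "t0 > 0" "\<And>t. dist t 0 < t0 \<Longrightarrow> dist (\<phi> t) (\<phi> 0) < d / 2"
    unfolding continuous_at_eps_delta by metis
  obtain \<delta>2 where \<delta>2: "\<delta>2 > 0" "\<And>a. dist a p < \<delta>2 \<Longrightarrow> dist (\<rho> a) (\<rho> p) < t0"
    using cont_\<rho> t0(1) unfolding continuous_at_eps_delta by metis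
  define \<delta> where "\<delta> = min (d / 2) (min \<delta>1 \<delta>2)"
  have \<delta>: "\<delta> > 0" "\<delta> \<le> d / 2" "\<delta> \<le> \<delta>1" "\<delta> \<le> \<delta>2" using d \<delta>1 \<delta>2 by (simp_all add: \<delta>_def)
  have "\<exists>\<Psi> \<Theta>. squeeze_pair (\<Omega> \<inter> ball p d) (1 - \<epsilon>) a \<Psi> \<Theta>" if a: "a \<in> \<Omega>" "norm (a - p) < \<delta>" for a
  proof -
    define t where "t = - \<rho> a"
    have "a \<in> ball p d0" using a(2) \<delta> d by (simp add: dist_norm norm_minus_commute)
    then have t: "t > 0" using \<Omega>_iff a(1) by (simp add: t_def)
    have tt0: "t < t0" using \<delta>2(2)[of a] a(2) \<delta> by (simp add: dist_norm \<rho>_p t_def)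
    have lle: "cmod (ll a e) \<ge> \<alpha> / 2"
    proof -
      have "cmod (ll a e - of_real \<alpha>) \<le> \<alpha> / 2" using l1[of a e] a(2) \<delta> by (simp add: ll_p e_e norm_e)
      then show ?thesis using norm_triangle_ineq2[of "of_real \<alpha>" "ll a e"] \<alpha> by (simp add: norm_minus_commute)
    qed
    then have lle0: "ll a e \<noteq> 0" using \<alpha> by auto
    have as: "norm (a - p) < \<delta>s" using a(2) \<delta> d \<delta>s by linarith
    define \<Psi> where "\<Psi> = (\<lambda>z. S (of_real (1 / \<mu>) *\<^sub>C cayley a t z))"
    define \<Theta> where "\<Theta> = (\<lambda>y. cayley_inv a t (inv S (of_real \<mu> *\<^sub>C y)))"
    have outer: "of_real (2 * t) + w0 a (z - a) \<noteq> 0" "norm (S (cayley a t z)) < \<mu>" if z: "z \<in> \<Omega>" "z \<in> ball p d" for z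
    proof -
      have "\<rho> z < 0" using \<Omega>_iff[of z] z d by simp
      have "norm (z - a) < \<delta>s"
        using norm_triangle_ineq4[of "z - p" "a - p"] z(2) a(2) \<delta> d by (simp add: dist_norm norm_minus_commute)
      from sw[OF as this] have "\<bar>\<rho> z + t + Re (w0 a (z - a)) - \<Lambda> (z - a)\<bar> \<le> \<eta> * (cmod (w0 a (z - a)) + (norm (\<pi> (z - a)))\<^sup>2)"
        by (simp add: t_def)
      then have lt: "\<Lambda> (z - a) < t + Re (w0 a (z - a)) + \<eta> * (cmod (w0 a (z - a)) + (norm (\<pi> (z - a)))\<^sup>2)"
        using \<open>\<rho> z < 0\<close> by linarith
      note out = cayley_outer[OF t \<eta>(1-3) lt]
      show "of_real (2 * t) + w0 a (z - a) \<noteq> 0" by (rule out(1))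
      have "(norm (S (cayley a t z)))\<^sup>2 - 1 \<le> 400 * \<eta> * (1 + 4 / C)"
        unfolding S(3) norm_cayley_sq[OF t out(1)] by (rule out(2))
      then have "(norm (S (cayley a t z)))\<^sup>2 < \<mu>\<^sup>2" using \<eta>Y \<mu>1(2) by linarith
      then show "norm (S (cayley a t z)) < \<mu>" by (rule power_less_imp_less_base) (use \<mu> in simp)
    qed
    have S\<mu>: "S (of_real (1 / \<mu>) *\<^sub>C u) = of_real (1 / \<mu>) *\<^sub>C S u" for u by (rule clinear_scaleC[OF S(1)])
    have cd1: "cdiff_on \<Psi> (\<Omega> \<inter> ball p d)" unfolding \<Psi>_def
    proof (rule cdiff_on_compose[OF _ cdiff_on_bounded_clinear[OF S(1) blS(1), where S=UNIV]])
      show "cdiff_on (\<lambda>z. of_real (1 / \<mu>) *\<^sub>C cayley a t z) (\<Omega> \<inter> ball p d)"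
        using outer(1) by (intro cdiff_on_scaleC cdiff_on_const cdiff_on_cayley) auto
    qed simp
    have \<Psi>1: "norm (\<Psi> z) < 1" if "z \<in> \<Omega> \<inter> ball p d" for z
      using outer(2)[of z] that \<mu> unfolding \<Psi>_def S\<mu> by (simp add: norm_scaleC norm_divide)
    have w00: "w0 a 0 = 0" "\<pi> 0 = 0"
      by (simp_all add: w0_def clinear_zero[OF clinear_ll] clinear_zero[OF clinear_\<pi>] clinear_zero[OF Q(2)])
    have \<Psi>a: "\<Psi> a = 0" by (simp add: \<Psi>_def cayley_def w00 clinear_zero[OF S(1)])
    have inner: "cinner e (inv S (of_real \<mu> *\<^sub>C y)) \<noteq> 1" "\<Theta> y \<in> \<Omega>" "\<Theta> y \<in> ball p d" if y: "norm y < 1 - \<epsilon>" for y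
    proof -
      define u where "u = inv S (of_real \<mu> *\<^sub>C y)"
      have "norm (S u) < 1 - \<epsilon>1"
      proof -
        have "norm (S u) = \<mu> * norm y" using \<mu> by (simp add: u_def SS norm_scaleC)
        also have "\<dots> < \<mu> * (1 - \<epsilon>)" using y \<mu> by simp
        finally show ?thesis using \<mu>1 by simp
      qed
      then have "(norm (S u))\<^sup>2 < (1 - \<epsilon>1)\<^sup>2" by (intro power_strict_mono) auto
      then have uu: "(cmod (cinner e u))\<^sup>2 + \<Lambda> u < (1 - \<epsilon>1)\<^sup>2" by (simp only: S(3))
      note inn = cayley_inner[OF t \<epsilon>1 uu \<eta>(1) \<eta>X]
      show "cinner e (inv S (of_real \<mu> *\<^sub>C y)) \<noteq> 1" using inn(1) by (simp add: u_def)
      define z where "z = cayley_inv a t u - a"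
      note comps = cayley_inv_comps[OF lle0, of t u, folded z_def]
      define s where "s = norm (cayley_tan t u)"
      have s: "0 \<le> s" "s \<le> \<kappa> * sqrt t"
      proof -
        have "s\<^sup>2 \<le> t / (C * \<epsilon>1\<^sup>2)" using inn(3) C \<epsilon>1 by (simp add: s_def field_simps)
        also have "\<dots> = (\<kappa> * sqrt t)\<^sup>2" using C t by (simp add: \<kappa>_def power_divide power_mult_distrib)
        finally show "s \<le> \<kappa> * sqrt t" by (rule power2_le_imp_le) (use \<kappa> t in simp)
      qed (simp add: s_def)
      have lt: "cmod (ll a (cayley_tan t u)) \<le> \<alpha> / 2 * s"
        using l1[of a "cayley_tan t u"] a(2) \<delta> by (simp add: ll_p s_def)
      have Qt: "cmod (Q (cayley_tan t u) (cayley_tan t u)) \<le> M * s\<^sup>2"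
        using Q_le[of "cayley_tan t u" "cayley_tan t u"] by (simp add: s_def power2_eq_square mult.assoc)
      define b where "b = cayley_w t u + ll a (cayley_tan t u) + Q (cayley_tan t u) (cayley_tan t u)"
      have b: "cmod b \<le> 2 * t / \<epsilon>1 + \<alpha> / 2 * s + M * s\<^sup>2"
        unfolding b_def by (intro norm_triangle_le add_mono inn(2) lt Qt)
      have "cmod (cinner e z) = cmod b / cmod (ll a e)"
        unfolding comps(3) b_def[symmetric] by (simp add: norm_mult norm_inverse divide_inverse mult.commute)
      also have "\<dots> \<le> cmod b / (\<alpha> / 2)" using lle lle0 \<alpha> by (intro divide_left_mono) auto
      also have "\<dots> = 2 / \<alpha> * cmod b" by simp
      also have "\<dots> \<le> 2 / \<alpha> * (2 * t / \<epsilon>1 + \<alpha> / 2 * (\<kappa> * sqrt t) + M * (\<kappa> * sqrt t)\<^sup>2)"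
        using \<alpha> M s by (intro mult_left_mono order_trans[OF b] add_mono power_mono) auto
      finally have "norm z \<le> \<phi> t"
        using norm_le_sum[of z] s(2) unfolding comps(1) by (simp add: \<phi>_def s_def)
      moreover have "\<phi> 0 = 0" by (simp add: \<phi>_def)
      then have "\<phi> t < d / 2" using t0(2)[of t] tt0 t by (simp add: dist_real_def abs_less_iff)
      ultimately have nz: "norm z < d / 2" by linarith
      have az: "a + z = \<Theta> y" by (simp add: z_def \<Theta>_def u_def)
      have "norm (\<Theta> y - p) < d"
        using norm_triangle_ineq[of "a - p" z] nz a(2) \<delta> unfolding az[symmetric] by (simp add: algebra_simps)
      then show in_d: "\<Theta> y \<in> ball p d" by (simp add: dist_norm norm_minus_commute)
      have "norm z < \<delta>s" using nz d \<delta>s by linarith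
      from sw[OF as this] have "\<rho> (\<Theta> y) + t + Re (w0 a z) - \<Lambda> z \<le> \<eta> * (cmod (w0 a z) + (norm (\<pi> z))\<^sup>2)"
        by (simp add: az t_def abs_le_iff)
      moreover have "\<Lambda> z = \<Lambda> (cayley_tan t u)" using \<Lambda>_\<pi>[of z] comps(1) by simp
      ultimately have "\<rho> (\<Theta> y) < 0" using inn(4) unfolding comps(1,2) by linarith
      then show "\<Theta> y \<in> \<Omega>" using \<Omega>_iff[of "\<Theta> y"] in_d d by simp
    qed
    have cd2: "cdiff_on \<Theta> (ball 0 (1 - \<epsilon>))" unfolding \<Theta>_def
    proof (rule cdiff_on_compose[where f="cayley_inv a t" and T="{u. cinner e u \<noteq> 1}"])
      show "cdiff_on (\<lambda>y. inv S (of_real \<mu> *\<^sub>C y)) (ball 0 (1 - \<epsilon>))"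
        by (rule cdiff_on_compose[OF _ cdiff_on_bounded_clinear[OF clinear_inv[OF S(1,2)] blS(2), where S=UNIV]])
          (auto intro: cdiff_on_scaleC cdiff_on_const cdiff_on_id)
      show "cdiff_on (cayley_inv a t) {u. cinner e u \<noteq> 1}" by (rule cdiff_on_cayley_inv) simp
    qed (use inner(1) in simp)
    have \<Psi>\<Theta>: "\<Psi> (\<Theta> y) = y" if y: "norm y < 1 - \<epsilon>" for y
    proof -
      have "\<Psi> (\<Theta> y) = of_real (1 / \<mu>) *\<^sub>C S (inv S (of_real \<mu> *\<^sub>C y))"
        unfolding \<Psi>_def \<Theta>_def S\<mu> cayley_cayley_inv[OF lle0 t inner(1)[OF y]] ..
      then show ?thesis using \<mu> by (simp add: SS scaleC_scaleC)
    qed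
    have \<Theta>\<Psi>: "\<Theta> (\<Psi> z) = z" if z: "z \<in> \<Omega> \<inter> ball p d" for z
    proof -
      have "of_real \<mu> *\<^sub>C \<Psi> z = S (cayley a t z)" unfolding \<Psi>_def S\<mu> using \<mu> by (simp add: scaleC_scaleC)
      then show ?thesis using z by (simp add: \<Theta>_def SS cayley_inv_cayley[OF lle0 t outer(1)])
    qed
    have "squeeze_pair (\<Omega> \<inter> ball p d) (1 - \<epsilon>) a \<Psi> \<Theta>"
      unfolding squeeze_pair_def using cd1 cd2 \<Psi>1 \<Psi>a inner(2,3) \<Psi>\<Theta> \<Theta>\<Psi> by auto
    then show ?thesis by blast
  qed
  moreover have "\<delta> \<le> d" using \<delta> d by linarith
  ultimately show ?thesis using d(1) \<delta>(1) by blast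
qed

end

text \<open>Maclaurin's formula on the segment from \<open>a\<close> to \<open>a + z\<close>
  involves the second derivative at an intermediate point; continuity at \<open>p\<close> lets it be
  frozen there, with one \<open>\<delta>\<close> for all centres \<open>a\<close>.\<close>

lemma C2_on_second_order:
  fixes \<rho> :: "'a::real_normed_vector \<Rightarrow> real"
  assumes U: "open U" "p \<in> U" and C2: "C2_on \<rho> U"
  obtains D :: "'a \<Rightarrow> 'a \<Rightarrow>\<^sub>L real" and B :: "'a \<Rightarrow>\<^sub>L 'a \<Rightarrow>\<^sub>L real"
  where "\<And>x v. x \<in> U \<Longrightarrow> (diff_quot \<rho> x v \<longlongrightarrow> blinfun_apply (D x) v) (at 0)"
    "\<And>v w. dir_deriv2 \<rho> p v w = blinfun_apply (blinfun_apply B v) w" "isCont D p"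
    "\<And>\<epsilon>. \<epsilon> > 0 \<Longrightarrow> \<exists>\<delta>>0. \<forall>a z. norm (a - p) < \<delta> \<longrightarrow> norm z < \<delta> \<longrightarrow>
      \<bar>\<rho> (a + z) - \<rho> a - (blinfun_apply (D a) z + 1 / 2 * blinfun_apply (blinfun_apply B z) z)\<bar> \<le> \<epsilon> * (norm z)\<^sup>2"
proof -
  obtain D :: "'a \<Rightarrow> 'a \<Rightarrow>\<^sub>L real" where cD: "continuous_on U D"
    and D: "\<And>x v. x \<in> U \<Longrightarrow> (diff_quot \<rho> x v \<longlongrightarrow> blinfun_apply (D x) v) (at 0)"
    using C2 unfolding C2_on_def C1_on_def by blast
  obtain E :: "'a \<Rightarrow> 'a \<Rightarrow>\<^sub>L 'a \<Rightarrow>\<^sub>L real" where cE: "continuous_on U E"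
    and E: "\<And>x v w. x \<in> U \<Longrightarrow> (diff_quot (\<lambda>q. dir_deriv \<rho> q v) x w \<longlongrightarrow> blinfun_apply (blinfun_apply (E x) v) w) (at 0)"
    using C2 unfolding C2_on_def by blast
  have isE: "isCont E p" using cE U by (simp add: continuous_on_eq_continuous_at)
  show thesis
  proof (rule that[of D "E p"])
    show "(diff_quot \<rho> x v \<longlongrightarrow> blinfun_apply (D x) v) (at 0)" if "x \<in> U" for x v by (rule D[OF that])
    show "dir_deriv2 \<rho> p v w = blinfun_apply (blinfun_apply (E p) v) w" for v w
      unfolding dir_deriv2_def by (rule dir_deriv_eq[OF E[OF U(2)]])
    show "isCont D p" using cD U by (simp add: continuous_on_eq_continuous_at)
    fix \<epsilon> :: real assume \<epsilon>: "\<epsilon> > 0"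
    obtain d1 where d1: "d1 > 0" "\<And>x. dist x p < d1 \<Longrightarrow> dist (E x) (E p) < \<epsilon>"
      using isE \<epsilon> unfolding continuous_at_eps_delta by metis
    obtain d2 where d2: "d2 > 0" "ball p d2 \<subseteq> U" using U open_contains_ball by blast
    define \<delta> where "\<delta> = min d1 d2 / 2"
    have \<delta>: "\<delta> > 0" "2 * \<delta> \<le> d1" "2 * \<delta> \<le> d2" using d1 d2 by (simp_all add: \<delta>_def)
    have "\<bar>\<rho> (a + z) - \<rho> a - (D a z + 1 / 2 * E p z z)\<bar> \<le> \<epsilon> * (norm z)\<^sup>2"
      if a: "norm (a - p) < \<delta>" and z: "norm z < \<delta>" for a z
    proof -
      have near: "dist (a + t *\<^sub>R z) p < 2 * \<delta>" if t: "0 \<le> t" "t \<le> 1" for t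
      proof -
        have "norm (a + t *\<^sub>R z - p) \<le> norm (a - p) + norm (t *\<^sub>R z)"
          using norm_triangle_ineq[of "a - p" "t *\<^sub>R z"] by (simp add: algebra_simps)
        also have "norm (t *\<^sub>R z) \<le> 1 * norm z" using t by (simp add: mult_left_le_one_le)
        finally show ?thesis using a z by (simp add: dist_norm)
      qed
      have inU: "a + t *\<^sub>R z \<in> U" if "0 \<le> t" "t \<le> 1" for t
        using near[OF that] \<delta> d2(2) by (auto simp: dist_commute)
      define g where "g = (\<lambda>m t. if m = 0 then \<rho> (a + t *\<^sub>R z) else if m = Suc 0 then dir_deriv \<rho> (a + t *\<^sub>R z) z
        else E (a + t *\<^sub>R z) z z)"
      have der: "\<forall>m t. m < 2 \<and> 0 \<le> t \<and> t \<le> 1 \<longrightarrow> (g m has_real_derivative g (Suc m) t) (at t)"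
      proof (intro allI impI, elim conjE)
        fix m :: nat and t :: real assume m: "m < 2" and t: "0 \<le> t" "t \<le> 1"
        have q: "(\<lambda>r. (1 / r) *\<^sub>R (u (a + (t + r) *\<^sub>R z) - u (a + t *\<^sub>R z))) = diff_quot u (a + t *\<^sub>R z) z"
          for u :: "'a \<Rightarrow> real"
          unfolding diff_quot_def[abs_def] by (simp add: scaleR_add_left add.assoc)
        consider "m = 0" | "m = Suc 0" using m by linarith
        then show "(g m has_real_derivative g (Suc m) t) (at t)"
        proof cases
          case 1
          have "((\<lambda>t. \<rho> (a + t *\<^sub>R z)) has_vector_derivative D (a + t *\<^sub>R z) z) (at t)"
            unfolding has_vector_derivative_iff_quotient q by (rule D[OF inU[OF t]])
          then show ?thesis unfolding 1 g_def
            by (simp add: has_real_derivative_iff_has_vector_derivative dir_deriv_eq[OF D[OF inU[OF t]]])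
        next
          case 2
          have "((\<lambda>t. dir_deriv \<rho> (a + t *\<^sub>R z) z) has_vector_derivative E (a + t *\<^sub>R z) z z) (at t)"
            unfolding has_vector_derivative_iff_quotient q[of "\<lambda>q. dir_deriv \<rho> q z"] by (rule E[OF inU[OF t]])
          then show ?thesis unfolding 2 g_def by (simp add: has_real_derivative_iff_has_vector_derivative)
        qed
      qed
      obtain t where t: "0 < t" "t < 1" "g 0 1 = (\<Sum>m<2. g m 0 / fact m * 1 ^ m) + g 2 t / fact 2 * 1 ^ 2"
        using Maclaurin[of 1 2 g "g 0"] der by auto
      have "(\<Sum>m<2. g m 0 / fact m * 1 ^ m) = \<rho> a + D a z"
        using dir_deriv_eq[OF D[OF inU[of 0]], of z] by (simp add: g_def numeral_2_eq_2)
      then have "\<rho> (a + z) - \<rho> a - (D a z + 1 / 2 * E p z z) = 1 / 2 * (E (a + t *\<^sub>R z) - E p) z z"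
        using t(3) by (simp add: g_def blinfun.diff_left)
      also have "\<bar>\<dots>\<bar> \<le> norm (E (a + t *\<^sub>R z) - E p) * (norm z)\<^sup>2"
      proof -
        have "\<bar>(E (a + t *\<^sub>R z) - E p) z z\<bar> \<le> norm ((E (a + t *\<^sub>R z) - E p) z) * norm z"
          using norm_blinfun[of "(E (a + t *\<^sub>R z) - E p) z" z] by simp
        also have "\<dots> \<le> (norm (E (a + t *\<^sub>R z) - E p) * norm z) * norm z"
          by (intro mult_right_mono norm_blinfun) simp
        finally have "\<bar>(E (a + t *\<^sub>R z) - E p) z z\<bar> \<le> norm (E (a + t *\<^sub>R z) - E p) * (norm z)\<^sup>2"
          by (simp add: power2_eq_square mult.assoc)
        then show ?thesis using abs_ge_zero[of "(E (a + t *\<^sub>R z) - E p) z z"] by (simp add: abs_mult)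
      qed
      also have "\<dots> \<le> \<epsilon> * (norm z)\<^sup>2"
        using d1(2)[of "a + t *\<^sub>R z"] near[of t] t \<delta> by (intro mult_right_mono) (simp_all add: dist_norm)
      finally show ?thesis .
    qed
    then show "\<exists>\<delta>>0. \<forall>a z. norm (a - p) < \<delta> \<longrightarrow> norm z < \<delta> \<longrightarrow>
      \<bar>\<rho> (a + z) - \<rho> a - (D a z + 1 / 2 * E p z z)\<bar> \<le> \<epsilon> * (norm z)\<^sup>2"
      using \<delta>(1) by blast
  qed
qed

text \<open>A real symmetric bilinear form \<open>b\<close> is the real part of the sum of a complex bilinear form and a
  hermitian form; on the diagonal the latter is the Levi form when \<open>b\<close> is half the second derivative.\<close>

definition bilinear_part :: "('a::complex_normed_vector \<Rightarrow> 'a \<Rightarrow> real) \<Rightarrow> 'a \<Rightarrow> 'a \<Rightarrow> complex"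
  where "bilinear_part b v w = Complex ((b v w - b (\<i> *\<^sub>C v) (\<i> *\<^sub>C w)) / 2) (- (b v (\<i> *\<^sub>C w) + b (\<i> *\<^sub>C v) w) / 2)"

definition hermitian_part :: "('a::complex_normed_vector \<Rightarrow> 'a \<Rightarrow> real) \<Rightarrow> 'a \<Rightarrow> 'a \<Rightarrow> complex"
  where "hermitian_part b v w = Complex ((b v w + b (\<i> *\<^sub>C v) (\<i> *\<^sub>C w)) / 2) (- (b v (\<i> *\<^sub>C w) - b (\<i> *\<^sub>C v) w) / 2)"

lemma half_sum_bound:
  fixes T :: real
  assumes "\<bar>x\<bar> \<le> T" "\<bar>y\<bar> \<le> T"
  shows "\<bar>(x + y) / 2\<bar> \<le> T" "\<bar>(x - y) / 2\<bar> \<le> T" "\<bar>- (x + y) / 2\<bar> \<le> T" "\<bar>- (x - y) / 2\<bar> \<le> T"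
  using assms by (auto simp: abs_le_iff)

context
  fixes b :: "'a::complex_normed_vector \<Rightarrow> 'a \<Rightarrow> real" and K :: real
  assumes add: "\<And>x y w. b (x + y) w = b x w + b y w" and scale: "\<And>r x w. b (r *\<^sub>R x) w = r * b x w"
    and sym: "\<And>x y. b x y = b y x" and le: "\<And>x y. \<bar>b x y\<bar> \<le> K * norm x * norm y"
begin

lemma form_right: "b w (x + y) = b w x + b w y" "b w (r *\<^sub>R x) = r * b w x" "b (- x) w = - b x w" "b w (- x) = - b w x"
  using add scale sym scale[of "-1"] by (metis, metis, simp, metis scaleR_minus1_left mult_minus1)

lemma form_i_le: "\<bar>b (\<i> *\<^sub>C x) y\<bar> \<le> K * norm x * norm y" "\<bar>b x (\<i> *\<^sub>C y)\<bar> \<le> K * norm x * norm y"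
  "\<bar>b (\<i> *\<^sub>C x) (\<i> *\<^sub>C y)\<bar> \<le> K * norm x * norm y"
  using le[of "\<i> *\<^sub>C x" y] le[of x "\<i> *\<^sub>C y"] le[of "\<i> *\<^sub>C x" "\<i> *\<^sub>C y"] by (simp_all add: norm_scaleC)

lemma bilinear_part_le: "cmod (bilinear_part b v w) \<le> 2 * K * norm v * norm w"
proof -
  have "cmod (bilinear_part b v w) \<le> \<bar>Re (bilinear_part b v w)\<bar> + \<bar>Im (bilinear_part b v w)\<bar>" by (rule cmod_le)
  also have "\<dots> \<le> 2 * (K * norm v * norm w)"
    unfolding bilinear_part_def complex.sel mult_2
    by (intro add_mono half_sum_bound le form_i_le)
  finally show ?thesis by simp
qed

lemma hermitian_part_le: "cmod (hermitian_part b v w) \<le> 2 * K * norm v * norm w"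
proof -
  have "cmod (hermitian_part b v w) \<le> \<bar>Re (hermitian_part b v w)\<bar> + \<bar>Im (hermitian_part b v w)\<bar>" by (rule cmod_le)
  also have "\<dots> \<le> 2 * (K * norm v * norm w)"
    unfolding hermitian_part_def complex.sel mult_2
    by (intro add_mono half_sum_bound le form_i_le)
  finally show ?thesis by simp
qed

lemma clinear_bilinear_part: "clinear (bilinear_part b v)" "clinear (\<lambda>v. bilinear_part b v w)"
proof -
  show "clinear (bilinear_part b v)"
  proof (rule clinear_of_ii, rule linearI)
    show "bilinear_part b v (x + y) = bilinear_part b v x + bilinear_part b v y" for x y
      by (simp add: bilinear_part_def complex_eq_iff form_right scaleC_add_right add_divide_distrib diff_divide_distrib)
    show "bilinear_part b v (r *\<^sub>R x) = r *\<^sub>R bilinear_part b v x" for r x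
      by (simp add: bilinear_part_def complex_eq_iff form_right scaleC_scaleR_commute algebra_simps)
    show "bilinear_part b v (\<i> *\<^sub>C x) = \<i> *\<^sub>C bilinear_part b v x" for x
      by (simp add: bilinear_part_def complex_eq_iff form_right scaleC_ii) (simp add: field_simps)
  qed
  show "clinear (\<lambda>v. bilinear_part b v w)"
  proof (rule clinear_of_ii, rule linearI)
    show "bilinear_part b (x + y) w = bilinear_part b x w + bilinear_part b y w" for x y
      by (simp add: bilinear_part_def complex_eq_iff add scaleC_add_right add_divide_distrib diff_divide_distrib)
    show "bilinear_part b (r *\<^sub>R x) w = r *\<^sub>R bilinear_part b x w" for r x
      by (simp add: bilinear_part_def complex_eq_iff scale scaleC_scaleR_commute algebra_simps)
    show "bilinear_part b (\<i> *\<^sub>C x) w = \<i> *\<^sub>C bilinear_part b x w" for x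
      by (simp add: bilinear_part_def complex_eq_iff form_right scaleC_ii) (simp add: field_simps)
  qed
qed

lemma hermitian_form_hermitian_part: "hermitian_form (hermitian_part b)"
  unfolding hermitian_form_def
proof (intro conjI allI)
  show "clinear (hermitian_part b v)" for v
  proof (rule clinear_of_ii, rule linearI)
    show "hermitian_part b v (x + y) = hermitian_part b v x + hermitian_part b v y" for x y
      by (simp add: hermitian_part_def complex_eq_iff form_right scaleC_add_right add_divide_distrib diff_divide_distrib)
    show "hermitian_part b v (r *\<^sub>R x) = r *\<^sub>R hermitian_part b v x" for r x
      by (simp add: hermitian_part_def complex_eq_iff form_right scaleC_scaleR_commute algebra_simps)
    show "hermitian_part b v (\<i> *\<^sub>C x) = \<i> *\<^sub>C hermitian_part b v x" for x
      by (simp add: hermitian_part_def complex_eq_iff form_right scaleC_ii) (simp add: field_simps)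
  qed
  show "hermitian_part b v w = cnj (hermitian_part b w v)" for v w
    using sym[of w v] sym[of "\<i> *\<^sub>C w" "\<i> *\<^sub>C v"] sym[of w "\<i> *\<^sub>C v"] sym[of "\<i> *\<^sub>C w" v]
    by (simp add: hermitian_part_def complex_eq_iff) (simp add: field_simps)
  show "\<exists>K. \<forall>v w. cmod (hermitian_part b v w) \<le> K * norm v * norm w"
    using hermitian_part_le by blast
qed

lemma bounded_bilinear_bilinear_part: "bounded_bilinear (bilinear_part b)"
proof
  fix v v' w w' r
  show "bilinear_part b (v + v') w = bilinear_part b v w + bilinear_part b v' w"
    "bilinear_part b v (w + w') = bilinear_part b v w + bilinear_part b v w'"
    by (simp_all add: clinear_add[OF clinear_bilinear_part(1)] clinear_add[OF clinear_bilinear_part(2)])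
  show "bilinear_part b (r *\<^sub>R v) w = r *\<^sub>R bilinear_part b v w" "bilinear_part b v (r *\<^sub>R w) = r *\<^sub>R bilinear_part b v w"
    using linear_scale[OF clinear_linear[OF clinear_bilinear_part(1)]]
      linear_scale[OF clinear_linear[OF clinear_bilinear_part(2)]] by simp_all
  show "\<exists>K. \<forall>v w. norm (bilinear_part b v w) \<le> norm v * norm w * K"
    using bilinear_part_le by (intro exI[of _ "2 * K"]) (simp add: ac_simps)
qed

lemma Re_parts: "Re (bilinear_part b z z) + Re (hermitian_part b z z) = b z z"
  by (simp add: bilinear_part_def hermitian_part_def field_simps)

end

lemma strongly_pseudoconvex_local_model:
  fixes \<Omega> :: "'h::complex_hilbert set"
  assumes \<Omega>: "open \<Omega>" and spc: "strongly_pseudoconvex_at \<Omega> p"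
  shows "\<exists>\<rho> ll Q L e \<alpha> M C d0. local_model \<Omega> p \<rho> ll Q L e \<alpha> M C d0"
proof -
  obtain U \<rho> C where U: "open U" "p \<in> U" and C2: "C2_on \<rho> U" and pf: "p \<in> frontier \<Omega>"
    and \<Omega>U: "\<Omega> \<inter> U = {z \<in> U. \<rho> z < 0}" and fr: "frontier \<Omega> \<inter> U = {z \<in> U. \<rho> z = 0}"
    and nz: "\<forall>q \<in> frontier \<Omega> \<inter> U. \<exists>v. dir_deriv \<rho> q v \<noteq> 0" and C: "C > 0"
    and levi: "\<And>v. del (\<lambda>z. complex_of_real (\<rho> z)) p v = 0 \<Longrightarrow> levi_form \<rho> p v \<ge> C * (norm v)\<^sup>2"
    using spc unfolding strongly_pseudoconvex_at_def by blast
  obtain D :: "'h \<Rightarrow> 'h \<Rightarrow>\<^sub>L real" and B :: "'h \<Rightarrow>\<^sub>L 'h \<Rightarrow>\<^sub>L real"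
    where D: "\<And>x v. x \<in> U \<Longrightarrow> (diff_quot \<rho> x v \<longlongrightarrow> blinfun_apply (D x) v) (at 0)"
    and B: "\<And>v w. dir_deriv2 \<rho> p v w = blinfun_apply (blinfun_apply B v) w" and cD: "isCont D p"
    and tay: "\<And>\<epsilon>. \<epsilon> > 0 \<Longrightarrow> \<exists>\<delta>>0. \<forall>a z. norm (a - p) < \<delta> \<longrightarrow> norm z < \<delta> \<longrightarrow>
      \<bar>\<rho> (a + z) - \<rho> a - (blinfun_apply (D a) z + 1 / 2 * blinfun_apply (blinfun_apply B z) z)\<bar> \<le> \<epsilon> * (norm z)\<^sup>2"
    by (rule C2_on_second_order[OF U C2]) blast
  have \<rho>p: "\<rho> p = 0" using fr pf U by blast
  \<comment> \<open>Half the second derivative, symmetrized so that it splits into bilinear and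
    hermitian parts; its diagonal, which enters the Taylor and Levi forms, is unchanged.\<close>
  define b where "b = (\<lambda>v w. (B v w + B w v) / 4)"
  have b_add: "b (x + y) w = b x w + b y w" and b_scale: "b (r *\<^sub>R x) w = r * b x w" and b_sym: "b x w = b w x" for x y w r
    by (simp_all add: b_def blinfun.bilinear_simps field_simps)
  have B_le: "\<bar>B v w\<bar> \<le> norm B * norm v * norm w" for v w
  proof -
    have "\<bar>B v w\<bar> \<le> norm (B v) * norm w" using norm_blinfun[of "B v" w] by simp
    also have "\<dots> \<le> norm B * norm v * norm w" by (intro mult_right_mono norm_blinfun) simp
    finally show ?thesis .
  qed
  have b_le: "\<bar>b v w\<bar> \<le> norm B * norm v * norm w" for v w
    using B_le[of v w] B_le[of w v] by (simp add: b_def ac_simps)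
  \<comment> \<open>The complex linear functional with real part \<open>D a\<close>. At
    \<open>p\<close> its kernel is the complex tangent space, and its Riesz vector \<open>y\<close>
    supplies the unit normal \<open>e\<close> and the factor \<open>norm y\<close>.\<close>
  define ll where "ll = (\<lambda>a z. Complex (D a z) (- D a (\<i> *\<^sub>C z)))"
  have lin_ll: "clinear (ll a)" for a
    by (rule clinear_of_ii, rule linearI)
      (simp_all add: ll_def complex_eq_iff blinfun.bilinear_simps scaleC_add_right scaleC_scaleR_commute scaleC_ii)
  have ll_diff: "cmod (ll a z - ll a' z) \<le> 2 * norm (D a - D a') * norm z" for a a' z
  proof -
    have "cmod (ll a z - ll a' z) \<le> \<bar>(D a - D a') z\<bar> + \<bar>(D a - D a') (\<i> *\<^sub>C z)\<bar>"
      using cmod_le[of "ll a z - ll a' z"] by (simp add: ll_def blinfun.diff_left abs_minus_commute)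
    also have "\<dots> \<le> norm (D a - D a') * norm z + norm (D a - D a') * norm z"
      using norm_blinfun[of "D a - D a'" z] norm_blinfun[of "D a - D a'" "\<i> *\<^sub>C z"]
      unfolding norm_scaleC norm_ii mult_1_left real_norm_def by (rule add_mono)
    finally show ?thesis by linarith
  qed
  have bnd_ll: "cmod (ll a z) \<le> 2 * norm (D a) * norm z" for a z
  proof -
    have "cmod (ll a z) \<le> \<bar>D a z\<bar> + \<bar>D a (\<i> *\<^sub>C z)\<bar>" using cmod_le[of "ll a z"] by (simp add: ll_def)
    also have "\<dots> \<le> norm (D a) * norm z + norm (D a) * norm z"
      using norm_blinfun[of "D a" z] norm_blinfun[of "D a" "\<i> *\<^sub>C z"]
      unfolding norm_scaleC norm_ii mult_1_left real_norm_def by (rule add_mono)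
    finally show ?thesis by linarith
  qed
  obtain y where y: "\<And>z. ll p z = cinner y z" using Riesz_representation[OF lin_ll bnd_ll] by metis
  have "y \<noteq> 0"
  proof
    assume "y = 0"
    then have "D p v = 0" for v using y[of v] by (simp add: ll_def complex_eq_iff)
    moreover obtain v where "dir_deriv \<rho> p v \<noteq> 0" using nz pf U by blast
    ultimately show False using dir_deriv_eq[OF D[OF U(2)], of v] by simp
  qed
  then have ny: "norm y > 0" by simp
  define e where "e = (1 / norm y) *\<^sub>R y"
  define M where "M = 2 * norm B + 1"
  obtain d0 where d0: "d0 > 0" "ball p d0 \<subseteq> U" using U open_contains_ball by blast
  have Dc: "(diff_quot (\<lambda>z. complex_of_real (\<rho> z)) p v \<longlongrightarrow> of_real (D p v)) (at 0)" for v
  proof -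
    have "diff_quot (\<lambda>z. complex_of_real (\<rho> z)) p v = (\<lambda>r. complex_of_real (diff_quot \<rho> p v r))"
      by (simp add: diff_quot_def fun_eq_iff scaleR_conv_of_real)
    then show ?thesis using tendsto_of_real[OF D[OF U(2)]] by simp
  qed
  \<comment> \<open>Continuity is read off from the expansion with centre \<open>p\<close> and
    \<open>\<epsilon> = 1\<close>.\<close>
  have contr: "isCont \<rho> p"
  proof -
    obtain \<delta> where \<delta>: "\<delta> > 0" and t1: "\<And>z. norm z < \<delta> \<Longrightarrow> \<bar>\<rho> (p + z) - \<rho> p - (D p z + 1 / 2 * B z z)\<bar> \<le> 1 * (norm z)\<^sup>2"
      using tay[of 1] by (metis norm_zero diff_self zero_less_one)
    have bnd: "norm (\<rho> (p + z) - \<rho> p) \<le> norm (D p) * norm z + (norm B + 1) * (norm z)\<^sup>2" if "norm z < \<delta>" for z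
    proof -
      have "\<bar>D p z\<bar> \<le> norm (D p) * norm z" using norm_blinfun[of "D p" z] by simp
      moreover have "\<bar>B z z\<bar> \<le> norm B * (norm z)\<^sup>2" using B_le[of z z] by (simp add: power2_eq_square mult.assoc)
      ultimately show ?thesis using t1[OF that] by (simp add: distrib_right)
    qed
    have "isCont (\<lambda>z::'h. norm (D p) * norm z + (norm B + 1) * (norm z)\<^sup>2) 0"
      by (intro continuous_intros)
    then have l0: "((\<lambda>z::'h. norm (D p) * norm z + (norm B + 1) * (norm z)\<^sup>2) \<longlongrightarrow> 0) (at 0)"
      by (simp add: isCont_def)
    have "\<forall>\<^sub>F z in at 0. z \<in> ball (0::'h) \<delta>" using \<delta> by (intro eventually_at_in_open') auto
    then have "\<forall>\<^sub>F z in at 0. norm (\<rho> (p + z) - \<rho> p) \<le> norm (D p) * norm z + (norm B + 1) * (norm z)\<^sup>2"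
      by eventually_elim (use bnd in simp)
    then have "((\<lambda>z. \<rho> (p + z) - \<rho> p) \<longlongrightarrow> 0) (at 0)" by (rule Lim_null_comparison[OF _ l0])
    then show ?thesis unfolding isCont_iff by (rule LIM_zero_cancel)
  qed
  have "local_model \<Omega> p \<rho> ll (bilinear_part b) (hermitian_part b) e (norm y) M C d0"
  proof (rule local_model.intro)
    show "clinear (ll a)" for a by (rule lin_ll)
    show "bounded_linear (ll a)" for a by (rule bounded_linear_of_clinear[OF lin_ll bnd_ll])
    show "\<exists>\<delta>>0. \<forall>a. norm (a - p) < \<delta> \<longrightarrow> (\<forall>z. cmod (ll a z - ll p z) \<le> \<eta> * norm z)" if \<eta>: "\<eta> > 0" for \<eta>
    proof -
      have "\<eta> / 2 > 0" using \<eta> by simp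
      then obtain \<delta> where \<delta>: "\<delta> > 0" "\<And>a. dist a p < \<delta> \<Longrightarrow> dist (D a) (D p) < \<eta> / 2"
        using cD unfolding continuous_at_eps_delta by metis
      have "cmod (ll a z - ll p z) \<le> \<eta> * norm z" if "norm (a - p) < \<delta>" for a z
        using \<delta>(2)[of a] that by (intro order_trans[OF ll_diff] mult_right_mono) (simp_all add: dist_norm)
      then show ?thesis using \<delta>(1) by blast
    qed
    show "ll p z = of_real (norm y) * cinner e z" for z using ny by (simp add: y e_def cinner_scaleR_left)
    show "norm y > 0" "norm e = 1" using ny by (simp_all add: e_def)
    show "bounded_bilinear (bilinear_part b)" "clinear (bilinear_part b v)" "clinear (\<lambda>v. bilinear_part b v w)"
      "hermitian_form (hermitian_part b)" for v w
      using b_add b_scale b_sym b_le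
      by (rule bounded_bilinear_bilinear_part clinear_bilinear_part hermitian_form_hermitian_part)+
    have MM: "2 * norm B * norm v * norm w \<le> M * norm v * norm w" for v w :: 'h
      unfolding M_def by (intro mult_right_mono) auto
    show "cmod (bilinear_part b v w) \<le> M * norm v * norm w" "cmod (hermitian_part b v w) \<le> M * norm v * norm w" for v w
      using bilinear_part_le[OF b_add b_scale b_sym b_le, of v w] hermitian_part_le[OF b_add b_scale b_sym b_le, of v w] MM[of v w]
      by linarith+
    show "M > 0" unfolding M_def by (rule add_nonneg_pos) auto
    show "C > 0" by (rule C)
    show "C * (norm v)\<^sup>2 \<le> Re (hermitian_part b v v)" if "cinner e v = 0" for v
    proof -
      have "cinner y v = 0" using that ny by (simp add: e_def cinner_scaleR_left)
      then have "ll p v = 0" by (simp add: y)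
      then have "D p v = 0" "D p (\<i> *\<^sub>C v) = 0" by (simp_all add: ll_def complex_eq_iff)
      then have "del (\<lambda>z. complex_of_real (\<rho> z)) p v = 0" unfolding del_def dir_deriv_eq[OF Dc] by simp
      then have "C * (norm v)\<^sup>2 \<le> levi_form \<rho> p v" by (rule levi)
      also have "levi_form \<rho> p v = Re (hermitian_part b v v)"
        by (simp add: levi_form_def B hermitian_part_def b_def field_simps)
      finally show ?thesis .
    qed
    show "\<exists>\<delta>>0. \<forall>a z. norm (a - p) < \<delta> \<longrightarrow> norm z < \<delta> \<longrightarrow>
      \<bar>\<rho> (a + z) - \<rho> a - (Re (ll a z) + Re (bilinear_part b z z) + Re (hermitian_part b z z))\<bar> \<le> \<epsilon> * (norm z)\<^sup>2"
      if "\<epsilon> > 0" for \<epsilon>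
    proof -
      have "Re (ll a z) + Re (bilinear_part b z z) + Re (hermitian_part b z z) = D a z + 1 / 2 * B z z" for a z
        using Re_parts[OF b_add b_scale b_sym b_le, of z] by (simp add: ll_def b_def)
      then show ?thesis using tay[OF that] by simp
    qed
    show "\<rho> p = 0" "isCont \<rho> p" "d0 > 0" "open \<Omega>" by (rule \<rho>p contr d0(1) \<Omega>)+
    show "z \<in> \<Omega> \<longleftrightarrow> \<rho> z < 0" if "z \<in> ball p d0" for z using that d0(2) \<Omega>U by blast
  qed
  then show ?thesis by blast
qed

section \<open>Convergence of the rescaled automorphisms\<close>

lemma funpow_pos:
  assumes "\<And>x::real. x > 0 \<Longrightarrow> h x > 0 \<and> h x \<le> x" "x > 0"
  shows "(h ^^ n) x > 0 \<and> (h ^^ n) x \<le> x"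
  using assms(2) by (induction n) (use assms(1) in \<open>force intro: order_trans\<close>)+

theorem theorem1p1:
  fixes \<Omega> :: "'h::complex_hilbert set"
    and p q :: 'h
    and \<phi> :: "nat \<Rightarrow> 'h \<Rightarrow> 'h"
  assumes "separable_space (euclidean :: 'h topology)"
    and "complex_domain \<Omega>"
    and "p \<in> frontier \<Omega>"
    and "strongly_pseudoconvex_at \<Omega> p"
    and "q \<in> \<Omega>"
    and "\<And>j. \<phi> j \<in> Aut \<Omega>"
    and "(\<lambda>j. norm (\<phi> j q - p)) \<longlonglongrightarrow> 0"
  shows "biholomorphic \<Omega> {z :: 'h. norm z < 1}"
proof -
  have \<Omega>: "open \<Omega>" "connected \<Omega>" using assms(2) by (simp_all add: complex_domain_def)
  obtain \<rho> ll Q L e \<alpha> M C d0 where lm: "local_model \<Omega> p \<rho> ll Q L e \<alpha> M C d0"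
    using strongly_pseudoconvex_local_model[OF \<Omega>(1) assms(4)] by blast
  obtain N c r where pk: "peak_point \<Omega> p N c r" using local_model.peak_exists[OF lm] by blast
  have aut: "bij_betw (\<phi> j) \<Omega> \<Omega>" "cdiff_on (\<phi> j) \<Omega>" "cdiff_on (inv_into \<Omega> (\<phi> j)) \<Omega>" for j
    using assms(6)[of j] holomorphic_map_on_imp_cdiff_on[OF _ \<Omega>(1)] by (auto simp: Aut_def biholomorphism_def)
  \<comment> \<open>The clause \<open>\<delta> \<le> \<epsilon>\<close> is included so that iterates
    of \<open>loc\<close> never exceed their starting value.\<close>
  define close where "close = (\<lambda>t \<epsilon> \<delta>. \<delta> > 0 \<and> \<delta> \<le> \<epsilon> \<and> (\<forall>(G :: 'h \<Rightarrow> 'h) x s. s > 0 \<longrightarrow> cdiff_on G (ball x s) \<longrightarrow>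
    (\<forall>y\<in>ball x s. G y \<in> \<Omega>) \<longrightarrow> norm (G x - p) < \<delta> \<longrightarrow> (\<forall>y\<in>ball x (t * s). norm (G y - p) < \<epsilon>)))"
  have close_ex: "\<exists>\<delta>. close t \<epsilon> \<delta>" if t: "t < 1" "\<epsilon> > 0" for t \<epsilon>
  proof -
    obtain \<delta> where "\<delta> > 0" and loc: "\<forall>(G :: 'h \<Rightarrow> 'h) x s. s > 0 \<longrightarrow> cdiff_on G (ball x s) \<longrightarrow>
    (\<forall>y\<in>ball x s. G y \<in> \<Omega>) \<longrightarrow> norm (G x - p) < \<delta> \<longrightarrow> (\<forall>y\<in>ball x (t * s). norm (G y - p) < \<epsilon>)"
      using peak_point.ball_localization[OF pk t, where 'g = 'h] by blast
    then have "close t \<epsilon> (min \<delta> \<epsilon>)" using t unfolding close_def by simp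
    then show ?thesis ..
  qed
  have closeD: "norm (G y - p) < \<epsilon>"
    if "close t \<epsilon> \<delta>" "s > 0" "cdiff_on G (ball x s)" "\<And>y. y\<in>ball x s \<Longrightarrow> G y \<in> \<Omega>" "norm (G x - p) < \<delta>" "y \<in> ball x (t * s)"
    for t \<epsilon> \<delta> s x y and G :: "'h \<Rightarrow> 'h"
    using that unfolding close_def by blast
  have close_pos: "\<delta> > 0" "\<delta> \<le> \<epsilon>" if "close t \<epsilon> \<delta>" for t \<epsilon> \<delta> using that unfolding close_def by blast+
  \<comment> \<open>One passage to half the radius. \<open>(loc ^^ n) d\<close> is the closeness to
    \<open>p\<close> that still guarantees distance below \<open>d\<close> after \<open>n\<close>
    passages.\<close>
  have "\<exists>loc. \<forall>\<epsilon>. \<epsilon> > 0 \<longrightarrow> close (1/2) \<epsilon> (loc \<epsilon>)"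
    by (intro choice allI) (use close_ex[of "1/2"] in auto)
  then obtain loc where loc: "\<And>\<epsilon>. \<epsilon> > 0 \<Longrightarrow> close (1/2) \<epsilon> (loc \<epsilon>)" by blast
  have loc_pos: "(loc ^^ n) x > 0" "(loc ^^ n) x \<le> x" if "x > 0" for n x
    using funpow_pos[of loc x n] close_pos[OF loc] that by blast+
  define \<epsilon> where "\<epsilon> = (\<lambda>n::nat. 1 / (real n + 2))"
  have \<epsilon>: "0 < \<epsilon> n" "\<epsilon> n < 1" for n by (simp_all add: \<epsilon>_def field_simps)
  \<comment> \<open>Three demands on the closeness of \<open>\<phi> j q\<close> to \<open>p\<close>:
    squeezing with defect \<open>\<epsilon> n\<close>, localization on relative radius
    \<open>1 - \<epsilon> n\<close> for \<open>overlap\<close>, and \<open>n\<close> halving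
    passages for \<open>exhaust\<close>.\<close>
  have "\<exists>j d \<Psi> \<Theta> \<delta>. d > 0 \<and> squeeze_pair (\<Omega> \<inter> ball p d) (1 - \<epsilon> n) (\<phi> j q) \<Psi> \<Theta> \<and> close (1 - \<epsilon> n) d \<delta> \<and>
    norm (\<phi> j q - p) < \<delta> \<and> norm (\<phi> j q - p) < (loc ^^ n) d" for n
  proof -
    obtain d \<delta> where d: "d > 0" "\<delta> > 0" and sq: "\<And>a. a \<in> \<Omega> \<Longrightarrow> norm (a - p) < \<delta> \<Longrightarrow>
      \<exists>\<Psi> \<Theta>. squeeze_pair (\<Omega> \<inter> ball p d) (1 - \<epsilon> n) a \<Psi> \<Theta>"
      using local_model.squeeze_maps[OF lm \<epsilon>] by blast
    obtain \<delta>' where \<delta>': "close (1 - \<epsilon> n) d \<delta>'" using close_ex[of "1 - \<epsilon> n" d] \<epsilon>[of n] d by auto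
    have "min \<delta> (min \<delta>' ((loc ^^ n) d)) > 0" using d close_pos[OF \<delta>'] loc_pos[OF d(1)] by simp
    from order_tendstoD(2)[OF assms(7) this] obtain j where j: "norm (\<phi> j q - p) < min \<delta> (min \<delta>' ((loc ^^ n) d))"
      by (meson eventually_sequentially order_refl)
    have "\<phi> j q \<in> \<Omega>" using aut(1)[of j] assms(5) by (auto simp: bij_betw_def)
    then obtain \<Psi> \<Theta> where "squeeze_pair (\<Omega> \<inter> ball p d) (1 - \<epsilon> n) (\<phi> j q) \<Psi> \<Theta>" using sq j by force
    then show ?thesis using d \<delta>' j by auto
  qed
  then obtain J d \<Psi> \<Theta> \<delta> where d: "\<And>n. d n > 0"
    and sq: "\<And>n. squeeze_pair (\<Omega> \<inter> ball p (d n)) (1 - \<epsilon> n) (\<phi> (J n) q) (\<Psi> n) (\<Theta> n)"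
    and cl: "\<And>n. close (1 - \<epsilon> n) (d n) (\<delta> n)" and near\<delta>: "\<And>n. norm (\<phi> (J n) q - p) < \<delta> n"
    and nearloc: "\<And>n. norm (\<phi> (J n) q - p) < (loc ^^ n) (d n)"
    by metis
  define \<psi> where "\<psi> = (\<lambda>n. \<phi> (J n))"
  define \<psi>' where "\<psi>' = (\<lambda>n. inv_into \<Omega> (\<phi> (J n)))"
  have \<psi>: "cdiff_on (\<psi> n) \<Omega>" "cdiff_on (\<psi>' n) \<Omega>" for n by (simp_all add: \<psi>_def \<psi>'_def aut)
  have \<psi>\<Omega>: "\<psi> n x \<in> \<Omega>" "\<psi>' n x \<in> \<Omega>" "\<psi> n (\<psi>' n x) = x" "\<psi>' n (\<psi> n x) = x" if "x \<in> \<Omega>" for n x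
    using that aut(1)[of "J n"] unfolding \<psi>_def \<psi>'_def bij_betw_def
    by (auto simp: inv_into_f_f f_inv_into_f inv_into_into)
  have \<Psi>: "cdiff_on (\<Psi> n) (\<Omega> \<inter> ball p (d n))" "\<Psi> n (\<psi> n q) = 0" "cdiff_on (\<Theta> n) (ball 0 (1 - \<epsilon> n))"
    and \<Psi>1: "\<And>z. z \<in> \<Omega> \<Longrightarrow> z \<in> ball p (d n) \<Longrightarrow> norm (\<Psi> n z) < 1"
    and \<Theta>: "\<And>y. norm y < 1 - \<epsilon> n \<Longrightarrow> \<Theta> n y \<in> \<Omega> \<and> \<Theta> n y \<in> ball p (d n) \<and> \<Psi> n (\<Theta> n y) = y"
    and \<Theta>\<Psi>: "\<And>z. z \<in> \<Omega> \<Longrightarrow> z \<in> ball p (d n) \<Longrightarrow> norm (\<Psi> n z) < 1 - \<epsilon> n \<Longrightarrow> \<Theta> n (\<Psi> n z) = z" for n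
    using sq[of n] unfolding squeeze_pair_def \<psi>_def by auto
  define V where "V = (\<lambda>n. {x \<in> \<Omega>. \<psi> n x \<in> ball p (d n)})"
  define f where "f = (\<lambda>n x. \<Psi> n (\<psi> n x))"
  define F where "F = (\<lambda>n y. \<psi>' n (\<Theta> n y))"
  have V_iff: "x \<in> V n \<longleftrightarrow> x \<in> \<Omega> \<and> norm (\<psi> n x - p) < d n" for n x
    by (auto simp: V_def dist_norm norm_minus_commute)
  have qV: "q \<in> V n" for n
    using assms(5) near\<delta>[of n] close_pos[OF cl, of n] by (simp add: V_iff \<psi>_def)
  have F\<Omega>: "F n y \<in> \<Omega>" "\<psi> n (F n y) = \<Theta> n y" if "norm y < 1 - \<epsilon> n" for n y
    using \<psi>\<Omega>[of "\<Theta> n y"] \<Theta>[OF that] by (auto simp: F_def)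
  have cf: "cdiff_on (f n) (V n)" for n unfolding f_def
    by (rule cdiff_on_compose[OF cdiff_on_subset[OF \<psi>(1)] \<Psi>(1)]) (use \<psi>\<Omega> in \<open>auto simp: V_def\<close>)
  have f1: "norm (f n x) < 1" if "x \<in> V n" for n x using \<Psi>1[of "\<psi> n x" n] \<psi>\<Omega> that by (auto simp: V_def f_def)
  have fq: "f n q = 0" for n by (simp add: f_def \<Psi>(2))
  have cF: "cdiff_on (F n) (ball 0 (1 - \<epsilon> n))" for n unfolding F_def
    by (rule cdiff_on_compose[OF \<Psi>(3) \<psi>(2)]) (use \<Theta> in auto)
  have FV: "F n y \<in> V n" and fF: "f n (F n y) = y" if "norm y < 1 - \<epsilon> n" for n y
    using F\<Omega>[OF that] \<Theta>[OF that] by (auto simp: V_def f_def)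
  have Ff: "F n (f n x) = x" if "x \<in> V n" "norm (f n x) < 1 - \<epsilon> n" for n x
    using \<Theta>\<Psi>[of "\<psi> n x" n] \<psi>\<Omega>[of x n] that by (auto simp: V_def f_def F_def)
  have F0: "F n 0 = q" for n using Ff[OF qV, of n] fq[of n] \<epsilon>[of n] by simp
  have oV: "open (V n)" for n
    using continuous_open_preimage[OF cdiff_on_continuous[OF \<psi>(1)[of n]] \<Omega>(1) open_ball, of p "d n"]
    by (simp add: V_def vimage_def Int_def)
  have overlap: "\<exists>N. \<forall>j\<ge>N. \<forall>k\<ge>N. r < 1 - \<epsilon> k \<and> (\<forall>y. norm y < r \<longrightarrow> F k y \<in> V j)" if r: "r < 1" for r
  proof -
    obtain N :: nat where N: "2 / (1 - r) < real N" using reals_Archimedean2 by blast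
    have \<epsilon>N: "\<epsilon> k < (1 - r) / 2" if "k \<ge> N" for k
    proof -
      have "2 / (1 - r) < real k + 2" using N that by linarith
      then show ?thesis using r by (simp add: \<epsilon>_def field_simps)
    qed
    have "r < 1 - \<epsilon> k \<and> (\<forall>y. norm y < r \<longrightarrow> F k y \<in> V j)" if jk: "j \<ge> N" "k \<ge> N" for j k
    proof (intro conjI allI impI)
      show "r < 1 - \<epsilon> k" using \<epsilon>N[OF jk(2)] r by (simp add: field_simps)
      fix y :: 'h assume y: "norm y < r"
      \<comment> \<open>Localization covers the fraction \<open>1 - \<epsilon> j\<close> of the ball
        of radius \<open>1 - \<epsilon> k\<close>; the product is still at least
        \<open>r\<close>.\<close>
      have rr: "r \<le> (1 - \<epsilon> j) * (1 - \<epsilon> k)"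
      proof -
        have "(1 - \<epsilon> j) * (1 - \<epsilon> k) = 1 - \<epsilon> j - \<epsilon> k + \<epsilon> j * \<epsilon> k" by (simp add: algebra_simps)
        moreover have "\<epsilon> j * \<epsilon> k \<ge> 0" using \<epsilon> by (simp add: less_imp_le)
        ultimately show ?thesis using \<epsilon>N[OF jk(1)] \<epsilon>N[OF jk(2)] by (simp add: field_simps)
      qed
      have "norm (\<psi> j (F k y) - p) < d j"
      proof (rule closeD[OF cl, where s="1 - \<epsilon> k" and x=0 and G="\<lambda>y. \<psi> j (F k y)"])
        show "cdiff_on (\<lambda>y. \<psi> j (F k y)) (ball 0 (1 - \<epsilon> k))"
          by (rule cdiff_on_compose[OF cF \<psi>(1)]) (use F\<Omega> in auto)
        show "\<psi> j (F k y) \<in> \<Omega>" if "y \<in> ball 0 (1 - \<epsilon> k)" for y using F\<Omega>(1)[of y k] \<psi>\<Omega>(1) that by simp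
        show "norm (\<psi> j (F k 0) - p) < \<delta> j" using near\<delta>[of j] by (simp add: F0 \<psi>_def)
      qed (use y rr \<epsilon>[of k] in auto)
      moreover have "norm y < 1 - \<epsilon> k" using y \<open>r < 1 - \<epsilon> k\<close> by simp
      ultimately show "F k y \<in> V j" using F\<Omega>(1) by (simp add: V_iff)
    qed
    then show ?thesis by blast
  qed
  \<comment> \<open>A point reached from \<open>q\<close> through \<open>m\<close> balls uses up \<open>m\<close> of the \<open>k\<close> localization steps granted by the choice of \<open>J k\<close>.\<close>
  define good where "good = (\<lambda>m N r x. m \<le> N \<and> r < (1::real) \<and>
    (\<forall>k\<ge>N. norm (\<psi> k x - p) < (loc ^^ (k - m)) (d k) \<and> norm (f k x) < r))"
  have step: "\<exists>m' N' r'. \<forall>y\<in>ball x (s / 2). y \<in> \<Omega> \<and> (\<forall>k\<ge>N'. y \<in> V k) \<and> good m' N' r' y"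
    if g: "good m N r x" and s: "s > 0" "ball x (2 * s) \<subseteq> \<Omega>" for m N r x s
  proof -
    \<comment> \<open>\<open>Harnack_vector\<close> gives the fraction 1/3; weakening it to 1/4
      makes the bound strict.\<close>
    define r' where "r' = 1 - (1 - r) / 4"
    have r: "r < 1" using g by (simp add: good_def)
    have near: "norm (\<psi> k y - p) < (loc ^^ (k - Suc m)) (d k)" if k: "k \<ge> Suc N" and y: "y \<in> ball x s" for k y
    proof (rule closeD[OF loc[OF loc_pos(1)[OF d]], where s="2 * s" and x=x and G="\<psi> k"])
      show "cdiff_on (\<psi> k) (ball x (2 * s))" by (rule cdiff_on_subset[OF \<psi>(1) s(2)])
      show "\<psi> k y \<in> \<Omega>" if "y \<in> ball x (2 * s)" for y using s(2) that \<psi>\<Omega>(1) by blast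
      have "m \<le> N" using g by (simp add: good_def)
      \<comment> \<open>From \<open>m \<le> N < k\<close> the truncated subtraction is exact, so one
        factor of \<open>loc\<close> can be split off.\<close>
      then have "k - m = Suc (k - Suc m)" using k by arith
      moreover have "norm (\<psi> k x - p) < (loc ^^ (k - m)) (d k)" using g k by (simp add: good_def)
      ultimately show "norm (\<psi> k x - p) < loc ((loc ^^ (k - Suc m)) (d k))" by simp
    qed (use s y in auto)
    have inV: "y \<in> V k" if k: "k \<ge> Suc N" and y: "y \<in> ball x s" for k y
    proof -
      have "y \<in> \<Omega>" using s y by auto
      then show ?thesis using near[OF that] loc_pos(2)[OF d, of "k - Suc m" k] by (simp add: V_iff)
    qed
    have fr: "norm (f k y) < r'" if k: "k \<ge> Suc N" and y: "y \<in> ball x (s / 2)" for k y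
    proof -
      have "norm (f k y) \<le> 1 - (1 - r) / 3"
      proof (rule Harnack_vector[OF _ s(1) _ _ y])
        show "cdiff_on (f k) (ball x s)" using inV[OF k] by (intro cdiff_on_subset[OF cf]) blast
        show "norm (f k y) \<le> 1" if "y \<in> ball x s" for y using f1[OF inV[OF k that]] by simp
        show "norm (f k x) \<le> r" using g k by (simp add: good_def less_imp_le)
      qed
      then show ?thesis using r by (simp add: r'_def field_simps)
    qed
    have "y \<in> \<Omega> \<and> (\<forall>k\<ge>Suc N. y \<in> V k) \<and> good (Suc m) (Suc N) r' y" if y: "y \<in> ball x (s / 2)" for y
    proof -
      have ys: "y \<in> ball x s" using y s by simp
      have "good (Suc m) (Suc N) r' y"
        using near[OF _ ys] fr[OF _ y] g r unfolding good_def r'_def by auto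
      then show ?thesis using inV[OF _ ys] s ys by auto
    qed
    then show ?thesis by blast
  qed
  \<comment> \<open>The points with eventual uniform control. \<open>A\<close> contains
    \<open>q\<close>, and both \<open>A\<close> and its complement in \<open>\<Omega>\<close> are
    open, so connectedness gives \<open>A = \<Omega>\<close>.\<close>
  define A where "A = {x \<in> \<Omega>. \<exists>m N r. good m N r x}"
  have qA: "q \<in> A"
  proof -
    have "good 0 0 (1/2) q" using nearloc fq by (simp add: good_def \<psi>_def)
    then show ?thesis using assms(5) unfolding A_def by blast
  qed
  have ball_sub: "\<exists>s>0. ball x (4 * s) \<subseteq> \<Omega>" if x: "x \<in> \<Omega>" for x
  proof -
    obtain s where "s > 0" "ball x s \<subseteq> \<Omega>" using x \<Omega>(1) open_contains_ball by blast
    then show ?thesis by (intro exI[of _ "s / 4"]) auto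
  qed
  have spread: "ball x (s / 2) \<subseteq> A" if "x \<in> A" "s > 0" "ball x (2 * s) \<subseteq> \<Omega>" for x s
  proof -
    obtain m N r where "good m N r x" using \<open>x \<in> A\<close> by (auto simp: A_def)
    from step[OF this that(2,3)] show ?thesis unfolding A_def by blast
  qed
  have sub2: "ball x (2 * s) \<subseteq> ball x (4 * s)" if "s > 0" for x :: 'h and s using that by (intro subset_ball) simp
  have "open A" unfolding open_contains_ball
  proof
    fix x assume x: "x \<in> A"
    then obtain s where s: "s > 0" "ball x (4 * s) \<subseteq> \<Omega>" using ball_sub by (auto simp: A_def)
    then have "ball x (s / 2) \<subseteq> A" using spread[OF x s(1)] sub2[OF s(1)] by blast
    then show "\<exists>e>0. ball x e \<subseteq> A" using s by (intro exI[of _ "s / 2"]) simp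
  qed
  moreover have "open (\<Omega> - A)" unfolding open_contains_ball
  proof
    fix x assume x: "x \<in> \<Omega> - A"
    then obtain s where s: "s > 0" "ball x (4 * s) \<subseteq> \<Omega>" using ball_sub by auto
    have "y \<in> \<Omega> - A" if y: "y \<in> ball x (s / 2)" for y
    proof
      show "y \<in> \<Omega>" using y s by auto
      show "y \<notin> A"
      proof
        assume yA: "y \<in> A"
        \<comment> \<open>Spreading from \<open>y\<close> would reach \<open>x\<close>; the radius
          \<open>4 * s\<close> around \<open>x\<close> leaves the room \<open>2 * s\<close> that
          this needs around \<open>y\<close>.\<close>
        have "ball y (2 * s) \<subseteq> \<Omega>"
        proof
          fix w assume "w \<in> ball y (2 * s)"
          then have "w \<in> ball x (4 * s)" using y s(1) dist_triangle[of x w y] by simp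
          then show "w \<in> \<Omega>" using s by blast
        qed
        then have "ball y (s / 2) \<subseteq> A" by (rule spread[OF yA s(1)])
        moreover have "x \<in> ball y (s / 2)" using y by (simp add: dist_commute)
        ultimately show False using x by blast
      qed
    qed
    then show "\<exists>e>0. ball x e \<subseteq> \<Omega> - A" using s by (intro exI[of _ "s / 2"]) auto
  qed
  ultimately have "A = \<Omega>"
    using connectedD[OF \<Omega>(2), of A "\<Omega> - A"] qA assms(5) unfolding A_def by blast
  \<comment> \<open>The condition \<open>exhaust\<close> is one more application of
    \<open>step\<close>, now available at every point because \<open>A = \<Omega>\<close>.\<close>
  interpret squeezing \<Omega> q V f F "\<lambda>n. 1 - \<epsilon> n"
  proof unfold_locales
    show "open \<Omega>" "q \<in> \<Omega>" by (rule \<Omega>(1), rule assms(5))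
    show "open (V k)" "V k \<subseteq> \<Omega>" "q \<in> V k" "cdiff_on (f k) (V k)" "f k q = 0" "0 < 1 - \<epsilon> k"
      "cdiff_on (F k) (ball 0 (1 - \<epsilon> k))" for k
      using oV qV cf fq cF \<epsilon>[of k] by (auto simp: V_iff)
    show "norm (f k x) < 1" if "x \<in> V k" for x k by (rule f1[OF that])
    show "F k y \<in> V k" "f k (F k y) = y" if "norm y < 1 - \<epsilon> k" for y k by (rule FV[OF that], rule fF[OF that])
    show "F k (f k x) = x" if "x \<in> V k" "norm (f k x) < 1 - \<epsilon> k" for x k by (rule Ff[OF that])
    show "\<exists>N. \<forall>j\<ge>N. \<forall>k\<ge>N. r < 1 - \<epsilon> k \<and> (\<forall>y. norm y < r \<longrightarrow> F k y \<in> V j)" if "r < 1" for r by (rule overlap[OF that])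
    show "\<exists>s>0. \<exists>r<1. \<exists>N. ball x s \<subseteq> \<Omega> \<and> (\<forall>k\<ge>N. \<forall>y\<in>ball x s. y \<in> V k \<and> norm (f k y) < r)" if x: "x \<in> \<Omega>" for x
    proof -
      obtain s where s: "s > 0" "ball x (4 * s) \<subseteq> \<Omega>" using ball_sub[OF x] by blast
      obtain m N r where "good m N r x" using x \<open>A = \<Omega>\<close> unfolding A_def by blast
      moreover have "ball x (2 * s) \<subseteq> \<Omega>" using s sub2[OF s(1)] by blast
      ultimately obtain m' N' r' where st: "\<forall>y\<in>ball x (s / 2). y \<in> \<Omega> \<and> (\<forall>k\<ge>N'. y \<in> V k) \<and> good m' N' r' y"
        using step s(1) by meson
      have "x \<in> ball x (s / 2)" using s(1) by simp
      then have "r' < 1" using st unfolding good_def by blast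
      moreover have "\<forall>k\<ge>N'. \<forall>y\<in>ball x (s / 2). y \<in> V k \<and> norm (f k y) < r'" using st unfolding good_def by blast
      ultimately show ?thesis using st s(1) by (intro exI[of _ "s / 2"] conjI exI[of _ r'] exI[of _ N']) auto
    qed
  qed
  show ?thesis by (rule biholomorphic_unit_ball)
qed

end
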